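(* Let $\mathscr F$ be an acceptable space of analytic functions on the unit disc $\mathbb D$ with values in a complex Banach space $\Sigma$. Then for every $n\ge1$ the space $\mathscr F^{(n)}$ is an acceptable space of analytic functions on $\mathbb D$ (with values in $\Sigma^n$). Moreover: (i) if $f\in\mathscr F$, then $\tau_{(n,0]}f\in\mathscr F^{(n)}$ and $\|\tau_{(n,0]}f\|_{\mathscr F^{(n)}}=\|f\|_{\mathscr F}$; (ii) the analytic family associated to $\mathscr F^{(n)}$ is the family of Rochberg spaces $(\mathscr F^{(n)}_z)_{z\in\mathbb D}$, up to equivalence of norms; that is, for every $z\in\mathbb D$ one has $\{F(z):F\in\mathscr F^{(n)}\}=\mathscr F^{(n)}_z$ as subspaces of $\Sigma^n$, and the quotient norm on the left is equivalent to the norm of $\mathscr F^{(n)}_z$.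
   Context: $A^\infty$ is the Fréchet algebra (pointwise product) of all analytic $f:\mathbb D\to\mathbb C$ whose Taylor coefficients $(c_j)_{j\ge0}$ at $0$ are rapidly decreasing, with the topology given by the norms $\sup_j|c_j|(j+1)^\alpha$, $\alpha>0$. An acceptable space on $\mathbb D$ with values in a complex Banach space $\Sigma$ is a Banach space $\mathscr F$ of analytic functions $f:\mathbb D\to\Sigma$ such that: (a) the evaluation maps $\delta_z:\mathscr F\to\Sigma$ are continuous for all $z\in\mathbb D$; (b) $\mathscr F$ is a module over $A^\infty$ under pointwise multiplication, with jointly continuous product $A^\infty\times\mathscr F\to\mathscr F$; (c) for each conformal automorphism $\varphi:\mathbb D\to\mathbb D$ there is a constant $K[\varphi]$ such that, for analytic $f:\mathbb D\to\Sigma$, $\varphi f\in\mathscr F$ if and only if $f\in\mathscr F$, and then $K[\varphi]^{-1}\|\varphi f\|_{\mathscr F}\le\|f\|_{\mathscr F}\le K[\varphi]\|\varphi f\|_{\mathscr F}$. Notation: $\tau_{(n,0]}f=\left(\frac{f^{(n-1)}}{(n-1)!},\dots,f',f\right)$ and $\tau_{[n,1]}f=\left(\frac{f^{(n)}}{n!},\dots,f'\right)$. Rochberg spaces: $\mathscr F^{(n)}_z=\{\tau_{(n,0]}f(z):f\in\mathscr F\}\subset\Sigma^n$ with the quotient norm $\|w\|=\inf\{\|f\|_{\mathscr F}:w=\tau_{(n,0]}f(z)\}$. Let $\mathscr H$ be the space of all analytic functions $\mathbb D\to\Sigma$. The spaces $\mathscr F^{(n)}\subset\mathscr H^n$ (no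 subscript) are defined inductively by $\mathscr F^{(1)}=\mathscr F$ and $$\mathscr F^{(n+1)}=\left\{(f_n,\dots,f_1,f)\in\mathscr H^{n+1}: f\in\mathscr F\text{ and }(f_n,\dots,f_1)-\tau_{[n,1]}f\in\mathscr F^{(n)}\right\},$$ with norm $\|(f_n,\dots,f_1,f)\|_{\mathscr F^{(n+1)}}=\|(f_n,\dots,f_1)-\tau_{[n,1]}f\|_{\mathscr F^{(n)}}+\|f\|_{\mathscr F}$. Elements of $\mathscr H^n$ are regarded as analytic functions $\mathbb D\to\Sigma^n$, $\Sigma^n$ having the sum norm. *)

theory Defs
  imports "HOL-Complex_Analysis.Complex_Analysis" "HOL-Library.Function_Algebras"
begin

section \<open>Complex Banach spaces\<close>

class scaleC =
  fixes scaleC :: "complex \<Rightarrow> 'a \<Rightarrow> 'a"  (infixr \<open>*\<^sub>C\<close> 75)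

class complex_vector = ab_group_add + scaleC +
  assumes scaleC_add_right: "a *\<^sub>C (x + y) = a *\<^sub>C x + a *\<^sub>C y"
    and scaleC_add_left: "(a + b) *\<^sub>C x = a *\<^sub>C x + b *\<^sub>C x"
    and scaleC_scaleC: "a *\<^sub>C (b *\<^sub>C x) = (a * b) *\<^sub>C x"
    and scaleC_one: "1 *\<^sub>C x = x"

global_interpretation complex_vector:
  vector_space "scaleC :: complex \<Rightarrow> 'a \<Rightarrow> 'a::complex_vector"
  by unfold_locales
    (simp_all add: scaleC_add_right scaleC_add_left scaleC_scaleC scaleC_one)

class complex_banach = complex_vector + banach +
  assumes scaleR_eq_scaleC: "scaleR r x = scaleC (complex_of_real r) x"
    and norm_scaleC: "norm (scaleC c x) = cmod c * norm x"

instantiation complex :: complex_banach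
begin
definition "scaleC c z = c * (z::complex)"
instance
  by standard
    (simp_all add: scaleC_complex_def algebra_simps norm_mult scaleR_conv_of_real)
end

instantiation "fun" :: (type, complex_vector) complex_vector
begin
definition "scaleC c f = (\<lambda>x. c *\<^sub>C f x)"
instance
  by standard
    (simp_all add: scaleC_fun_def fun_eq_iff
      scaleC_add_right scaleC_add_left scaleC_scaleC scaleC_one)
end

text \<open>
  Spaces of functions, and the powers of a Banach space, are subspaces of a type of class
  \<open>complex_vector\<close> carrying a norm of their own, so a complex Banach space is given by a carrier
  set and a norm function, which is only relevant on the carrier.
\<close>

text \<open>The value 0 off the carrier is needed because \<^locale>\<open>Metric_space\<close> demands nonnegativity
  everywhere.\<close>
definition norm_dist :: "'v::complex_vector set \<Rightarrow> ('v \<Rightarrow> real) \<Rightarrow> 'v \<Rightarrow> 'v \<Rightarrow> real" where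
  "norm_dist V N x y = (if x \<in> V \<and> y \<in> V then N (x - y) else 0)"

definition norm_topology :: "'v::complex_vector set \<Rightarrow> ('v \<Rightarrow> real) \<Rightarrow> 'v topology" where
  "norm_topology V N = Metric_space.mtopology V (norm_dist V N)"

definition complex_banach_on :: "'v::complex_vector set \<Rightarrow> ('v \<Rightarrow> real) \<Rightarrow> bool" where
  "complex_banach_on V N \<longleftrightarrow>
     complex_vector.subspace V \<and>
     (\<forall>x\<in>V. 0 \<le> N x \<and> (N x = 0 \<longleftrightarrow> x = 0)) \<and>
     (\<forall>c. \<forall>x\<in>V. N (c *\<^sub>C x) = cmod c * N x) \<and>
     (\<forall>x\<in>V. \<forall>y\<in>V. N (x + y) \<le> N x + N y) \<and>
     Metric_space.mcomplete V (norm_dist V N)"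

definition equivalent_norms_on :: "'v set \<Rightarrow> ('v \<Rightarrow> real) \<Rightarrow> ('v \<Rightarrow> real) \<Rightarrow> bool" where
  "equivalent_norms_on V N N' \<longleftrightarrow>
     (\<exists>c>0. \<exists>C>0. \<forall>x\<in>V. c * N x \<le> N' x \<and> N' x \<le> C * N x)"


section \<open>Analytic functions on the unit disc\<close>

text \<open>A function on the disc is represented by its extension by 0 to all of \<open>\<complex>\<close>.\<close>

abbreviation unit_disc :: "complex set" where
  "unit_disc \<equiv> ball 0 1"

definition analytic_on_disc ::
    "'v::complex_vector set \<Rightarrow> ('v \<Rightarrow> real) \<Rightarrow> (complex \<Rightarrow> 'v) set" where
  "analytic_on_disc V N =
     {f. (\<forall>z. z \<notin> unit_disc \<longrightarrow> f z = 0) \<and>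
         (\<forall>z\<in>unit_disc. f z \<in> V) \<and>
         (\<forall>a\<in>unit_disc. \<exists>r>0. \<exists>c. ball a r \<subseteq> unit_disc \<and> (\<forall>k. c k \<in> V) \<and>
            (\<forall>z\<in>ball a r.
               limitin (norm_topology V N) (\<lambda>m. \<Sum>k<m. (z - a) ^ k *\<^sub>C c k) (f z) sequentially))}"

definition pointwise_mult ::
    "(complex \<Rightarrow> complex) \<Rightarrow> (complex \<Rightarrow> 'v::complex_vector) \<Rightarrow> complex \<Rightarrow> 'v" where
  "pointwise_mult a f = (\<lambda>z. a z *\<^sub>C f z)"

definition conformal_automorphism :: "(complex \<Rightarrow> complex) \<Rightarrow> bool" where
  "conformal_automorphism \<phi> \<longleftrightarrow>
     \<phi> holomorphic_on unit_disc \<and> bij_betw \<phi> unit_disc unit_disc"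


section \<open>The algebra of functions with rapidly decreasing Taylor coefficients\<close>

definition taylor_coeff :: "(complex \<Rightarrow> complex) \<Rightarrow> nat \<Rightarrow> complex" where
  "taylor_coeff a j = (deriv ^^ j) a 0 / fact j"

definition A_infinity :: "(complex \<Rightarrow> complex) set" where
  "A_infinity =
     {a. (\<forall>z. z \<notin> unit_disc \<longrightarrow> a z = 0) \<and> a holomorphic_on unit_disc \<and>
         (\<forall>\<alpha>>0. bdd_above (range (\<lambda>j. cmod (taylor_coeff a j) * (real j + 1) powr \<alpha>)))}"

definition A_infinity_norm :: "real \<Rightarrow> (complex \<Rightarrow> complex) \<Rightarrow> real" where
  "A_infinity_norm \<alpha> a = (SUP j. cmod (taylor_coeff a j) * (real j + 1) powr \<alpha>)"

definition A_infinity_topology :: "(complex \<Rightarrow> complex) topology" where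
  "A_infinity_topology = topology_generated_by
     {{b \<in> A_infinity. A_infinity_norm \<alpha> (b - a) < \<epsilon>} | a \<alpha> \<epsilon>. a \<in> A_infinity \<and> \<alpha> > 0 \<and> \<epsilon> > 0}"


section \<open>Acceptable spaces\<close>

definition acceptable_space ::
    "'v::complex_vector set \<Rightarrow> ('v \<Rightarrow> real) \<Rightarrow>
     (complex \<Rightarrow> 'v) set \<Rightarrow> ((complex \<Rightarrow> 'v) \<Rightarrow> real) \<Rightarrow> bool" where
  "acceptable_space V N F NF \<longleftrightarrow>
     complex_banach_on V N \<and>
     complex_banach_on F NF \<and>
     F \<subseteq> analytic_on_disc V N \<and>
     (\<forall>z\<in>unit_disc. continuous_map (norm_topology F NF) (norm_topology V N) (\<lambda>f. f z)) \<and>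
     (\<forall>a\<in>A_infinity. \<forall>f\<in>F. pointwise_mult a f \<in> F) \<and>
     continuous_map (prod_topology A_infinity_topology (norm_topology F NF)) (norm_topology F NF)
       (\<lambda>(a, f). pointwise_mult a f) \<and>
     (\<forall>\<phi>. conformal_automorphism \<phi> \<longrightarrow>
        (\<exists>K>0. \<forall>f\<in>analytic_on_disc V N.
           (pointwise_mult \<phi> f \<in> F \<longleftrightarrow> f \<in> F) \<and>
           (f \<in> F \<longrightarrow>
              inverse K * NF (pointwise_mult \<phi> f) \<le> NF f \<and>
              NF f \<le> K * NF (pointwise_mult \<phi> f))))"

text \<open>The norm on the image of the normed space \<open>F\<close> under a linear map \<open>e\<close>.\<close>
definition quotient_norm :: "'f set \<Rightarrow> ('f \<Rightarrow> real) \<Rightarrow> ('f \<Rightarrow> 'w) \<Rightarrow> 'w \<Rightarrow> real" where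
  "quotient_norm F NF e w = Inf {NF f | f. f \<in> F \<and> w = e f}"

text \<open>The analytic family associated to a space of functions.\<close>
definition family_space :: "(complex \<Rightarrow> 'v) set \<Rightarrow> complex \<Rightarrow> 'v set" where
  "family_space F z = (\<lambda>f. f z) ` F"

definition family_norm ::
    "(complex \<Rightarrow> 'v) set \<Rightarrow> ((complex \<Rightarrow> 'v) \<Rightarrow> real) \<Rightarrow> complex \<Rightarrow> 'v \<Rightarrow> real" where
  "family_norm F NF z = quotient_norm F NF (\<lambda>f. f z)"


section \<open>Rochberg spaces\<close>

text \<open>
  The tuple \<open>(x\<^sub>n\<^sub>-\<^sub>1, \<dots>, x\<^sub>1, x\<^sub>0)\<close> is represented by the function \<open>x\<close> on the natural numbers
  with \<open>x i = x\<^sub>i\<close> for \<open>i < n\<close> and \<open>x i = 0\<close> for \<open>i \<ge> n\<close>. So the index of an entry is the order of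
  the derivative it stands for, and the rightmost entry has index 0.
\<close>

definition tuples :: "nat \<Rightarrow> (nat \<Rightarrow> 'a::zero) set" where
  "tuples n = {x. \<forall>i\<ge>n. x i = 0}"

definition tuple_norm :: "nat \<Rightarrow> (nat \<Rightarrow> 'a::real_normed_vector) \<Rightarrow> real" where
  "tuple_norm n x = (\<Sum>i<n. norm (x i))"

definition cderiv :: "(complex \<Rightarrow> 'a::complex_banach) \<Rightarrow> complex \<Rightarrow> 'a" where
  "cderiv f z =
     (if z \<in> unit_disc then THE d. (f has_derivative (\<lambda>h. h *\<^sub>C d)) (at z) else 0)"

text \<open>\<open>tau n\<close> is $\tau_{(n,0]}$ and \<open>tau_shift n\<close> is $\tau_{[n,1]}$.\<close>

definition tau :: "nat \<Rightarrow> (complex \<Rightarrow> 'a::complex_banach) \<Rightarrow> complex \<Rightarrow> nat \<Rightarrow> 'a" where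
  "tau n f z i = (if i < n then (1 / fact i) *\<^sub>C (cderiv ^^ i) f z else 0)"

definition tau_shift :: "nat \<Rightarrow> (complex \<Rightarrow> 'a::complex_banach) \<Rightarrow> complex \<Rightarrow> nat \<Rightarrow> 'a" where
  "tau_shift n f z i = (if i < n then (1 / fact (Suc i)) *\<^sub>C (cderiv ^^ Suc i) f z else 0)"

definition rochberg_space ::
    "(complex \<Rightarrow> 'a::complex_banach) set \<Rightarrow> nat \<Rightarrow> complex \<Rightarrow> (nat \<Rightarrow> 'a) set" where
  "rochberg_space F n z = (\<lambda>f. tau n f z) ` F"

definition rochberg_norm ::
    "(complex \<Rightarrow> 'a::complex_banach) set \<Rightarrow> ((complex \<Rightarrow> 'a) \<Rightarrow> real) \<Rightarrow>
     nat \<Rightarrow> complex \<Rightarrow> (nat \<Rightarrow> 'a) \<Rightarrow> real" where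
  "rochberg_norm F NF n z = quotient_norm F NF (\<lambda>f. tau n f z)"

text \<open>$\mathscr H^n$, with a tuple of functions written as a tuple-valued function.\<close>
definition analytic_tuples :: "nat \<Rightarrow> (complex \<Rightarrow> nat \<Rightarrow> 'a::complex_banach) set" where
  "analytic_tuples n =
     {G. (\<forall>i<n. (\<lambda>z. G z i) \<in> analytic_on_disc UNIV norm) \<and> (\<forall>z. G z \<in> tuples n)}"

definition tuple_last :: "(complex \<Rightarrow> nat \<Rightarrow> 'a) \<Rightarrow> complex \<Rightarrow> 'a" where
  "tuple_last G = (\<lambda>z. G z 0)"

definition tuple_init :: "(complex \<Rightarrow> nat \<Rightarrow> 'a) \<Rightarrow> complex \<Rightarrow> nat \<Rightarrow> 'a" where
  "tuple_init G = (\<lambda>z i. G z (Suc i))"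

text \<open>The spaces $\mathscr F^{(n)}$ are indexed from 1; the value at 0 is a dummy.\<close>

fun iterated_space ::
    "(complex \<Rightarrow> 'a::complex_banach) set \<Rightarrow> nat \<Rightarrow> (complex \<Rightarrow> nat \<Rightarrow> 'a) set" where
  "iterated_space F 0 = {0}"
| "iterated_space F (Suc 0) = {G \<in> analytic_tuples 1. tuple_last G \<in> F}"
| "iterated_space F (Suc (Suc n)) =
     {G \<in> analytic_tuples (Suc (Suc n)).
        tuple_last G \<in> F \<and>
        tuple_init G - tau_shift (Suc n) (tuple_last G) \<in> iterated_space F (Suc n)}"

fun iterated_norm ::
    "((complex \<Rightarrow> 'a::complex_banach) \<Rightarrow> real) \<Rightarrow> nat \<Rightarrow> (complex \<Rightarrow> nat \<Rightarrow> 'a) \<Rightarrow> real" where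
  "iterated_norm NF 0 G = 0"
| "iterated_norm NF (Suc 0) G = NF (tuple_last G)"
| "iterated_norm NF (Suc (Suc n)) G =
     iterated_norm NF (Suc n) (tuple_init G - tau_shift (Suc n) (tuple_last G)) +
     NF (tuple_last G)"

end

theory Submission
  imports Defs "HOL-Real_Asymp.Real_Asymp"
begin

text \<open>
  Write \<open>D\<^sub>k f = f\<^sup>(\<^sup>k\<^sup>) / k!\<close>. Unfolding the recursion, an element \<open>G\<close> of $\mathscr F^{(n)}$ is a
  tuple with entries \<open>G\<^sub>i = (\<Sum>j\<le>i. D\<^sub>i\<^sub>-\<^sub>j g\<^sub>j)\<close> for unique \<open>g\<^sub>0, \<dots>, g\<^sub>n\<^sub>-\<^sub>1\<close> in
  $\mathscr F$, and its norm is the sum of the norms of the \<open>g\<^sub>j\<close>; so $\mathscr F^{(n)}$ is isometric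
  to an $\ell_1$-sum of \<open>n\<close> copies of $\mathscr F$. Evaluations are bounded because \<open>f \<mapsto> D\<^sub>k f(z)\<close>
  is, being built from pointwise limits of bounded difference quotients. By the identity
  \<open>a \<cdot> D\<^sub>i f = (\<Sum>j\<le>i. (-1)\<^sup>j D\<^sub>i\<^sub>-\<^sub>j (D\<^sub>j a \<cdot> f))\<close>, multiplication by \<open>a\<close> acts on the family \<open>(g\<^sub>j)\<close>
  as a triangular matrix with entries \<open>(-1)\<^sup>k D\<^sub>k a\<close>. This gives the module structure and, inverting
  the matrix when its diagonal \<open>a\<close> is an automorphism of the disc, the invariance condition.
  Finally, the jet at \<open>z\<close> of \<open>\<Sum>j. (w - z)\<^sup>j g\<^sub>j(w)\<close> as a function of \<open>w\<close> is \<open>G(z)\<close>, which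
  identifies the analytic family.
\<close>

section \<open>Normed spaces on carrier sets\<close>

text \<open>The obstacle is that \<open>F\<close> need not be closed under differentiation, so
  \<open>a\<close> times a divided derivative of \<open>f\<close> is not visibly a combination of
  divided derivatives of members of \<open>F\<close>. The alternating identity lets all inner
  derivatives fall on \<open>a\<close>, where they are harmless: a derivative of a member of
  \<open>A_infinity\<close> is again one, at the cost of one unit of the exponent. Joint continuity
  survives this loss because it amounts to an estimate by a single norm
  \<open>A_infinity_norm \<alpha>\<close>, and \<alpha> may be raised by \<open>n\<close>.

  The invariance condition needs two more facts. It quantifies over all analytic tuples, so every
  analytic tuple must first receive coordinates, which are then merely analytic. And the
  off-diagonal entries of the matrix are derivatives of the automorphism; they act on
  \<open>F\<close> because automorphisms of the disc are Moebius maps and hence belong to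
  \<open>A_infinity\<close> after restriction.

  In the comparison of quotient norms one constant is 1, since jets embed isometrically; the other
  comes from powers of a bound for multiplication by \<open>w - z\<close> on
  \<open>F\<close>.\<close>

locale normed_on =
  fixes V :: "'v::complex_vector set" and N :: "'v \<Rightarrow> real"
  assumes subspace: "complex_vector.subspace V"
    and nonneg: "x \<in> V \<Longrightarrow> 0 \<le> N x"
    and eq_0_iff: "x \<in> V \<Longrightarrow> N x = 0 \<longleftrightarrow> x = 0"
    and scale: "x \<in> V \<Longrightarrow> N (c *\<^sub>C x) = cmod c * N x"
    and triangle: "x \<in> V \<Longrightarrow> y \<in> V \<Longrightarrow> N (x + y) \<le> N x + N y"
begin

lemma mem_zero [simp]: "0 \<in> V"
  using subspace by (rule complex_vector.subspace_0)

lemma mem_add: "x \<in> V \<Longrightarrow> y \<in> V \<Longrightarrow> x + y \<in> V"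
  using subspace by (rule complex_vector.subspace_add)

lemma mem_diff: "x \<in> V \<Longrightarrow> y \<in> V \<Longrightarrow> x - y \<in> V"
  using subspace by (rule complex_vector.subspace_diff)

lemma mem_scale: "x \<in> V \<Longrightarrow> c *\<^sub>C x \<in> V"
  using subspace by (rule complex_vector.subspace_scale)

lemma mem_sum: "(\<And>i. i \<in> I \<Longrightarrow> f i \<in> V) \<Longrightarrow> sum f I \<in> V"
  using subspace by (rule complex_vector.subspace_sum)

lemma zero [simp]: "N 0 = 0"
  by (simp add: eq_0_iff)

lemma norm_sum_le: "(\<And>i. i \<in> I \<Longrightarrow> f i \<in> V) \<Longrightarrow> N (sum f I) \<le> (\<Sum>i\<in>I. N (f i))"
proof (induction I rule: infinite_finite_induct)
  case (insert i I)
  then have "N (f i + sum f I) \<le> N (f i) + N (sum f I)"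
    by (intro triangle mem_sum) auto
  with insert show ?case by simp
qed auto

lemma uminus: "x \<in> V \<Longrightarrow> N (- x) = N x"
  using scale[of x "-1"] by simp

lemma minus_commute: "x \<in> V \<Longrightarrow> y \<in> V \<Longrightarrow> N (x - y) = N (y - x)"
  using uminus[of "y - x"] by (simp add: mem_diff)

lemma triangle_diff: "x \<in> V \<Longrightarrow> y \<in> V \<Longrightarrow> N (x - y) \<le> N x + N y"
  using triangle[of x "- y"] uminus[of y] mem_scale[of y "-1"] by simp

lemma dist_triangle: "x \<in> V \<Longrightarrow> y \<in> V \<Longrightarrow> z \<in> V \<Longrightarrow> N (x - z) \<le> N (x - y) + N (y - z)"
  using triangle[of "x - y" "y - z"] by (simp add: mem_diff)

sublocale metric: Metric_space V "norm_dist V N"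
proof
  show "0 \<le> norm_dist V N x y" for x y
    by (simp add: norm_dist_def nonneg mem_diff)
  show "norm_dist V N x y = norm_dist V N y x" for x y
    by (auto simp: norm_dist_def minus_commute)
  show "(norm_dist V N x y = 0) = (x = y)" if "x \<in> V" "y \<in> V" for x y
    using that by (simp add: norm_dist_def eq_0_iff mem_diff)
  show "norm_dist V N x z \<le> norm_dist V N x y + norm_dist V N y z"
    if "x \<in> V" "y \<in> V" "z \<in> V" for x y z
    using that by (simp add: norm_dist_def dist_triangle)
qed

lemma topspace_norm_topology [simp]: "topspace (norm_topology V N) = V"
  by (simp add: norm_topology_def)

lemma openin_norm_topology:
  "openin (norm_topology V N) U \<longleftrightarrow>
     U \<subseteq> V \<and> (\<forall>x\<in>U. \<exists>r>0. \<forall>y\<in>V. N (y - x) < r \<longrightarrow> y \<in> U)"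
proof (cases "U \<subseteq> V")
  case True
  have "metric.mball x r \<subseteq> U \<longleftrightarrow> (\<forall>y\<in>V. N (y - x) < r \<longrightarrow> y \<in> U)" if "x \<in> U" for x r
    using that True by (auto simp: subset_eq norm_dist_def minus_commute[of x])
  with True show ?thesis
    unfolding norm_topology_def metric.openin_mtopology by metis
qed (simp add: norm_topology_def metric.openin_mtopology)

lemma ball_open:
  assumes "x \<in> V"
  shows "openin (norm_topology V N) {y\<in>V. N (y - x) < r}"
  unfolding openin_norm_topology
proof (intro conjI ballI)
  fix y assume y: "y \<in> {y\<in>V. N (y - x) < r}"
  show "\<exists>e>0. \<forall>u\<in>V. N (u - y) < e \<longrightarrow> u \<in> {y\<in>V. N (y - x) < r}"
  proof (intro exI[of _ "r - N (y - x)"] conjI ballI impI)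
    fix u assume "u \<in> V" "N (u - y) < r - N (y - x)"
    then show "u \<in> {y\<in>V. N (y - x) < r}" using dist_triangle[of u y x] y assms by auto
  qed (use y in auto)
qed auto

lemma limitin_norm_topology:
  "limitin (norm_topology V N) s l sequentially \<longleftrightarrow>
     l \<in> V \<and> (\<forall>\<^sub>F m in sequentially. s m \<in> V) \<and> (\<lambda>m. N (s m - l)) \<longlonglongrightarrow> 0"
proof -
  have "(\<lambda>m. norm_dist V N (s m) l) \<longlonglongrightarrow> 0 \<longleftrightarrow> (\<lambda>m. N (s m - l)) \<longlonglongrightarrow> 0"
    if "l \<in> V" "\<forall>\<^sub>F m in sequentially. s m \<in> V"
  proof (rule tendsto_cong)
    show "\<forall>\<^sub>F m in sequentially. norm_dist V N (s m) l = N (s m - l)"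
      using that(2) by eventually_elim (simp add: norm_dist_def that(1))
  qed
  then show ?thesis
    unfolding norm_topology_def metric.limitin_metric_dist_null by blast
qed

lemma MCauchy_iff:
  "metric.MCauchy s \<longleftrightarrow>
     (\<forall>m. s m \<in> V) \<and> (\<forall>e>0. \<exists>K. \<forall>m\<ge>K. \<forall>k\<ge>K. N (s m - s k) < e)"
  unfolding metric.MCauchy_def by (auto simp: norm_dist_def image_subset_iff)

lemma mcomplete_iff:
  "metric.mcomplete \<longleftrightarrow>
     (\<forall>s. metric.MCauchy s \<longrightarrow> (\<exists>l\<in>V. (\<lambda>m. N (s m - l)) \<longlonglongrightarrow> 0))"
proof -
  have "limitin (norm_topology V N) s l sequentially \<longleftrightarrow> l \<in> V \<and> (\<lambda>m. N (s m - l)) \<longlonglongrightarrow> 0"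
    if "metric.MCauchy s" for s l
    using that by (simp add: limitin_norm_topology MCauchy_iff)
  then show ?thesis
    unfolding metric.mcomplete_def norm_topology_def[symmetric] by blast
qed

end

lemma complex_banach_on_iff:
  "complex_banach_on V N \<longleftrightarrow> normed_on V N \<and> Metric_space.mcomplete V (norm_dist V N)"
  unfolding complex_banach_on_def normed_on_def by blast

lemma complex_banach_onD:
  assumes "complex_banach_on V N"
  shows "normed_on V N" "Metric_space.mcomplete V (norm_dist V N)"
  using assms by (auto simp: complex_banach_on_iff)

lemma mcomplete_limit:
  assumes "complex_banach_on V N" "\<And>m. s m \<in> V"
    "\<And>e. e > 0 \<Longrightarrow> \<exists>K. \<forall>m\<ge>K. \<forall>k\<ge>K. N (s m - s k) < e"
  obtains l where "l \<in> V" "(\<lambda>m. N (s m - l)) \<longlonglongrightarrow> 0"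
proof -
  interpret normed_on V N using assms(1) by (rule complex_banach_onD)
  have "metric.MCauchy s" using assms(2,3) by (simp add: MCauchy_iff)
  with complex_banach_onD(2)[OF assms(1)] show thesis
    using that by (auto simp: mcomplete_iff)
qed

lemma complex_banach_onI:
  assumes "normed_on V N"
    and "\<And>s. (\<And>m. s m \<in> V) \<Longrightarrow> (\<And>e. e > 0 \<Longrightarrow> \<exists>K. \<forall>m\<ge>K. \<forall>k\<ge>K. N (s m - s k) < e)
           \<Longrightarrow> \<exists>l\<in>V. (\<lambda>m. N (s m - l)) \<longlonglongrightarrow> 0"
  shows "complex_banach_on V N"
proof -
  interpret normed_on V N by fact
  show ?thesis
    unfolding complex_banach_on_iff mcomplete_iff using assms MCauchy_iff by blast
qed

lemma normed_on_UNIV: "normed_on UNIV (norm :: 'a::complex_banach \<Rightarrow> real)"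
  by unfold_locales (auto simp: norm_scaleC norm_triangle_ineq)

lemma complex_banach_on_UNIV: "complex_banach_on UNIV (norm :: 'a::complex_banach \<Rightarrow> real)"
proof (rule complex_banach_onI[OF normed_on_UNIV])
  fix s :: "nat \<Rightarrow> 'a"
  assume "\<And>e. e > 0 \<Longrightarrow> \<exists>K. \<forall>m\<ge>K. \<forall>k\<ge>K. norm (s m - s k) < e"
  then have "Cauchy s" by (simp add: Cauchy_iff)
  then show "\<exists>l\<in>UNIV. (\<lambda>m. norm (s m - l)) \<longlonglongrightarrow> 0"
    by (auto simp: Cauchy_convergent_iff convergent_def tendsto_norm_zero_iff LIM_zero_iff)
qed

lemma limitin_norm_UNIV:
  "limitin (norm_topology UNIV norm) s (l::'a::complex_banach) sequentially \<longleftrightarrow> s \<longlonglongrightarrow> l"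
  by (simp add: normed_on.limitin_norm_topology[OF normed_on_UNIV]
      tendsto_norm_zero_iff LIM_zero_iff)

section \<open>Finite l1-sums of normed spaces\<close>

definition tuples_in :: "nat \<Rightarrow> 'b::zero set \<Rightarrow> (nat \<Rightarrow> 'b) set" where
  "tuples_in n V = {x \<in> tuples n. \<forall>i<n. x i \<in> V}"

lemma tuples_in_UNIV: "tuples_in n UNIV = tuples n"
  by (simp add: tuples_in_def)

text \<open>Together with \<open>tuples_in\<close> this serves twice: over a space of values it
  describes where tuple-valued functions take their values, over a space of functions it describes
  the coordinate families.\<close>

definition sum_norm :: "nat \<Rightarrow> ('b \<Rightarrow> real) \<Rightarrow> (nat \<Rightarrow> 'b) \<Rightarrow> real" where
  "sum_norm n N x = (\<Sum>i<n. N (x i))"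

lemma sum_norm_eq_tuple_norm: "sum_norm n norm = tuple_norm n"
  by (simp add: fun_eq_iff sum_norm_def tuple_norm_def)

lemma normed_on_tuples_in:
  assumes "normed_on V N"
  shows "normed_on (tuples_in n V) (sum_norm n N)"
proof -
  interpret normed_on V N by fact
  show ?thesis
  proof
    show "complex_vector.subspace (tuples_in n V)"
      unfolding complex_vector.subspace_def
      by (auto simp: tuples_in_def tuples_def scaleC_fun_def mem_add mem_scale)
    show "0 \<le> sum_norm n N x" if "x \<in> tuples_in n V" for x
      using that by (auto simp: tuples_in_def sum_norm_def intro!: sum_nonneg nonneg)
    show "sum_norm n N x = 0 \<longleftrightarrow> x = 0" if "x \<in> tuples_in n V" for x
    proof -
      have "sum_norm n N x = 0 \<longleftrightarrow> (\<forall>i<n. x i = 0)"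
        unfolding sum_norm_def using that
        by (subst sum_nonneg_eq_0_iff) (auto simp: tuples_in_def nonneg eq_0_iff)
      also have "\<dots> \<longleftrightarrow> x = 0"
        using that by (auto simp: tuples_in_def tuples_def fun_eq_iff) (meson not_le)
      finally show ?thesis .
    qed
    show "sum_norm n N (c *\<^sub>C x) = cmod c * sum_norm n N x" if "x \<in> tuples_in n V" for x c
      unfolding sum_norm_def sum_distrib_left using that
      by (auto simp: tuples_in_def scaleC_fun_def scale intro!: sum.cong)
    show "sum_norm n N (x + y) \<le> sum_norm n N x + sum_norm n N y"
      if "x \<in> tuples_in n V" "y \<in> tuples_in n V" for x y
      unfolding sum_norm_def sum.distrib[symmetric] using that
      by (auto simp: tuples_in_def intro!: sum_mono triangle)
  qed
qed

lemma sum_norm_component_le: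
  assumes "normed_on V N" "x \<in> tuples_in n V" "i < n"
  shows "N (x i) \<le> sum_norm n N x"
  unfolding sum_norm_def
  using assms by (intro member_le_sum) (auto simp: tuples_in_def normed_on.nonneg)

text \<open>Limits are formed entry by entry: each entry of a Cauchy sequence is Cauchy in
  \<open>V\<close>, and finitely many null sequences add up to a null sequence.\<close>

lemma complex_banach_on_tuples_in:
  fixes V :: "'a::complex_vector set"
  assumes banach: "complex_banach_on V N"
  shows "complex_banach_on (tuples_in n V) (sum_norm n N)"
proof (rule complex_banach_onI)
  interpret normed_on V N using banach by (rule complex_banach_onD)
  show normed: "normed_on (tuples_in n V) (sum_norm n N)"
    by (rule normed_on_tuples_in) unfold_locales
  fix s :: "nat \<Rightarrow> nat \<Rightarrow> 'a"
  assume s: "\<And>m. s m \<in> tuples_in n V"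
    and cauchy: "\<And>e. e > 0 \<Longrightarrow> \<exists>K. \<forall>m\<ge>K. \<forall>k\<ge>K. sum_norm n N (s m - s k) < e"
  have "\<exists>l\<in>V. (\<lambda>m. N (s m i - l)) \<longlonglongrightarrow> 0" if "i < n" for i
  proof -
    have "\<exists>K. \<forall>m\<ge>K. \<forall>k\<ge>K. N (s m i - s k i) < e" if "e > 0" for e
    proof -
      have "N (s m i - s k i) \<le> sum_norm n N (s m - s k)" for m k
        using sum_norm_component_le[OF normed_on_axioms normed_on.mem_diff[OF normed s s] \<open>i < n\<close>]
        by simp
      with cauchy[OF that] show ?thesis by (meson le_less_trans)
    qed
    moreover have "s m i \<in> V" for m
      using s \<open>i < n\<close> by (simp add: tuples_in_def)
    ultimately obtain l where "l \<in> V" "(\<lambda>m. N (s m i - l)) \<longlonglongrightarrow> 0"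
      using mcomplete_limit[OF banach, of "\<lambda>m. s m i"] by blast
    then show ?thesis by blast
  qed
  then obtain l where l: "\<And>i. i < n \<Longrightarrow> l i \<in> V \<and> (\<lambda>m. N (s m i - l i)) \<longlonglongrightarrow> 0"
    by metis
  define L where "L = (\<lambda>i. if i < n then l i else 0)"
  have "(\<lambda>m. sum_norm n N (s m - L)) \<longlonglongrightarrow> (\<Sum>i<n. 0)"
    unfolding sum_norm_def by (intro tendsto_sum) (simp add: L_def l)
  moreover have "L \<in> tuples_in n V"
    by (auto simp: L_def l tuples_in_def tuples_def)
  ultimately show "\<exists>l\<in>tuples_in n V. (\<lambda>m. sum_norm n N (s m - l)) \<longlonglongrightarrow> 0"
    by auto
qed

section \<open>Isometric images and bounded linear maps on carrier sets\<close>

definition linear_on_into :: "'v::complex_vector set \<Rightarrow> 'w::complex_vector set \<Rightarrow> ('v \<Rightarrow> 'w) \<Rightarrow> bool" where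
  "linear_on_into V W T \<longleftrightarrow>
     (\<forall>x\<in>V. T x \<in> W) \<and> (\<forall>x\<in>V. \<forall>y\<in>V. T (x + y) = T x + T y) \<and>
     (\<forall>c. \<forall>x\<in>V. T (c *\<^sub>C x) = c *\<^sub>C T x)"

lemma linear_on_into_diff:
  assumes "linear_on_into V W T" "normed_on V N" "x \<in> V" "y \<in> V"
  shows "T (x - y) = T x - T y"
proof -
  have "T (x + (-1) *\<^sub>C y) = T x + (-1) *\<^sub>C T y"
    using assms normed_on.mem_scale[OF assms(2)] unfolding linear_on_into_def by metis
  then show ?thesis by simp
qed

lemma linear_on_into_zero:
  assumes "linear_on_into V W T" "normed_on V N"
  shows "T 0 = 0"
  using linear_on_into_diff[OF assms, of 0 0] normed_on.mem_zero[OF assms(2)] by simp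

text \<open>Norm axioms and limits are pulled back along \<open>T\<close>. This spares a direct
  check that the recursively defined \<open>iterated_norm\<close> is a complete norm: knowing its
  values on the image of an isometry is enough.\<close>

lemma complex_banach_on_isometric_image:
  fixes T :: "'v::complex_vector \<Rightarrow> 'w::complex_vector"
  assumes banach: "complex_banach_on V N" and T: "linear_on_into V UNIV T"
    and isometric: "\<And>x. x \<in> V \<Longrightarrow> M (T x) = N x"
    and inj: "\<And>x. x \<in> V \<Longrightarrow> T x = 0 \<Longrightarrow> x = 0"
  shows "complex_banach_on (T ` V) M"
proof (rule complex_banach_onI)
  interpret normed_on V N using banach by (rule complex_banach_onD)
  note T_diff = linear_on_into_diff[OF T normed_on_axioms]
  note T_zero = linear_on_into_zero[OF T normed_on_axioms]
  have T_add: "T (x + y) = T x + T y" if "x \<in> V" "y \<in> V" for x y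
    using T that by (simp add: linear_on_into_def)
  have T_scale: "T (c *\<^sub>C x) = c *\<^sub>C T x" if "x \<in> V" for c x
    using T that by (simp add: linear_on_into_def)
  show "normed_on (T ` V) M"
  proof
    show "complex_vector.subspace (T ` V)"
      unfolding complex_vector.subspace_def
      by (auto simp: image_iff T_add[symmetric] T_scale[symmetric] intro: mem_add mem_scale
          bexI[of _ 0] simp: T_zero)
    show "0 \<le> M y" if "y \<in> T ` V" for y
      using that by (auto simp: isometric nonneg)
    show "M y = 0 \<longleftrightarrow> y = 0" if "y \<in> T ` V" for y
      using that isometric[of 0] by (auto simp: isometric eq_0_iff T_zero dest: inj)
    show "M (c *\<^sub>C y) = cmod c * M y" if "y \<in> T ` V" for c y
      using that by (auto simp: T_scale[symmetric] isometric mem_scale scale)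
    show "M (x + y) \<le> M x + M y" if "x \<in> T ` V" "y \<in> T ` V" for x y
      using that by (auto simp: T_add[symmetric] isometric mem_add triangle)
  qed
  fix s :: "nat \<Rightarrow> 'w"
  assume s: "\<And>m. s m \<in> T ` V"
    and cauchy: "\<And>e. e > 0 \<Longrightarrow> \<exists>K. \<forall>m\<ge>K. \<forall>k\<ge>K. M (s m - s k) < e"
  have "\<forall>m. \<exists>x. x \<in> V \<and> s m = T x" using s by blast
  then obtain t where t: "\<And>m. t m \<in> V" "\<And>m. s m = T (t m)"
    by metis
  have M_diff: "M (s m - T x) = N (t m - x)" if "x \<in> V" for m x
    using t that by (simp add: T_diff[symmetric] isometric mem_diff)
  have "\<exists>K. \<forall>m\<ge>K. \<forall>k\<ge>K. N (t m - t k) < e" if "e > 0" for e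
    using cauchy[OF that] M_diff[OF t(1)] unfolding t(2) by simp
  then obtain l where "l \<in> V" "(\<lambda>m. N (t m - l)) \<longlonglongrightarrow> 0"
    using mcomplete_limit[OF banach, of t] t(1) by blast
  then show "\<exists>l\<in>T ` V. (\<lambda>m. M (s m - l)) \<longlonglongrightarrow> 0"
    by (auto simp: M_diff)
qed

lemma bounded_linear_if_continuous_map:
  assumes V: "normed_on V N" and W: "normed_on W M" and T: "linear_on_into V W T"
    and cont: "continuous_map (norm_topology V N) (norm_topology W M) T"
  obtains C where "C \<ge> 0" "\<And>x. x \<in> V \<Longrightarrow> M (T x) \<le> C * N x"
proof -
  interpret V: normed_on V N by fact
  interpret W: normed_on W M by fact
  have T0: "T 0 = 0" by (rule linear_on_into_zero[OF T V])
  have TW: "x \<in> V \<Longrightarrow> T x \<in> W" and T_scale: "x \<in> V \<Longrightarrow> T (c *\<^sub>C x) = c *\<^sub>C T x" for x c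
    using T by (auto simp: linear_on_into_def)
  have "openin (norm_topology W M) {y\<in>W. M y < 1}"
    using W.ball_open[OF W.mem_zero, of 1] by simp
  then have "openin (norm_topology V N) {x\<in>V. T x \<in> {y\<in>W. M y < 1}}"
    using cont unfolding continuous_map_def by auto
  moreover have "0 \<in> {x\<in>V. T x \<in> {y\<in>W. M y < 1}}"
    by (simp add: T0)
  ultimately obtain r where r: "r > 0" "\<And>x. x \<in> V \<Longrightarrow> N x < r \<Longrightarrow> M (T x) < 1"
    unfolding V.openin_norm_topology by (metis (no_types, lifting) diff_zero mem_Collect_eq)
  show thesis
  proof
    \<comment> \<open>A nonzero \<open>x\<close> is rescaled to norm \<open>r / 2\<close>, inside
      the ball on which \<open>M (T x) < 1\<close>; undoing the scaling gives the factor
      \<open>2 / r\<close>.\<close>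
    show "0 \<le> 2 / r" using r by simp
    fix x assume x: "x \<in> V"
    show "M (T x) \<le> 2 / r * N x"
    proof (cases "x = 0")
      case False
      then have pos: "N x > 0" using x V.eq_0_iff[OF x] V.nonneg[OF x] by linarith
      define c where "c = complex_of_real (r / (2 * N x))"
      have c: "cmod c = r / (2 * N x)" using pos r by (simp add: c_def norm_divide norm_mult)
      have "N (c *\<^sub>C x) < r" using pos r by (simp add: V.scale x c)
      then have "M (T (c *\<^sub>C x)) < 1" using r x by (simp add: V.mem_scale)
      then show ?thesis
        using pos r by (simp add: T_scale TW W.scale x c field_simps)
    qed (simp add: T0)
  qed
qed

lemma continuous_map_if_bounded_linear:
  assumes V: "normed_on V N" and W: "normed_on W M" and T: "linear_on_into V W T"
    and bound: "\<And>x. x \<in> V \<Longrightarrow> M (T x) \<le> C * N x"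
  shows "continuous_map (norm_topology V N) (norm_topology W M) T"
proof -
  interpret V: normed_on V N by fact
  interpret W: normed_on W M by fact
  have TW: "x \<in> V \<Longrightarrow> T x \<in> W" for x
    using T by (auto simp: linear_on_into_def)
  have "openin (norm_topology V N) {x\<in>V. T x \<in> U}" if U: "openin (norm_topology W M) U" for U
    unfolding V.openin_norm_topology
  proof (intro conjI ballI)
    fix x assume x: "x \<in> {x\<in>V. T x \<in> U}"
    then obtain r where r: "r > 0" "\<And>y. y \<in> W \<Longrightarrow> M (y - T x) < r \<Longrightarrow> y \<in> U"
      using U unfolding W.openin_norm_topology by blast
    \<comment> \<open>The sign of \<open>C\<close> is unknown, so \<open>\<bar>C\<bar> + 1\<close>
      replaces it to make the radius well defined and positive.\<close>
    have "T y \<in> U" if "y \<in> V" "N (y - x) < r / (\<bar>C\<bar> + 1)" for y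
    proof (rule r)
      have "M (T y - T x) = M (T (y - x))"
        using x that linear_on_into_diff[OF T V] by simp
      also have "\<dots> \<le> C * N (y - x)"
        using x that bound by (simp add: V.mem_diff)
      also have "\<dots> \<le> (\<bar>C\<bar> + 1) * N (y - x)"
        using x that by (intro mult_right_mono) (auto simp: V.mem_diff V.nonneg)
      also have "\<dots> < r"
        using that by (simp add: field_simps)
      finally show "M (T y - T x) < r" .
    qed (use that TW in auto)
    then show "\<exists>e>0. \<forall>y\<in>V. N (y - x) < e \<longrightarrow> y \<in> {x\<in>V. T x \<in> U}"
      using r(1) by (intro exI[of _ "r / (\<bar>C\<bar> + 1)"]) auto
  qed auto
  then show ?thesis
    using TW by (auto simp: continuous_map_def)
qed

text \<open>By Baire, one of the closed sets \<open>{x. \<forall>m. norm (T m x) \<le> k}\<close> contains a ball.\<close>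

lemma bounded_linear_pointwise_limit:
  fixes T :: "nat \<Rightarrow> 'v::complex_vector \<Rightarrow> 'a::complex_banach"
  assumes banach: "complex_banach_on V N" and T: "\<And>m. linear_on_into V UNIV (T m)"
    and bound: "\<And>m. \<exists>C. \<forall>x\<in>V. norm (T m x) \<le> C * N x"
    and lim: "\<And>x. x \<in> V \<Longrightarrow> (\<lambda>m. T m x) \<longlonglongrightarrow> S x"
  obtains C where "C \<ge> 0" "\<And>x. x \<in> V \<Longrightarrow> norm (S x) \<le> C * N x"
proof -
  interpret normed_on V N using banach by (rule complex_banach_onD)
  define A where "A k = {x\<in>V. \<forall>m. norm (T m x) \<le> real k}" for k
  have T_diff: "T m (x - y) = T m x - T m y" if "x \<in> V" "y \<in> V" for m x y
    using linear_on_into_diff[OF T normed_on_axioms that] .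
  have T_scale: "T m (c *\<^sub>C x) = c *\<^sub>C T m x" if "x \<in> V" for m c x
    using T that by (auto simp: linear_on_into_def)
  have closed: "closedin (norm_topology V N) (A k)" for k
    unfolding closedin_def openin_norm_topology topspace_norm_topology
  proof (intro conjI ballI)
    fix x assume x: "x \<in> V - A k"
    then obtain m where m: "norm (T m x) > k" unfolding A_def using not_le by blast
    obtain C where C: "\<And>x. x \<in> V \<Longrightarrow> norm (T m x) \<le> C * N x" using bound by blast
    have "y \<in> V - A k" if "y \<in> V" "N (y - x) < (norm (T m x) - k) / (\<bar>C\<bar> + 1)" for y
    proof -
      have "norm (T m x) - norm (T m y) \<le> norm (T m (y - x))"
        using x that by (simp add: T_diff) (metis norm_minus_commute norm_triangle_ineq2)
      also have "\<dots> \<le> C * N (y - x)" using x that by (intro C mem_diff) auto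
      also have "\<dots> \<le> (\<bar>C\<bar> + 1) * N (y - x)"
        using x that by (intro mult_right_mono) (auto simp: mem_diff nonneg)
      also have "\<dots> < norm (T m x) - k" using that by (simp add: field_simps)
      finally have "\<not> norm (T m y) \<le> k" by simp
      then show ?thesis using that unfolding A_def by blast
    qed
    then show "\<exists>r>0. \<forall>y\<in>V. N (y - x) < r \<longrightarrow> y \<in> V - A k"
      using m by (intro exI[of _ "(norm (T m x) - k) / (\<bar>C\<bar> + 1)"]) auto
  qed (auto simp: A_def)
  have union: "(\<Union>k. A k) = V"
  proof -
    have "\<exists>k. x \<in> A k" if "x \<in> V" for x
    proof -
      have "Bseq (\<lambda>m. T m x)" using lim[OF that] by (intro convergent_imp_Bseq convergentI)
      then obtain B where "\<And>m. norm (T m x) \<le> B" by (auto simp: Bseq_def)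
      moreover obtain k :: nat where "B \<le> k" using real_arch_simple by blast
      ultimately have "x \<in> A k" using that by (force simp: A_def intro: order_trans)
      then show ?thesis ..
    qed
    then show ?thesis by (auto simp: A_def)
  qed
  have "\<exists>k. norm_topology V N interior_of A k \<noteq> {}"
  proof (rule ccontr)
    assume *: "\<not> ?thesis"
    \<comment> \<open>If all the closed sets \<open>A k\<close> had empty interior, so would their
      union by Baire; but that union is the whole space, which is open and contains 0.\<close>
    have "norm_topology V N interior_of (\<Union>(range A)) = {}"
      unfolding norm_topology_def
      using closed * complex_banach_onD(2)[OF banach]
      by (intro metric.metric_Baire_category_alt) (auto simp: norm_topology_def)
    then show False
      using union interior_of_topspace[of "norm_topology V N"] mem_zero by auto
  qed
  then obtain k x0 where "x0 \<in> norm_topology V N interior_of A k" by blast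
  then obtain U where U: "openin (norm_topology V N) U" "x0 \<in> U" "U \<subseteq> A k"
    by (auto simp: interior_of_def)
  then obtain r where r: "r > 0" "\<And>y. y \<in> V \<Longrightarrow> N (y - x0) < r \<Longrightarrow> y \<in> A k"
    unfolding openin_norm_topology by blast
  have x0: "x0 \<in> V" "x0 \<in> A k" using U by (auto simp: A_def)
  \<comment> \<open>The ball found by Baire is centred at \<open>x0\<close>, not at 0. Writing
    \<open>x\<close> as the difference of \<open>x + x0\<close> and \<open>x0\<close>, both in
    \<open>A k\<close>, moves it to the origin and doubles the bound.\<close>
  have small: "norm (T m x) \<le> 2 * k" if "x \<in> V" "N x < r" for m x
  proof -
    have "x + x0 \<in> A k" using that x0 by (intro r mem_add) auto
    then have "norm (T m (x + x0)) \<le> k" "norm (T m x0) \<le> k" using x0 by (auto simp: A_def)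
    moreover have "T m x = T m (x + x0) - T m x0"
      using T_diff[of "x + x0" x0 m] that x0 by (simp add: mem_add)
    ultimately show ?thesis using norm_triangle_ineq4[of "T m (x + x0)" "T m x0"] by simp
  qed
  show thesis
  proof
    \<comment> \<open>The bound \<open>2 * k\<close> on the ball, applied to \<open>x\<close>
      rescaled to norm \<open>r / 2\<close>. It does not depend on \<open>m\<close>, so it passes to
      the limit.\<close>
    show "0 \<le> 4 * k / r" using r by simp
    fix x assume x: "x \<in> V"
    have "norm (T m x) \<le> 4 * k / r * N x" for m
    proof (cases "x = 0")
      case False
      then have pos: "N x > 0" using x eq_0_iff[OF x] nonneg[OF x] by linarith
      define c where "c = complex_of_real (r / (2 * N x))"
      have c: "cmod c = r / (2 * N x)" using pos r by (simp add: c_def norm_divide norm_mult)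
      have "N (c *\<^sub>C x) < r" using pos r by (simp add: scale x c)
      then have "norm (T m (c *\<^sub>C x)) \<le> 2 * k" using x by (intro small) (simp add: mem_scale)
      then show ?thesis
        using pos r by (simp add: T_scale x c norm_scaleC field_simps)
    qed (use linear_on_into_zero[OF T normed_on_axioms] in simp)
    then show "norm (S x) \<le> 4 * k / r * N x"
      using lim[OF x] by (intro LIMSEQ_le_const2[OF tendsto_norm]) auto
  qed
qed

section \<open>Vector-valued analytic functions and divided derivatives\<close>

lemma bounded_bilinear_scaleC:
  "bounded_bilinear (scaleC :: complex \<Rightarrow> 'a \<Rightarrow> 'a::complex_banach)"
proof
  show "(r *\<^sub>R a) *\<^sub>C b = r *\<^sub>R (a *\<^sub>C b)" "a *\<^sub>C (r *\<^sub>R b) = r *\<^sub>R (a *\<^sub>C b)" for r a and b :: 'a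
    by (simp_all add: scaleR_eq_scaleC scaleC_scaleC scaleC_complex_def mult.commute)
  show "\<exists>K. \<forall>a b. norm (a *\<^sub>C b :: 'a) \<le> norm a * norm b * K"
    by (intro exI[of _ 1]) (simp add: norm_scaleC)
qed (simp_all add: scaleC_add_left scaleC_add_right)

interpretation scaleC: bounded_bilinear "scaleC :: complex \<Rightarrow> 'a \<Rightarrow> 'a::complex_banach"
  by (rule bounded_bilinear_scaleC)

text \<open>A real Frechet derivative of this form is complex-linear, so this is complex
  differentiability of a vector-valued function.\<close>

abbreviation has_cderiv :: "(complex \<Rightarrow> 'a::complex_banach) \<Rightarrow> 'a \<Rightarrow> complex \<Rightarrow> bool" where
  "has_cderiv f d z \<equiv> (f has_derivative (\<lambda>h. h *\<^sub>C d)) (at z)"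

definition vanishes_off_disc :: "(complex \<Rightarrow> 'v::zero) \<Rightarrow> bool" where
  "vanishes_off_disc f \<longleftrightarrow> (\<forall>z. z \<notin> unit_disc \<longrightarrow> f z = 0)"

definition cdiff_on_disc :: "(complex \<Rightarrow> 'a::complex_banach) \<Rightarrow> bool" where
  "cdiff_on_disc f \<longleftrightarrow> (\<forall>z\<in>unit_disc. has_cderiv f (cderiv f z) z)"

lemma cderiv_eqI: "z \<in> unit_disc \<Longrightarrow> has_cderiv f d z \<Longrightarrow> cderiv f z = d"
  unfolding cderiv_def using has_derivative_unique[of f _ z]
  by (auto intro!: the_equality) (metis scaleC_one)

lemma cderiv_off_disc: "z \<notin> unit_disc \<Longrightarrow> cderiv f z = 0"
  unfolding cderiv_def by simp

lemma vanishes_off_disc_cderiv [simp]: "vanishes_off_disc (cderiv f)"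
  unfolding vanishes_off_disc_def by (simp add: cderiv_off_disc)

text \<open>The conclusion is an equality of functions on the whole plane, so \<open>g\<close> has
  to follow the convention that derivatives are 0 off the disc.\<close>

lemma cdiff_onI:
  assumes "\<And>z. z \<in> unit_disc \<Longrightarrow> has_cderiv f (g z) z" "vanishes_off_disc g"
  shows "cdiff_on_disc f \<and> cderiv f = g"
proof -
  have "cderiv f z = g z" if "z \<in> unit_disc" for z
    using cderiv_eqI assms(1) that by blast
  moreover have "cderiv f z = g z" if "z \<notin> unit_disc" for z
    using assms(2) that by (simp add: cderiv_off_disc vanishes_off_disc_def)
  ultimately show ?thesis
    using assms(1) by (auto simp: cdiff_on_disc_def)
qed

lemma vanishes_off_disc_add: "vanishes_off_disc f \<Longrightarrow> vanishes_off_disc g \<Longrightarrow> vanishes_off_disc (f + g)"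
  for f g :: "complex \<Rightarrow> 'v::complex_vector"
  by (simp add: vanishes_off_disc_def)

lemma vanishes_off_disc_scaleC: "vanishes_off_disc f \<Longrightarrow> vanishes_off_disc (c *\<^sub>C f)"
  by (simp add: vanishes_off_disc_def scaleC_fun_def)

lemma vanishes_off_disc_mult: "vanishes_off_disc f \<Longrightarrow> vanishes_off_disc (pointwise_mult a f)"
  by (simp add: vanishes_off_disc_def pointwise_mult_def)

lemma cderiv_add:
  assumes "cdiff_on_disc f" "cdiff_on_disc g"
  shows "cdiff_on_disc (f + g) \<and> cderiv (f + g) = cderiv f + cderiv g"
proof (rule cdiff_onI)
  fix z assume "z \<in> unit_disc"
  then show "has_cderiv (f + g) ((cderiv f + cderiv g) z) z"
    using assms unfolding cdiff_on_disc_def plus_fun_def scaleC_add_right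
    by (auto intro: has_derivative_add)
qed (simp add: vanishes_off_disc_add)

lemma cderiv_scaleC:
  assumes "cdiff_on_disc f"
  shows "cdiff_on_disc (c *\<^sub>C f) \<and> cderiv (c *\<^sub>C f) = c *\<^sub>C cderiv f"
proof (rule cdiff_onI)
  fix z assume "z \<in> unit_disc"
  then have "has_cderiv f (cderiv f z) z"
    using assms unfolding cdiff_on_disc_def by blast
  from bounded_linear.has_derivative[OF scaleC.bounded_linear_right this, of c]
  show "has_cderiv (c *\<^sub>C f) ((c *\<^sub>C cderiv f) z) z"
    unfolding scaleC_fun_def by (simp add: scaleC_scaleC mult.commute)
qed (simp add: vanishes_off_disc_scaleC)

lemma cderiv_mult:
  assumes "cdiff_on_disc a" "cdiff_on_disc f"
  shows "cdiff_on_disc (pointwise_mult a f) \<and>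
    cderiv (pointwise_mult a f) = pointwise_mult (cderiv a) f + pointwise_mult a (cderiv f)"
proof (rule cdiff_onI)
  fix z assume "z \<in> unit_disc"
  then have "has_cderiv a (cderiv a z) z" "has_cderiv f (cderiv f z) z"
    using assms unfolding cdiff_on_disc_def by blast+
  from scaleC.FDERIV[OF this]
  show "has_cderiv (pointwise_mult a f)
      ((pointwise_mult (cderiv a) f + pointwise_mult a (cderiv f)) z) z"
    unfolding pointwise_mult_def plus_fun_def
    by (simp add: scaleC_scaleC scaleC_add_right scaleC_complex_def mult.commute add.commute)
qed (simp add: vanishes_off_disc_def pointwise_mult_def cderiv_off_disc)

lemma cdiff_0: "cdiff_on_disc (0 :: complex \<Rightarrow> 'a::complex_banach) \<and> cderiv 0 = (0 :: complex \<Rightarrow> 'a::complex_banach)"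
  by (rule cdiff_onI) (auto simp: vanishes_off_disc_def zero_fun_def scaleC.zero_right)

fun cdiff_times :: "nat \<Rightarrow> (complex \<Rightarrow> 'a::complex_banach) \<Rightarrow> bool" where
  "cdiff_times 0 f \<longleftrightarrow> vanishes_off_disc f"
| "cdiff_times (Suc k) f \<longleftrightarrow> vanishes_off_disc f \<and> cdiff_on_disc f \<and> cdiff_times k (cderiv f)"

lemma cdiff_times_SucD: "cdiff_times (Suc k) f \<Longrightarrow> cdiff_times k f"
  by (induction k arbitrary: f) auto

lemma cdiff_times_add: "cdiff_times k f \<Longrightarrow> cdiff_times k g \<Longrightarrow> cdiff_times k (f + g)"
  by (induction k arbitrary: f g) (auto simp: vanishes_off_disc_add cderiv_add)

lemma cdiff_times_scaleC: "cdiff_times k f \<Longrightarrow> cdiff_times k (c *\<^sub>C f)"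
  by (induction k arbitrary: f) (auto simp: vanishes_off_disc_scaleC cderiv_scaleC)

lemma cdiff_times_mult: "cdiff_times k a \<Longrightarrow> cdiff_times k f \<Longrightarrow> cdiff_times k (pointwise_mult a f)"
proof (induction k arbitrary: a f)
  case (Suc k)
  then have "cdiff_times k (pointwise_mult (cderiv a) f)" "cdiff_times k (pointwise_mult a (cderiv f))"
    using cdiff_times_SucD[OF Suc.prems(1)] cdiff_times_SucD[OF Suc.prems(2)] by auto
  with Suc.prems show ?case
    by (simp add: vanishes_off_disc_mult cderiv_mult cdiff_times_add)
qed (simp add: vanishes_off_disc_mult)

text \<open>The identities between derivatives are proved in this space rather than for analytic
  functions: closure under products is an induction on the order by the product rule, and no power
  series have to be multiplied.\<close>

definition smooth_on_disc :: "(complex \<Rightarrow> 'a::complex_banach) set" where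
  "smooth_on_disc = {f. \<forall>k. cdiff_times k f}"

lemma smooth_cdiff: "f \<in> smooth_on_disc \<Longrightarrow> cdiff_on_disc f"
  unfolding smooth_on_disc_def using cdiff_times.simps(2) by blast

lemma smooth_cderiv: "f \<in> smooth_on_disc \<Longrightarrow> cderiv f \<in> smooth_on_disc"
  unfolding smooth_on_disc_def using cdiff_times.simps(2) by blast

lemma smooth_vanishes: "f \<in> smooth_on_disc \<Longrightarrow> vanishes_off_disc f"
  unfolding smooth_on_disc_def using cdiff_times.simps(1) by blast

lemma smooth_mult: "a \<in> smooth_on_disc \<Longrightarrow> f \<in> smooth_on_disc \<Longrightarrow> pointwise_mult a f \<in> smooth_on_disc"
  by (simp add: smooth_on_disc_def cdiff_times_mult)

lemma subspace_smooth_on_disc: "complex_vector.subspace (smooth_on_disc :: (complex \<Rightarrow> 'a::complex_banach) set)"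
  unfolding complex_vector.subspace_def
proof (intro conjI)
  have "vanishes_off_disc (0 :: complex \<Rightarrow> 'a)"
    by (simp add: vanishes_off_disc_def)
  then have "cdiff_times k (0 :: complex \<Rightarrow> 'a)" for k
    by (induction k) (simp_all only: cdiff_0 cdiff_times.simps simp_thms)
  then show "(0 :: complex \<Rightarrow> 'a) \<in> smooth_on_disc"
    by (simp add: smooth_on_disc_def)
qed (auto simp: smooth_on_disc_def cdiff_times_add cdiff_times_scaleC)

lemmas smooth_scaleC = complex_vector.subspace_scale[OF subspace_smooth_on_disc]
  and smooth_zero = complex_vector.subspace_0[OF subspace_smooth_on_disc]
  and smooth_sum = complex_vector.subspace_sum[OF subspace_smooth_on_disc]

text \<open>A coinduction principle, used with the analytic and with the holomorphic functions as
  invariant set.\<close>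

lemma smooth_on_discI:
  assumes "f \<in> S" and "\<And>f. f \<in> S \<Longrightarrow> vanishes_off_disc f \<and> cdiff_on_disc f \<and> cderiv f \<in> S"
  shows "f \<in> smooth_on_disc"
proof -
  have "f \<in> S \<Longrightarrow> cdiff_times k f" for k f
    by (induction k arbitrary: f) (use assms(2) in auto)
  with assms(1) show ?thesis by (simp add: smooth_on_disc_def)
qed

lemma cderiv_sum:
  assumes "\<And>i. i \<in> I \<Longrightarrow> f i \<in> smooth_on_disc"
  shows "cderiv (sum f I) = (\<Sum>i\<in>I. cderiv (f i))"
  using assms
proof (induction I rule: infinite_finite_induct)
  case (insert i I)
  then have "cderiv (f i + sum f I) = cderiv (f i) + cderiv (sum f I)"
    by (intro cderiv_add[THEN conjunct2] smooth_cdiff smooth_sum) simp_all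
  with insert.IH insert.prems show ?case
    unfolding sum.insert[OF insert.hyps] by (metis insertI2)
qed (auto simp: cdiff_0)

lemma cderiv_power_smooth:
  "f \<in> smooth_on_disc \<Longrightarrow> (cderiv ^^ k) f \<in> smooth_on_disc"
  by (induction k) (auto simp: smooth_cderiv)

lemma cderiv_power_add:
  "f \<in> smooth_on_disc \<Longrightarrow> g \<in> smooth_on_disc \<Longrightarrow>
    (cderiv ^^ k) (f + g) = (cderiv ^^ k) f + (cderiv ^^ k) g"
  by (induction k) (auto simp: cderiv_add smooth_cdiff cderiv_power_smooth)

lemma cderiv_power_scaleC:
  "f \<in> smooth_on_disc \<Longrightarrow> (cderiv ^^ k) (c *\<^sub>C f) = c *\<^sub>C (cderiv ^^ k) f"
  by (induction k) (auto simp: cderiv_scaleC smooth_cdiff cderiv_power_smooth)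

section \<open>Divided derivatives and the alternating Leibniz identity\<close>

definition divided_deriv :: "nat \<Rightarrow> (complex \<Rightarrow> 'a::complex_banach) \<Rightarrow> complex \<Rightarrow> 'a" where
  "divided_deriv k f = (1 / fact k) *\<^sub>C (cderiv ^^ k) f"

lemma divided_deriv_0 [simp]: "divided_deriv 0 f = f"
  by (simp add: divided_deriv_def)

lemma divided_deriv_smooth: "f \<in> smooth_on_disc \<Longrightarrow> divided_deriv k f \<in> smooth_on_disc"
  by (simp add: divided_deriv_def smooth_scaleC cderiv_power_smooth)

lemma divided_deriv_add:
  "f \<in> smooth_on_disc \<Longrightarrow> g \<in> smooth_on_disc \<Longrightarrow>
    divided_deriv k (f + g) = divided_deriv k f + divided_deriv k g"
  by (simp add: divided_deriv_def cderiv_power_add scaleC_add_right)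

lemma divided_deriv_scaleC:
  "f \<in> smooth_on_disc \<Longrightarrow> divided_deriv k (c *\<^sub>C f) = c *\<^sub>C divided_deriv k f"
  by (simp add: divided_deriv_def cderiv_power_scaleC mult.commute)

lemma divided_deriv_zero [simp]: "divided_deriv k (0 :: complex \<Rightarrow> 'a::complex_banach) = 0"
  using divided_deriv_scaleC[OF smooth_zero, of k 0] by simp

lemma divided_deriv_sum:
  "(\<And>i. i \<in> I \<Longrightarrow> f i \<in> smooth_on_disc) \<Longrightarrow>
    divided_deriv k (sum f I) = (\<Sum>i\<in>I. divided_deriv k (f i))"
  by (induction I rule: infinite_finite_induct) (auto simp: divided_deriv_add smooth_sum)

lemma cderiv_divided_deriv:
  "f \<in> smooth_on_disc \<Longrightarrow> cderiv (divided_deriv k f) = of_nat (Suc k) *\<^sub>C divided_deriv (Suc k) f"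
  using cderiv_scaleC[OF smooth_cdiff[OF cderiv_power_smooth[of f k]], of "1 / fact k"]
  by (simp add: divided_deriv_def del: of_nat_Suc)

lemma divided_deriv_cderiv:
  "divided_deriv k (cderiv f) = of_nat (Suc k) *\<^sub>C divided_deriv (Suc k) f"
  by (simp add: divided_deriv_def funpow_swap1 del: of_nat_Suc)

lemma pointwise_mult_diff_left: "pointwise_mult (a - b) f = pointwise_mult a f - pointwise_mult b f"
  and pointwise_mult_diff_right: "pointwise_mult a (f - g) = pointwise_mult a f - pointwise_mult a g"
  and pointwise_mult_scaleC_left: "pointwise_mult (c *\<^sub>C a) f = c *\<^sub>C pointwise_mult a f"
  and pointwise_mult_scaleC_right: "pointwise_mult a (c *\<^sub>C f) = c *\<^sub>C pointwise_mult a f"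
  and pointwise_mult_zero_right: "pointwise_mult a 0 = 0"
  by (simp_all add: pointwise_mult_def fun_eq_iff scaleC_fun_def
      complex_vector.scale_left_diff_distrib complex_vector.scale_right_diff_distrib
      scaleC_complex_def mult.commute)

text \<open>In terms of generating functions this is \<open>a((z + t) - t) f(z + t) = a(z) f(z + t)\<close>, with the
  left-hand side expanded in powers of \<open>t\<close>.\<close>

lemma alternating_Leibniz:
  assumes a: "a \<in> smooth_on_disc" and f: "f \<in> smooth_on_disc"
  shows "(\<Sum>j\<le>i. (-1) ^ j *\<^sub>C divided_deriv (i - j) (pointwise_mult (divided_deriv j a) f)) =
    pointwise_mult a (divided_deriv i f)"
  using a
proof (induction i arbitrary: a)
  case (Suc i)
  define X where "X b j = pointwise_mult (divided_deriv j b) f" for b j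
  have X: "X b j \<in> smooth_on_disc" if "b \<in> smooth_on_disc" for b j
    using that f by (simp add: X_def smooth_mult divided_deriv_smooth)
  have IH: "(\<Sum>j\<le>i. (-1) ^ j *\<^sub>C divided_deriv (i - j) (X b j)) = pointwise_mult b (divided_deriv i f)"
    if "b \<in> smooth_on_disc" for b
    using Suc.IH[OF that] by (simp add: X_def)
  define t where "t j = (-1) ^ j *\<^sub>C divided_deriv (Suc i - j) (X a j)" for j
  \<comment> \<open>The weight \<open>Suc i\<close> is split as \<open>(Suc i - j) + j\<close>. The
    first part of the sum is the derivative of the identity for \<open>i\<close> and
    \<open>a\<close>; the second, after an index shift, is minus the identity for \<open>i\<close>
    and \<open>cderiv a\<close>. This is why the induction is over all \<open>a\<close>.\<close>
  have "of_nat (Suc i) *\<^sub>C (\<Sum>j\<le>Suc i. t j) = (\<Sum>j\<le>Suc i. of_nat (Suc i - j) *\<^sub>C t j + of_nat j *\<^sub>C t j)"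
    unfolding complex_vector.scale_sum_right
    by (intro sum.cong refl) (simp flip: scaleC_add_left of_nat_add)
  also have "\<dots> = (\<Sum>j\<le>Suc i. of_nat (Suc i - j) *\<^sub>C t j) + (\<Sum>j\<le>Suc i. of_nat j *\<^sub>C t j)"
    by (rule sum.distrib)
  also have "(\<Sum>j\<le>Suc i. of_nat (Suc i - j) *\<^sub>C t j) = (\<Sum>j\<le>i. of_nat (Suc i - j) *\<^sub>C t j)"
    by simp
  also have "\<dots> = (\<Sum>j\<le>i. cderiv ((-1) ^ j *\<^sub>C divided_deriv (i - j) (X a j)))"
  proof (rule sum.cong)
    fix j assume "j \<in> {..i}"
    then have "Suc i - j = Suc (i - j)" by auto
    then show "of_nat (Suc i - j) *\<^sub>C t j = cderiv ((-1) ^ j *\<^sub>C divided_deriv (i - j) (X a j))"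
      using X[OF Suc.prems]
      by (simp add: t_def cderiv_scaleC smooth_cdiff divided_deriv_smooth cderiv_divided_deriv
          mult.commute del: of_nat_Suc)
  qed simp
  also have "\<dots> = cderiv (\<Sum>j\<le>i. (-1) ^ j *\<^sub>C divided_deriv (i - j) (X a j))"
    using X[OF Suc.prems] by (simp add: cderiv_sum smooth_scaleC divided_deriv_smooth)
  also have "\<dots> = cderiv (pointwise_mult a (divided_deriv i f))"
    by (simp add: IH Suc.prems)
  also have "(\<Sum>j\<le>Suc i. of_nat j *\<^sub>C t j) = (\<Sum>j\<le>i. of_nat (Suc j) *\<^sub>C t (Suc j))"
    by (subst sum.atMost_Suc_shift) simp
  also have "\<dots> = - (\<Sum>j\<le>i. (-1) ^ j *\<^sub>C divided_deriv (i - j) (X (cderiv a) j))"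
    unfolding sum_negf[symmetric]
  proof (rule sum.cong)
    fix j
    have "X (cderiv a) j = of_nat (Suc j) *\<^sub>C X a (Suc j)"
      by (simp add: X_def divided_deriv_cderiv pointwise_mult_scaleC_left del: of_nat_Suc)
    then show "of_nat (Suc j) *\<^sub>C t (Suc j) = - ((-1) ^ j *\<^sub>C divided_deriv (i - j) (X (cderiv a) j))"
      using X[OF Suc.prems]
      by (simp add: t_def divided_deriv_scaleC mult.commute del: of_nat_Suc)
  qed simp
  also have "\<dots> = - pointwise_mult (cderiv a) (divided_deriv i f)"
    by (simp add: IH Suc.prems smooth_cderiv)
  also have "cderiv (pointwise_mult a (divided_deriv i f)) + - pointwise_mult (cderiv a) (divided_deriv i f) =
      of_nat (Suc i) *\<^sub>C pointwise_mult a (divided_deriv (Suc i) f)"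
    using Suc.prems f
    by (simp add: cderiv_mult smooth_cdiff divided_deriv_smooth cderiv_divided_deriv
        pointwise_mult_scaleC_right del: of_nat_Suc)
  finally show ?case
    by (simp add: t_def X_def del: of_nat_Suc sum.atMost_Suc)
qed simp

section \<open>Termwise differentiation of vector-valued power series\<close>

lemma analytic_on_disc_iff:
  "f \<in> analytic_on_disc UNIV norm \<longleftrightarrow> vanishes_off_disc f \<and>
     (\<forall>a\<in>unit_disc. \<exists>r>0. \<exists>c. ball a r \<subseteq> unit_disc \<and> (\<forall>z\<in>ball a r. (\<lambda>k. (z - a) ^ k *\<^sub>C c k) sums f z))"
  for f :: "complex \<Rightarrow> 'a::complex_banach"
  unfolding analytic_on_disc_def vanishes_off_disc_def limitin_norm_UNIV sums_def by auto

text \<open>The differentiated terms have a summable majorant on a smaller ball around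
  \<open>a\<close> that still contains \<open>z\<close>. Since the derivative is again a power
  series about \<open>a\<close>, with coefficients independent of \<open>z\<close>, analyticity
  passes to \<open>cderiv f\<close>.\<close>

lemma power_series_has_cderiv:
  fixes f :: "complex \<Rightarrow> 'a::complex_banach"
  assumes f: "\<And>z. z \<in> ball a r \<Longrightarrow> (\<lambda>k. (z - a) ^ k *\<^sub>C c k) sums f z" and z: "z \<in> ball a r"
  shows "\<exists>d. (\<lambda>k. (z - a) ^ k *\<^sub>C (of_nat (Suc k) *\<^sub>C c (Suc k))) sums d \<and> has_cderiv f d z"
proof -
  \<comment> \<open>Two radii strictly between \<open>dist a z\<close> and \<open>r\<close>.
    Convergence at radius \<sigma> bounds the coefficients by \<open>B / \<sigma> ^ k\<close>; on
    the ball of radius \<rho> the differentiated series is then dominated by a convergent series in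
    the ratio \<open>\<rho> / \<sigma>\<close>.\<close>
  define \<rho> \<sigma> where "\<rho> = (dist a z + r) / 2" and "\<sigma> = (\<rho> + r) / 2"
  have \<rho>: "0 < \<rho>" "dist a z < \<rho>" "\<rho> < \<sigma>" "0 < \<sigma>" "\<sigma> < r"
    using z le_less_trans[OF zero_le_dist, of a z r]
    by (simp_all add: \<rho>_def \<sigma>_def add_nonneg_pos)
  have "a + of_real \<sigma> \<in> ball a r" using \<rho> by (simp add: dist_norm)
  from f[OF this] have "summable (\<lambda>k. of_real \<sigma> ^ k *\<^sub>C c k)" by (auto simp: sums_iff)
  then have "Bseq (\<lambda>k. of_real \<sigma> ^ k *\<^sub>C c k)" using summable_imp_Bseq by blast
  then obtain B where B: "B > 0" "\<And>k. norm (of_real \<sigma> ^ k *\<^sub>C c k) \<le> B" by (auto simp: Bseq_def)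
  have cB: "norm (c k) \<le> B / \<sigma> ^ k" for k
    using B(2)[of k] \<rho> by (simp add: norm_scaleC norm_power field_simps)
  define d where "d k w = (of_nat k * (w - a) ^ (k - 1)) *\<^sub>C c k" for k w
  define M where "M k = real k * \<rho> ^ (k - 1) * (B / \<sigma> ^ k)" for k
  have dM: "norm (d k w) \<le> M k" if "w \<in> ball a \<rho>" for k w
  proof -
    have "cmod (w - a) ^ (k - 1) \<le> \<rho> ^ (k - 1)"
      using that by (intro power_mono) (auto simp: dist_norm norm_minus_commute)
    then have "real k * cmod (w - a) ^ (k - 1) * norm (c k) \<le> real k * \<rho> ^ (k - 1) * (B / \<sigma> ^ k)"
      using \<rho> B(1) by (intro mult_mono cB mult_nonneg_nonneg) auto
    then show ?thesis by (simp add: d_def M_def norm_scaleC norm_mult norm_power)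
  qed
  have "summable (\<lambda>k. B / \<sigma> * (of_nat (Suc k) * (\<rho> / \<sigma>) ^ k))"
    using geometric_deriv_sums[of "\<rho> / \<sigma>"] \<rho> by (intro summable_mult) (auto simp: sums_iff)
  also have "(\<lambda>k. B / \<sigma> * (of_nat (Suc k) * (\<rho> / \<sigma>) ^ k)) = (\<lambda>k. M (Suc k))"
    using \<rho> by (simp add: M_def power_divide fun_eq_iff)
  finally have "summable M" by (simp add: summable_Suc_iff)
  then have unif: "uniform_limit (ball a \<rho>) (\<lambda>n w. \<Sum>k<n. d k w) (\<lambda>w. suminf (\<lambda>k. d k w)) sequentially"
    using dM by (intro Weierstrass_m_test) auto
  have "\<exists>g. \<forall>w\<in>ball a \<rho>. (\<lambda>k. (w - a) ^ k *\<^sub>C c k) sums (g w) \<and>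
      (g has_derivative (\<lambda>h. h *\<^sub>C suminf (\<lambda>k. d k w))) (at w within ball a \<rho>)"
  proof (rule has_derivative_series[where f' = "\<lambda>k w h. h *\<^sub>C d k w"])
    show "((\<lambda>w. (w - a) ^ k *\<^sub>C c k) has_derivative (\<lambda>h. h *\<^sub>C d k w)) (at w within ball a \<rho>)" for k w
    proof -
      have "((\<lambda>w. (w - a) ^ k) has_derivative (\<lambda>h. h * (of_nat k * (w - a) ^ (k - 1)))) (at w within ball a \<rho>)"
        by (auto intro!: derivative_eq_intros simp: mult_ac)
      from bounded_linear.has_derivative[OF scaleC.bounded_linear_left this, of "c k"]
      show ?thesis by (simp add: d_def scaleC_scaleC)
    qed
    show "\<forall>\<^sub>F n in sequentially. \<forall>w\<in>ball a \<rho>. \<forall>h.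
        norm ((\<Sum>k<n. h *\<^sub>C d k w) - h *\<^sub>C suminf (\<lambda>k. d k w)) \<le> e * norm h" if "e > 0" for e
      using uniform_limitD[OF unif that]
    proof eventually_elim
      case (elim n)
      have "norm ((\<Sum>k<n. h *\<^sub>C d k w) - h *\<^sub>C suminf (\<lambda>k. d k w)) =
          cmod h * norm ((\<Sum>k<n. d k w) - suminf (\<lambda>k. d k w))" for h w
        by (simp add: norm_scaleC flip: complex_vector.scale_sum_right
            complex_vector.scale_right_diff_distrib)
      moreover have "cmod h * norm ((\<Sum>k<n. d k w) - suminf (\<lambda>k. d k w)) \<le> e * cmod h"
        if "w \<in> ball a \<rho>" for h w
        using elim[rule_format, OF that] unfolding dist_norm
        by (subst mult.commute) (rule mult_right_mono, auto)
      ultimately show ?case by simp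
    qed
    show "a \<in> ball a \<rho>" using \<rho> by simp
    show "(\<lambda>k. (a - a) ^ k *\<^sub>C c k) sums f a" using f[of a] \<rho> by simp
  qed auto
  then obtain g where g: "\<And>w. w \<in> ball a \<rho> \<Longrightarrow> (\<lambda>k. (w - a) ^ k *\<^sub>C c k) sums (g w)"
    "\<And>w. w \<in> ball a \<rho> \<Longrightarrow> (g has_derivative (\<lambda>h. h *\<^sub>C suminf (\<lambda>k. d k w))) (at w within ball a \<rho>)"
    by blast
  have z\<rho>: "z \<in> ball a \<rho>" using \<rho> by simp
  have fg: "g w = f w" if "w \<in> ball a \<rho>" for w
    using f[of w] g(1)[of w] that \<rho> by (auto intro: sums_unique2)
  have "has_cderiv g (suminf (\<lambda>k. d k z)) z"
    using g(2)[OF z\<rho>] at_within_open[OF z\<rho> open_ball] by simp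
  then have deriv: "has_cderiv f (suminf (\<lambda>k. d k z)) z"
    by (rule has_derivative_transform_within_open[OF _ open_ball z\<rho> fg])
  have "summable (\<lambda>k. d k z)"
    by (rule summable_comparison_test'[OF \<open>summable M\<close>, of 0]) (rule dM[OF z\<rho>])
  then have "(\<lambda>k. d k z) sums (suminf (\<lambda>k. d k z))" by (rule summable_sums)
  then have "(\<lambda>k. d (Suc k) z) sums (suminf (\<lambda>k. d k z))"
    by (subst sums_Suc_iff) (simp add: d_def)
  then have "(\<lambda>k. (z - a) ^ k *\<^sub>C (of_nat (Suc k) *\<^sub>C c (Suc k))) sums (suminf (\<lambda>k. d k z))"
    by (simp add: d_def scaleC_scaleC mult.commute del: of_nat_Suc)
  with deriv show ?thesis by blast
qed

lemma analytic_cderiv: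
  fixes f :: "complex \<Rightarrow> 'a::complex_banach"
  assumes f: "f \<in> analytic_on_disc UNIV norm"
  shows "cdiff_on_disc f" "cderiv f \<in> analytic_on_disc UNIV norm"
proof -
  have *: "\<exists>r>0. \<exists>c. ball a r \<subseteq> unit_disc \<and>
      (\<forall>z\<in>ball a r. (\<lambda>k. (z - a) ^ k *\<^sub>C c k) sums cderiv f z \<and> has_cderiv f (cderiv f z) z)"
    if a: "a \<in> unit_disc" for a
  proof -
    obtain r c where r: "r > 0" "ball a r \<subseteq> unit_disc"
      and c: "\<And>z. z \<in> ball a r \<Longrightarrow> (\<lambda>k. (z - a) ^ k *\<^sub>C c k) sums f z"
      using f a unfolding analytic_on_disc_iff by blast
    have "(\<lambda>k. (z - a) ^ k *\<^sub>C (of_nat (Suc k) *\<^sub>C c (Suc k))) sums cderiv f z \<and> has_cderiv f (cderiv f z) z"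
      if z: "z \<in> ball a r" for z
    proof -
      obtain d where d: "(\<lambda>k. (z - a) ^ k *\<^sub>C (of_nat (Suc k) *\<^sub>C c (Suc k))) sums d" "has_cderiv f d z"
        using power_series_has_cderiv[OF c z] by blast
      moreover have "cderiv f z = d" using d(2) z r by (intro cderiv_eqI) auto
      ultimately show ?thesis by simp
    qed
    with r show ?thesis
      by (intro exI[of _ r] conjI exI[of _ "\<lambda>k. of_nat (Suc k) *\<^sub>C c (Suc k)"]) auto
  qed
  show "cderiv f \<in> analytic_on_disc UNIV norm"
    unfolding analytic_on_disc_iff using * by (meson vanishes_off_disc_cderiv)
  show "cdiff_on_disc f"
    unfolding cdiff_on_disc_def using * by (meson centre_in_ball)
qed

lemma analytic_smooth: "f \<in> analytic_on_disc UNIV norm \<Longrightarrow> f \<in> smooth_on_disc"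
  by (erule smooth_on_discI) (simp add: analytic_cderiv, simp add: analytic_on_disc_iff)

lemma subspace_analytic:
  "complex_vector.subspace (analytic_on_disc UNIV (norm :: 'a::complex_banach \<Rightarrow> real))"
  unfolding complex_vector.subspace_def
proof (intro conjI ballI allI)
  show "0 \<in> analytic_on_disc UNIV (norm :: 'a \<Rightarrow> real)"
    unfolding analytic_on_disc_iff
  proof (intro conjI ballI)
    fix a :: complex assume "a \<in> unit_disc"
    then obtain r where "r > 0" "ball a r \<subseteq> unit_disc" using open_contains_ball by blast
    then show "\<exists>r>0. \<exists>c. ball a r \<subseteq> unit_disc \<and> (\<forall>z\<in>ball a r. (\<lambda>k. (z - a) ^ k *\<^sub>C c k) sums (0 :: complex \<Rightarrow> 'a) z)"
      by (intro exI[of _ r] conjI exI[of _ "\<lambda>_. 0"]) auto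
  qed (simp add: vanishes_off_disc_def)
  fix f :: "complex \<Rightarrow> 'a" assume f: "f \<in> analytic_on_disc UNIV norm"
  show "c *\<^sub>C f \<in> analytic_on_disc UNIV norm" for c
    unfolding analytic_on_disc_iff
  proof (intro conjI ballI)
    fix a :: complex assume "a \<in> unit_disc"
    then obtain r d where r: "r > 0" "ball a r \<subseteq> unit_disc"
      and d: "\<And>z. z \<in> ball a r \<Longrightarrow> (\<lambda>k. (z - a) ^ k *\<^sub>C d k) sums f z"
      using f unfolding analytic_on_disc_iff by blast
    have "(\<lambda>k. (z - a) ^ k *\<^sub>C c *\<^sub>C d k) sums (c *\<^sub>C f) z" if "z \<in> ball a r" for z
      using bounded_linear.sums[OF scaleC.bounded_linear_right d[OF that], of c]
      by (simp add: scaleC_fun_def mult.commute)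
    with r show "\<exists>r>0. \<exists>d. ball a r \<subseteq> unit_disc \<and> (\<forall>z\<in>ball a r. (\<lambda>k. (z - a) ^ k *\<^sub>C d k) sums (c *\<^sub>C f) z)"
      by (intro exI[of _ r] conjI exI[of _ "\<lambda>k. c *\<^sub>C d k"]) auto
  qed (use f in \<open>auto simp: analytic_on_disc_iff vanishes_off_disc_scaleC\<close>)
  fix g :: "complex \<Rightarrow> 'a" assume g: "g \<in> analytic_on_disc UNIV norm"
  show "f + g \<in> analytic_on_disc UNIV norm"
    unfolding analytic_on_disc_iff
  proof (intro conjI ballI)
    fix a :: complex assume a: "a \<in> unit_disc"
    obtain r c where r: "r > 0" "ball a r \<subseteq> unit_disc"
      and c: "\<And>z. z \<in> ball a r \<Longrightarrow> (\<lambda>k. (z - a) ^ k *\<^sub>C c k) sums f z"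
      using f a unfolding analytic_on_disc_iff by blast
    obtain s d where s: "s > 0" "ball a s \<subseteq> unit_disc"
      and d: "\<And>z. z \<in> ball a s \<Longrightarrow> (\<lambda>k. (z - a) ^ k *\<^sub>C d k) sums g z"
      using g a unfolding analytic_on_disc_iff by blast
    have "(\<lambda>k. (z - a) ^ k *\<^sub>C (c k + d k)) sums (f + g) z" if "z \<in> ball a (min r s)" for z
      using sums_add[OF c d, of z] that by (simp add: scaleC_add_right)
    with r s show "\<exists>r>0. \<exists>d. ball a r \<subseteq> unit_disc \<and> (\<forall>z\<in>ball a r. (\<lambda>k. (z - a) ^ k *\<^sub>C d k) sums (f + g) z)"
      by (intro exI[of _ "min r s"] conjI exI[of _ "\<lambda>k. c k + d k"]) auto
  qed (use f g in \<open>auto simp: analytic_on_disc_iff vanishes_off_disc_add\<close>)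
qed

lemma divided_deriv_analytic:
  assumes "f \<in> analytic_on_disc UNIV norm"
  shows "divided_deriv k f \<in> analytic_on_disc UNIV norm"
proof -
  have "(cderiv ^^ k) f \<in> analytic_on_disc UNIV norm"
    by (induction k) (use assms in \<open>auto intro: analytic_cderiv\<close>)
  then show ?thesis
    unfolding divided_deriv_def by (intro complex_vector.subspace_scale[OF subspace_analytic])
qed

section \<open>The algebra of rapidly decreasing Taylor coefficients\<close>

lemma A_infinityD:
  assumes "a \<in> A_infinity"
  shows "vanishes_off_disc a" "a holomorphic_on unit_disc"
    "\<alpha> > 0 \<Longrightarrow> bdd_above (range (\<lambda>j. cmod (taylor_coeff a j) * (real j + 1) powr \<alpha>))"
  using assms by (auto simp: A_infinity_def vanishes_off_disc_def)

lemma A_infinityI: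
  assumes "vanishes_off_disc a" "a holomorphic_on unit_disc"
    "\<And>\<alpha>. \<alpha> > 0 \<Longrightarrow> \<exists>B. \<forall>j. cmod (taylor_coeff a j) * (real j + 1) powr \<alpha> \<le> B"
  shows "a \<in> A_infinity"
  using assms by (fastforce simp: A_infinity_def vanishes_off_disc_def bdd_above_def)

lemma A_infinity_norm_upper:
  assumes "a \<in> A_infinity" "\<alpha> > 0"
  shows "cmod (taylor_coeff a j) * (real j + 1) powr \<alpha> \<le> A_infinity_norm \<alpha> a"
  unfolding A_infinity_norm_def by (intro cSUP_upper A_infinityD assms) simp

lemma A_infinity_norm_le:
  assumes "\<And>j. cmod (taylor_coeff a j) * (real j + 1) powr \<alpha> \<le> B"
  shows "A_infinity_norm \<alpha> a \<le> B"
  unfolding A_infinity_norm_def by (intro cSUP_least assms) simp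

lemma taylor_coeff_add:
  assumes "a holomorphic_on unit_disc" "b holomorphic_on unit_disc"
  shows "taylor_coeff (a + b) j = taylor_coeff a j + taylor_coeff b j"
  unfolding taylor_coeff_def plus_fun_def
  by (subst higher_deriv_add[OF assms]) (auto simp: add_divide_distrib)

lemma taylor_coeff_scaleC:
  assumes "a holomorphic_on unit_disc"
  shows "taylor_coeff (c *\<^sub>C a) j = c * taylor_coeff a j"
  unfolding taylor_coeff_def scaleC_fun_def scaleC_complex_def
  by (subst higher_deriv_cmult[OF assms]) auto

lemma taylor_coeff_cong:
  assumes "\<And>z. z \<in> unit_disc \<Longrightarrow> a z = b z"
  shows "taylor_coeff a j = taylor_coeff b j"
proof -
  have "eventually (\<lambda>z. a z = b z) (nhds 0)"
    using assms eventually_nhds_in_open[of unit_disc 0] by (auto elim: eventually_mono)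
  from higher_deriv_cong_ev[OF this refl] show ?thesis
    unfolding taylor_coeff_def by simp
qed

text \<open>Connects the vector-valued derivative to \<open>deriv\<close>, through which Taylor
  coefficients are defined. The two agree on the disc only.\<close>

lemma holomorphic_cderiv:
  assumes "a holomorphic_on unit_disc"
  shows "cdiff_on_disc a" "z \<in> unit_disc \<Longrightarrow> cderiv a z = deriv a z"
    "cderiv a holomorphic_on unit_disc"
proof -
  have *: "has_cderiv a (deriv a z) z" if "z \<in> unit_disc" for z
    using holomorphic_derivI[OF assms open_ball that]
    by (simp add: has_field_derivative_def scaleC_complex_def mult_commute_abs)
  show eq: "cderiv a z = deriv a z" if "z \<in> unit_disc" for z
    using cderiv_eqI[OF that *[OF that]] .
  show "cdiff_on_disc a" unfolding cdiff_on_disc_def using * eq by auto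
  show "cderiv a holomorphic_on unit_disc"
    using holomorphic_deriv[OF assms open_ball] eq by (subst holomorphic_cong) auto
qed

lemma taylor_coeff_cderiv:
  assumes "a holomorphic_on unit_disc"
  shows "taylor_coeff (cderiv a) j = of_nat (Suc j) * taylor_coeff a (Suc j)"
proof -
  have "taylor_coeff (cderiv a) j = taylor_coeff (deriv a) j"
    using holomorphic_cderiv(2)[OF assms] by (rule taylor_coeff_cong)
  then show ?thesis
    by (simp add: taylor_coeff_def funpow_swap1 divide_simps del: of_nat_Suc)
qed

lemma A_infinity_smooth: "a \<in> A_infinity \<Longrightarrow> a \<in> smooth_on_disc"
  by (rule smooth_on_discI[of a "{a. vanishes_off_disc a \<and> a holomorphic_on unit_disc}"])
    (auto simp: A_infinityD holomorphic_cderiv)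

lemma normed_on_A_infinity:
  assumes \<alpha>: "\<alpha> > 0"
  shows "normed_on A_infinity (A_infinity_norm \<alpha>)"
proof
  \<comment> \<open>Stated for every exponent \<beta> and not just for \<alpha>, because closure of
    \<open>A_infinity\<close> under sums involves all exponents.\<close>
  have tri: "cmod (taylor_coeff (a + b) j) * (real j + 1) powr \<beta> \<le> A_infinity_norm \<beta> a + A_infinity_norm \<beta> b"
    if "a \<in> A_infinity" "b \<in> A_infinity" "\<beta> > 0" for a b j \<beta>
  proof -
    have "cmod (taylor_coeff (a + b) j) * (real j + 1) powr \<beta> \<le>
        (cmod (taylor_coeff a j) + cmod (taylor_coeff b j)) * (real j + 1) powr \<beta>"
      using that by (intro mult_right_mono) (auto simp: taylor_coeff_add A_infinityD norm_triangle_ineq)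
    then show ?thesis
      using A_infinity_norm_upper[OF that(1,3), of j] A_infinity_norm_upper[OF that(2,3), of j]
      by (simp add: distrib_right)
  qed
  have sc: "cmod (taylor_coeff (c *\<^sub>C a) j) * (real j + 1) powr \<beta> \<le> cmod c * A_infinity_norm \<beta> a"
    if "a \<in> A_infinity" "\<beta> > 0" for c a j \<beta>
    using mult_left_mono[OF A_infinity_norm_upper[OF that, of j], of "cmod c"] that
    by (simp add: taylor_coeff_scaleC A_infinityD norm_mult mult.assoc)
  have c0: "taylor_coeff 0 j = 0" for j
    using taylor_coeff_scaleC[of 0 0 j] by (simp add: zero_fun_def)
  show "complex_vector.subspace A_infinity"
    unfolding complex_vector.subspace_def
  proof (intro conjI ballI allI)
    show "0 \<in> A_infinity"
      by (rule A_infinityI) (auto simp: vanishes_off_disc_def c0 zero_fun_def[symmetric],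
          simp add: zero_fun_def)
    show "a + b \<in> A_infinity" if "a \<in> A_infinity" "b \<in> A_infinity" for a b
    proof (rule A_infinityI)
      show "a + b holomorphic_on unit_disc"
        unfolding plus_fun_def using that by (intro holomorphic_intros A_infinityD)
      show "\<exists>B. \<forall>j. cmod (taylor_coeff (a + b) j) * (real j + 1) powr \<beta> \<le> B" if "\<beta> > 0" for \<beta>
        using tri[OF \<open>a \<in> A_infinity\<close> \<open>b \<in> A_infinity\<close> that] by blast
    qed (use that in \<open>auto simp: vanishes_off_disc_add A_infinityD\<close>)
    show "c *\<^sub>C a \<in> A_infinity" if "a \<in> A_infinity" for c a
    proof (rule A_infinityI)
      show "c *\<^sub>C a holomorphic_on unit_disc"
        unfolding scaleC_fun_def scaleC_complex_def using that by (intro holomorphic_intros A_infinityD)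
      show "\<exists>B. \<forall>j. cmod (taylor_coeff (c *\<^sub>C a) j) * (real j + 1) powr \<beta> \<le> B" if "\<beta> > 0" for \<beta>
        using sc[OF \<open>a \<in> A_infinity\<close> that] by blast
    qed (use that in \<open>auto simp: vanishes_off_disc_scaleC A_infinityD\<close>)
  qed
  then have scale_mem: "c *\<^sub>C a \<in> A_infinity" if "a \<in> A_infinity" for c a
    using that by (rule complex_vector.subspace_scale)
  show nonneg: "0 \<le> A_infinity_norm \<alpha> a" if "a \<in> A_infinity" for a
    using A_infinity_norm_upper[OF that \<alpha>, of 0] by (smt (verit) mult_nonneg_nonneg norm_ge_zero powr_ge_zero)
  show "A_infinity_norm \<alpha> a = 0 \<longleftrightarrow> a = 0" if a: "a \<in> A_infinity" for a
  proof
    assume *: "A_infinity_norm \<alpha> a = 0"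
    have "taylor_coeff a j = 0" for j
      using A_infinity_norm_upper[OF a \<alpha>, of j] * mult_le_0_iff[of "cmod (taylor_coeff a j)"] by auto
    then have "(deriv ^^ j) a 0 = 0" for j
      by (simp add: taylor_coeff_def)
    then have "a z = 0" if "z \<in> unit_disc" for z
      using holomorphic_fun_eq_0_on_ball[OF A_infinityD(2)[OF a] that] by blast
    then show "a = 0"
      using A_infinityD(1)[OF a] by (auto simp: vanishes_off_disc_def fun_eq_iff)
  next
    assume "a = 0"
    then have "A_infinity_norm \<alpha> a \<le> 0" by (intro A_infinity_norm_le) (simp add: c0)
    with nonneg[OF a] show "A_infinity_norm \<alpha> a = 0" by simp
  qed
  show "A_infinity_norm \<alpha> (c *\<^sub>C a) = cmod c * A_infinity_norm \<alpha> a" if a: "a \<in> A_infinity" for c a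
  proof (rule antisym)
    show le: "A_infinity_norm \<alpha> (c *\<^sub>C a) \<le> cmod c * A_infinity_norm \<alpha> a"
      by (intro A_infinity_norm_le sc a \<alpha>)
    show "cmod c * A_infinity_norm \<alpha> a \<le> A_infinity_norm \<alpha> (c *\<^sub>C a)"
    proof (cases "c = 0")
      case False
      have "A_infinity_norm \<alpha> (inverse c *\<^sub>C (c *\<^sub>C a)) \<le> cmod (inverse c) * A_infinity_norm \<alpha> (c *\<^sub>C a)"
        by (intro A_infinity_norm_le sc a \<alpha> scale_mem)
      with False show ?thesis by (simp add: norm_inverse norm_divide field_simps)
    qed (use nonneg[OF scale_mem[OF a, of 0]] in simp)
  qed
  show "A_infinity_norm \<alpha> (a + b) \<le> A_infinity_norm \<alpha> a + A_infinity_norm \<alpha> b"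
    if "a \<in> A_infinity" "b \<in> A_infinity" for a b
    by (intro A_infinity_norm_le tri that \<alpha>)
qed

lemmas subspace_A_infinity = normed_on.subspace[OF normed_on_A_infinity[OF zero_less_one]]

lemma A_infinity_norm_mono:
  assumes "a \<in> A_infinity" "0 < \<alpha>" "\<alpha> \<le> \<beta>"
  shows "A_infinity_norm \<alpha> a \<le> A_infinity_norm \<beta> a"
proof (rule A_infinity_norm_le)
  fix j
  have "cmod (taylor_coeff a j) * (real j + 1) powr \<alpha> \<le> cmod (taylor_coeff a j) * (real j + 1) powr \<beta>"
    using assms by (intro mult_left_mono powr_mono) auto
  also have "\<dots> \<le> A_infinity_norm \<beta> a"
    using assms by (intro A_infinity_norm_upper) auto
  finally show "cmod (taylor_coeff a j) * (real j + 1) powr \<alpha> \<le> A_infinity_norm \<beta> a" .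
qed

text \<open>Differentiation multiplies the coefficient of index \<open>Suc j\<close> by
  \<open>Suc j\<close> and moves it to index \<open>j\<close>, which costs exactly one unit of the
  exponent.\<close>

lemma A_infinity_cderiv:
  assumes a: "a \<in> A_infinity"
  shows "cderiv a \<in> A_infinity"
    and "\<alpha> > 0 \<Longrightarrow> A_infinity_norm \<alpha> (cderiv a) \<le> A_infinity_norm (\<alpha> + 1) a"
proof -
  have *: "cmod (taylor_coeff (cderiv a) j) * (real j + 1) powr \<alpha> \<le> A_infinity_norm (\<alpha> + 1) a"
    if "\<alpha> > 0" for \<alpha> j
  proof -
    have "cmod (taylor_coeff (cderiv a) j) * (real j + 1) powr \<alpha> =
        cmod (taylor_coeff a (Suc j)) * (real (Suc j) * (real j + 1) powr \<alpha>)"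
      using a by (simp add: taylor_coeff_cderiv A_infinityD norm_mult del: of_nat_Suc)
    also have "real (Suc j) * (real j + 1) powr \<alpha> = (real j + 1) powr (\<alpha> + 1)"
      by (simp add: powr_add add.commute)
    also have "cmod (taylor_coeff a (Suc j)) * \<dots> \<le>
        cmod (taylor_coeff a (Suc j)) * (real (Suc j) + 1) powr (\<alpha> + 1)"
      using that by (intro mult_left_mono powr_mono2) auto
    also have "\<dots> \<le> A_infinity_norm (\<alpha> + 1) a"
      using that a by (intro A_infinity_norm_upper) auto
    finally show ?thesis .
  qed
  show "cderiv a \<in> A_infinity"
    by (rule A_infinityI) (use * a in \<open>auto simp: holomorphic_cderiv A_infinityD\<close>)
  show "\<alpha> > 0 \<Longrightarrow> A_infinity_norm \<alpha> (cderiv a) \<le> A_infinity_norm (\<alpha> + 1) a"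
    by (intro A_infinity_norm_le *)
qed

lemma A_infinity_cderiv_power:
  assumes a: "a \<in> A_infinity"
  shows "(cderiv ^^ k) a \<in> A_infinity"
    and "\<alpha> > 0 \<Longrightarrow> A_infinity_norm \<alpha> ((cderiv ^^ k) a) \<le> A_infinity_norm (\<alpha> + real k) a"
proof -
  show mem: "(cderiv ^^ k) a \<in> A_infinity" for k
    by (induction k) (auto simp: a A_infinity_cderiv)
  show "\<alpha> > 0 \<Longrightarrow> A_infinity_norm \<alpha> ((cderiv ^^ k) a) \<le> A_infinity_norm (\<alpha> + real k) a"
  proof (induction k arbitrary: \<alpha>)
    case (Suc k)
    then have "A_infinity_norm \<alpha> ((cderiv ^^ Suc k) a) \<le> A_infinity_norm (\<alpha> + 1) ((cderiv ^^ k) a)"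
      using A_infinity_cderiv(2)[OF mem] by simp
    also have "\<dots> \<le> A_infinity_norm (\<alpha> + 1 + real k) a"
      using Suc by simp
    finally show ?case by (simp add: algebra_simps)
  qed simp
qed

lemma A_infinity_divided_deriv:
  assumes a: "a \<in> A_infinity"
  shows "divided_deriv k a \<in> A_infinity"
    and "\<alpha> > 0 \<Longrightarrow> A_infinity_norm \<alpha> (divided_deriv k a) \<le> A_infinity_norm (\<alpha> + real k) a"
proof -
  show "divided_deriv k a \<in> A_infinity"
    unfolding divided_deriv_def
    by (intro complex_vector.subspace_scale[OF subspace_A_infinity] A_infinity_cderiv_power a)
  assume \<alpha>: "\<alpha> > 0"
  interpret normed_on A_infinity "A_infinity_norm \<alpha>" by (rule normed_on_A_infinity[OF \<alpha>])
  have "A_infinity_norm \<alpha> (divided_deriv k a) = A_infinity_norm \<alpha> ((cderiv ^^ k) a) / fact k"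
    by (simp add: divided_deriv_def scale A_infinity_cderiv_power a norm_divide)
  also have "\<dots> \<le> A_infinity_norm \<alpha> ((cderiv ^^ k) a) / 1"
    by (intro divide_left_mono nonneg A_infinity_cderiv_power a) auto
  also have "\<dots> \<le> A_infinity_norm (\<alpha> + real k) a"
    using A_infinity_cderiv_power(2)[OF a \<alpha>] by simp
  finally show "A_infinity_norm \<alpha> (divided_deriv k a) \<le> A_infinity_norm (\<alpha> + real k) a" .
qed

section \<open>Functions that extend beyond the disc, and automorphisms\<close>

definition restrict_disc :: "(complex \<Rightarrow> complex) \<Rightarrow> complex \<Rightarrow> complex" where
  "restrict_disc a z = (if z \<in> unit_disc then a z else 0)"

text \<open>Members of \<open>A_infinity\<close> vanish off the disc, whereas
  \<open>conformal_automorphism\<close> leaves the values there free. Restricting reconciles the two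
  without changing products with functions on the disc.\<close>

lemma pointwise_mult_restrict_disc:
  "vanishes_off_disc f \<Longrightarrow> pointwise_mult (restrict_disc a) f = pointwise_mult a f"
  by (auto simp: pointwise_mult_def restrict_disc_def fun_eq_iff vanishes_off_disc_def)

text \<open>Cauchy's estimates on a circle of radius larger than 1 make the Taylor coefficients
  decay geometrically, which beats every power of the index.\<close>

lemma restrict_disc_in_A_infinity:
  assumes a: "a holomorphic_on ball 0 R" and R: "R > 1"
  shows "restrict_disc a \<in> A_infinity"
proof (rule A_infinityI)
  show "vanishes_off_disc (restrict_disc a)"
    by (simp add: vanishes_off_disc_def restrict_disc_def)
  have "a holomorphic_on unit_disc"
    using a by (rule holomorphic_on_subset) (use R in auto)
  then show "restrict_disc a holomorphic_on unit_disc"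
    by (rule holomorphic_transform) (simp add: restrict_disc_def)
  define \<rho> where "\<rho> = (1 + R) / 2"
  have \<rho>: "1 < \<rho>" "\<rho> < R" using R by (auto simp: \<rho>_def)
  have cont: "continuous_on (cball 0 \<rho>) a"
    using a by (rule holomorphic_on_imp_continuous_on[OF holomorphic_on_subset]) (use \<rho> in auto)
  then have "compact (a ` cball 0 \<rho>)"
    by (rule compact_continuous_image) simp
  then have "bounded (a ` cball 0 \<rho>)" by (rule compact_imp_bounded)
  then obtain B where B: "\<And>z. z \<in> cball 0 \<rho> \<Longrightarrow> cmod (a z) \<le> B"
    unfolding bounded_iff by blast
  have "B \<ge> 0" using B[of 0] \<rho> norm_ge_zero[of "a 0"] by (simp del: norm_ge_zero)
  have coeff: "cmod (taylor_coeff (restrict_disc a) j) \<le> B / \<rho> ^ j" for j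
  proof -
    have "taylor_coeff (restrict_disc a) j = taylor_coeff a j"
      by (rule taylor_coeff_cong) (simp add: restrict_disc_def)
    moreover have "cmod ((deriv ^^ j) a 0) \<le> fact j * B / \<rho> ^ j"
      by (rule Cauchy_inequality[OF holomorphic_on_subset[OF a] cont]) (use \<rho> B in auto)
    ultimately show ?thesis
      by (simp add: taylor_coeff_def norm_divide field_simps)
  qed
  fix \<alpha> :: real assume "\<alpha> > 0"
  have "(\<lambda>j. (real j + 1) powr \<alpha> / \<rho> ^ j) \<longlonglongrightarrow> 0"
    using \<rho>(1) by real_asymp
  then have "Bseq (\<lambda>j. (real j + 1) powr \<alpha> / \<rho> ^ j)"
    by (intro convergent_imp_Bseq convergentI)
  then obtain C where C: "\<And>j. norm ((real j + 1) powr \<alpha> / \<rho> ^ j) \<le> C"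
    by (auto simp: Bseq_def)
  show "\<exists>B. \<forall>j. cmod (taylor_coeff (restrict_disc a) j) * (real j + 1) powr \<alpha> \<le> B"
  proof (intro exI allI)
    fix j
    have "cmod (taylor_coeff (restrict_disc a) j) * (real j + 1) powr \<alpha> \<le> B / \<rho> ^ j * (real j + 1) powr \<alpha>"
      by (intro mult_right_mono coeff) simp
    also have "\<dots> = B * ((real j + 1) powr \<alpha> / \<rho> ^ j)" by simp
    also have "\<dots> \<le> B * C"
      using C[of j] \<rho> \<open>B \<ge> 0\<close> by (intro mult_left_mono) auto
    finally show "cmod (taylor_coeff (restrict_disc a) j) * (real j + 1) powr \<alpha> \<le> B * C" .
  qed
qed

text \<open>The Schwarz lemma, applied to \<open>\<phi>\<close> precomposed with a Moebius map and to the inverse of that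
  composition, shows that \<open>\<phi>\<close> is a Moebius map, which extends holomorphically to a larger disc.\<close>

lemma conformal_automorphism_in_A_infinity:
  assumes "conformal_automorphism \<phi>"
  shows "restrict_disc \<phi> \<in> A_infinity"
proof -
  have hol: "\<phi> holomorphic_on unit_disc" and bij: "bij_betw \<phi> unit_disc unit_disc"
    using assms by (auto simp: conformal_automorphism_def)
  have "0 \<in> \<phi> ` unit_disc" using bij by (simp add: bij_betw_def)
  then obtain p where p: "p \<in> unit_disc" "\<phi> p = 0" by auto
  then have np: "norm p < 1" "norm (- p) < 1" by auto
  \<comment> \<open>With this sign \<open>m\<close> sends 0 to \<open>p\<close>, so that \<psi>
    fixes 0 as the Schwarz lemma requires.\<close>
  define m where "m = Moebius_function 0 (- p)"
  define \<psi> where "\<psi> = \<phi> \<circ> m"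
  have m_disc: "m z \<in> unit_disc" if "z \<in> unit_disc" for z
    using Moebius_function_norm_lt_1[OF np(2)] that by (simp add: m_def)
  have m_inv: "m (Moebius_function 0 p z) = z" "Moebius_function 0 p (m z) = z" if "z \<in> unit_disc" for z
    using Moebius_function_compose that np by (auto simp: m_def)
  have m0: "m 0 = p" by (simp add: m_def Moebius_function_of_zero)
  have \<psi>_hol: "\<psi> holomorphic_on unit_disc"
    unfolding \<psi>_def
    by (rule holomorphic_on_compose_gen[OF _ hol])
      (use m_disc Moebius_function_holomorphic[OF np(2)] in \<open>auto simp: m_def\<close>)
  have \<psi>_disc: "\<psi> z \<in> unit_disc" if "z \<in> unit_disc" for z
    using bij m_disc[OF that] unfolding \<psi>_def bij_betw_def by auto
  have \<psi>0: "\<psi> 0 = 0" by (simp add: \<psi>_def m0 p)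
  have \<psi>_inj: "inj_on \<psi> unit_disc"
    unfolding \<psi>_def
  proof (rule comp_inj_on)
    show "inj_on m unit_disc" by (metis m_inv(2) inj_onI)
    show "inj_on \<phi> (m ` unit_disc)"
      using bij m_disc unfolding bij_betw_def by (metis image_subsetI inj_on_subset)
  qed
  have \<psi>_img: "\<psi> ` unit_disc = unit_disc"
  proof -
    have "unit_disc \<subseteq> m ` unit_disc"
      using m_inv(1) Moebius_function_norm_lt_1[OF np(1)] by (metis image_eqI mem_ball_0 subsetI)
    then have "m ` unit_disc = unit_disc" using m_disc by blast
    then show ?thesis using bij unfolding \<psi>_def bij_betw_def by (metis image_comp)
  qed
  obtain g where g: "g holomorphic_on unit_disc" "\<And>z. z \<in> unit_disc \<Longrightarrow> g (\<psi> z) = z"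
    using holomorphic_has_inverse[OF \<psi>_hol open_ball \<psi>_inj] \<psi>_img by metis
  have g_disc: "norm (g w) < 1" if "norm w < 1" for w
  proof -
    have "w \<in> \<psi> ` unit_disc" using that \<psi>_img by simp
    then show ?thesis using g(2) by auto
  qed
  have "g 0 = 0" using g(2)[of 0] \<psi>0 by simp
  \<comment> \<open>Equality at one nonzero point makes \<psi> a multiple of the identity, so the
    inequalities for \<psi> and its inverse are compared at the single point 1/2.\<close>
  have "norm (\<psi> (1/2)) \<le> norm (1/2 :: complex)"
    by (rule Schwarz_Lemma(1)[OF \<psi>_hol \<psi>0]) (use \<psi>_disc in auto)
  moreover have "norm (g (\<psi> (1/2))) \<le> norm (\<psi> (1/2))"
    by (rule Schwarz_Lemma(1)[OF g(1) \<open>g 0 = 0\<close> g_disc]) (use \<psi>_disc[of "1/2"] in auto)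
  moreover have "g (\<psi> (1/2)) = 1/2" by (rule g(2)) simp
  ultimately have "norm (\<psi> (1/2)) = norm (1/2 :: complex)" by simp
  then have "\<exists>z. norm z < 1 \<and> z \<noteq> 0 \<and> norm (\<psi> z) = norm z"
    by (intro exI[of _ "1/2"]) auto
  then obtain c where c: "\<And>z. norm z < 1 \<Longrightarrow> \<psi> z = c * z"
    using Schwarz_Lemma'[OF \<psi>_hol \<psi>0] \<psi>_disc by auto
  have \<phi>_eq: "\<phi> z = c * Moebius_function 0 p z" if "z \<in> unit_disc" for z
  proof -
    have "\<phi> z = \<psi> (Moebius_function 0 p z)" using m_inv(1)[OF that] by (simp add: \<psi>_def)
    with c Moebius_function_norm_lt_1[OF np(1)] that show ?thesis by simp
  qed
  \<comment> \<open>Chosen so that \<open>R > 1\<close> and \<open>norm p * R < 1\<close>, both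
    equivalent to \<open>norm p < 1\<close>; the pole of the Moebius map then lies outside
    \<open>ball 0 R\<close>.\<close>
  define R where "R = 2 / (1 + norm p)"
  have pos: "0 < 1 + norm p" by (simp add: add_pos_nonneg)
  then have R: "R > 1" using np by (simp add: R_def pos_less_divide_eq)
  have "1 - cnj p * z \<noteq> 0" if "z \<in> ball 0 R" for z
  proof
    assume "1 - cnj p * z = 0"
    then have "norm p * norm z = 1" by (metis complex_mod_cnj eq_iff_diff_eq_0 norm_mult norm_one)
    moreover have "norm p * norm z \<le> norm p * R" using that by (intro mult_left_mono) auto
    moreover have "norm p * R < 1" using np pos
      by (simp add: R_def pos_divide_less_eq)
    ultimately show False by simp
  qed
  then have "(\<lambda>z. c * Moebius_function 0 p z) holomorphic_on ball 0 R"
    unfolding Moebius_function_simple by (intro holomorphic_intros) auto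
  then have "restrict_disc (\<lambda>z. c * Moebius_function 0 p z) \<in> A_infinity"
    using R by (rule restrict_disc_in_A_infinity)
  moreover have "restrict_disc (\<lambda>z. c * Moebius_function 0 p z) = restrict_disc \<phi>"
    using \<phi>_eq by (auto simp: restrict_disc_def fun_eq_iff)
  ultimately show ?thesis by simp
qed

text \<open>The topology is generated by balls of all centres and exponents. Because the norms
  increase with the exponent, an intersection of balls about \<open>a\<close> contains a ball for
  the larger exponent; hence a single norm controls each neighbourhood.\<close>

lemma A_infinity_nbhd:
  assumes "openin A_infinity_topology U" "a \<in> U"
  shows "a \<in> A_infinity \<and> (\<exists>\<alpha>>0. \<exists>\<epsilon>>0. {b \<in> A_infinity. A_infinity_norm \<alpha> (b - a) < \<epsilon>} \<subseteq> U)"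
  using assms(1)[unfolded A_infinity_topology_def, THEN openin_topology_generated_by] assms(2)
proof induction
  case (Int U U')
  then obtain \<alpha> \<epsilon> \<alpha>' \<epsilon>' where *: "\<alpha> > 0" "\<epsilon> > 0" "\<alpha>' > 0" "\<epsilon>' > 0" "a \<in> A_infinity"
    "{b \<in> A_infinity. A_infinity_norm \<alpha> (b - a) < \<epsilon>} \<subseteq> U"
    "{b \<in> A_infinity. A_infinity_norm \<alpha>' (b - a) < \<epsilon>'} \<subseteq> U'" by blast
  have "{b \<in> A_infinity. A_infinity_norm (max \<alpha> \<alpha>') (b - a) < min \<epsilon> \<epsilon>'} \<subseteq> U \<inter> U'"
  proof
    fix b assume b: "b \<in> {b \<in> A_infinity. A_infinity_norm (max \<alpha> \<alpha>') (b - a) < min \<epsilon> \<epsilon>'}"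
    then have "b - a \<in> A_infinity" using * complex_vector.subspace_diff[OF subspace_A_infinity] by blast
    then have "A_infinity_norm \<alpha> (b - a) < \<epsilon>" "A_infinity_norm \<alpha>' (b - a) < \<epsilon>'"
      using A_infinity_norm_mono[of "b - a" \<alpha> "max \<alpha> \<alpha>'"]
        A_infinity_norm_mono[of "b - a" \<alpha>' "max \<alpha> \<alpha>'"] b *(1,3) by auto
    then show "b \<in> U \<inter> U'" using b *(6,7) by blast
  qed
  moreover have "0 < max \<alpha> \<alpha>'" "0 < min \<epsilon> \<epsilon>'" using * by auto
  ultimately show ?case using *(5) by blast
next
  case (UN K)
  then obtain k where k: "k \<in> K" "a \<in> k" by blast
  with UN.IH[OF k] show ?case by blast
next
  case (Basis U)
  then obtain a' \<alpha> \<epsilon> where U: "U = {b \<in> A_infinity. A_infinity_norm \<alpha> (b - a') < \<epsilon>}"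
    and *: "a' \<in> A_infinity" "\<alpha> > 0" by blast
  interpret normed_on A_infinity "A_infinity_norm \<alpha>" by (rule normed_on_A_infinity[OF *(2)])
  have a: "a \<in> A_infinity" "A_infinity_norm \<alpha> (a - a') < \<epsilon>" using Basis U by auto
  have "{b \<in> A_infinity. A_infinity_norm \<alpha> (b - a) < \<epsilon> - A_infinity_norm \<alpha> (a - a')} \<subseteq> U"
  proof
    fix b assume "b \<in> {b \<in> A_infinity. A_infinity_norm \<alpha> (b - a) < \<epsilon> - A_infinity_norm \<alpha> (a - a')}"
    then show "b \<in> U" using dist_triangle[of b a a'] a * by (simp add: U)
  qed
  moreover have "0 < \<epsilon> - A_infinity_norm \<alpha> (a - a')" using a by simp
  ultimately show ?case using a(1) *(2) by blast
qed auto

lemma A_infinity_ball_open: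
  "a \<in> A_infinity \<Longrightarrow> \<alpha> > 0 \<Longrightarrow> \<epsilon> > 0 \<Longrightarrow>
    openin A_infinity_topology {b \<in> A_infinity. A_infinity_norm \<alpha> (b - a) < \<epsilon>}"
  unfolding A_infinity_topology_def by (rule topology_generated_by_Basis) blast

lemma topspace_A_infinity_topology: "topspace A_infinity_topology = A_infinity"
proof
  show "topspace A_infinity_topology \<subseteq> A_infinity"
    unfolding A_infinity_topology_def by auto
  interpret normed_on A_infinity "A_infinity_norm 1" by (rule normed_on_A_infinity) simp
  show "A_infinity \<subseteq> topspace A_infinity_topology"
  proof
    fix a assume "a \<in> A_infinity"
    then have "a \<in> {b \<in> A_infinity. A_infinity_norm 1 (b - a) < 1}"
      "openin A_infinity_topology {b \<in> A_infinity. A_infinity_norm 1 (b - a) < 1}"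
      by (auto intro: A_infinity_ball_open)
    then show "a \<in> topspace A_infinity_topology" using openin_subset by blast
  qed
qed

text \<open>Joint continuity at the origin bounds the product on a pair of small balls, and
  bilinearity spreads the bound by scaling both factors. Only one exponent enters because each
  neighbourhood of 0 in \<open>A_infinity\<close> contains a ball of one norm.\<close>

lemma A_infinity_module_bound:
  fixes F :: "(complex \<Rightarrow> 'v::complex_vector) set"
  assumes F: "normed_on F NF"
    and closed: "\<And>a f. a \<in> A_infinity \<Longrightarrow> f \<in> F \<Longrightarrow> pointwise_mult a f \<in> F"
    and cont: "continuous_map (prod_topology A_infinity_topology (norm_topology F NF)) (norm_topology F NF)
       (\<lambda>(a, f). pointwise_mult a f)"
  obtains \<alpha> C where "\<alpha> > 0" "C \<ge> 0"
    "\<And>a f. a \<in> A_infinity \<Longrightarrow> f \<in> F \<Longrightarrow> NF (pointwise_mult a f) \<le> C * A_infinity_norm \<alpha> a * NF f"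
proof -
  interpret F: normed_on F NF by fact
  have "openin (norm_topology F NF) {f\<in>F. NF f < 1}"
    using F.ball_open[OF F.mem_zero, of 1] by simp
  then have "openin (prod_topology A_infinity_topology (norm_topology F NF))
      {x \<in> A_infinity \<times> F. (\<lambda>(a, f). pointwise_mult a f) x \<in> {f\<in>F. NF f < 1}}" (is "openin _ ?S")
    using cont unfolding continuous_map_def topspace_prod_topology topspace_A_infinity_topology
      F.topspace_norm_topology by blast
  moreover have "(0, 0) \<in> ?S"
    using complex_vector.subspace_0[OF subspace_A_infinity] by (simp add: pointwise_mult_zero_right)
  ultimately obtain U V where UV: "openin A_infinity_topology U" "openin (norm_topology F NF) V"
    "0 \<in> U" "0 \<in> V" "U \<times> V \<subseteq> ?S"
    unfolding openin_prod_topology_alt by meson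
  obtain \<alpha> \<epsilon> where \<alpha>: "\<alpha> > 0" "\<epsilon> > 0" "\<And>a. a \<in> A_infinity \<Longrightarrow> A_infinity_norm \<alpha> a < \<epsilon> \<Longrightarrow> a \<in> U"
    using A_infinity_nbhd[OF UV(1,3)] by auto
  obtain \<delta> where \<delta>: "\<delta> > 0" "\<And>f. f \<in> F \<Longrightarrow> NF f < \<delta> \<Longrightarrow> f \<in> V"
    using UV(2,4) unfolding F.openin_norm_topology by (metis diff_zero)
  interpret A: normed_on A_infinity "A_infinity_norm \<alpha>" by (rule normed_on_A_infinity[OF \<alpha>(1)])
  have small: "NF (pointwise_mult a f) < 1"
    if "a \<in> A_infinity" "f \<in> F" "A_infinity_norm \<alpha> a < \<epsilon>" "NF f < \<delta>" for a f
    using UV(5) \<alpha>(3)[OF that(1,3)] \<delta>(2)[OF that(2,4)] by auto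
  show thesis
  \<comment> \<open>Both factors are rescaled, to norms \<open>\<epsilon> / 2\<close> and
    \<open>\<delta> / 2\<close>, where the product has norm below 1.\<close>
  proof (rule that[of \<alpha> "4 / (\<epsilon> * \<delta>)"])
    fix a f assume a: "a \<in> A_infinity" and f: "f \<in> F"
    show "NF (pointwise_mult a f) \<le> 4 / (\<epsilon> * \<delta>) * A_infinity_norm \<alpha> a * NF f"
    proof (cases "a = 0 \<or> f = 0")
      case True
      moreover have "pointwise_mult 0 f = 0" by (simp add: pointwise_mult_def fun_eq_iff)
      ultimately show ?thesis by (auto simp: pointwise_mult_zero_right)
    next
      case False
      then have pos: "A_infinity_norm \<alpha> a > 0" "NF f > 0"
        using A.eq_0_iff[OF a] A.nonneg[OF a] F.eq_0_iff[OF f] F.nonneg[OF f] by linarith+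
      define s where "s = complex_of_real (\<epsilon> / (2 * A_infinity_norm \<alpha> a))"
      define t where "t = complex_of_real (\<delta> / (2 * NF f))"
      have s: "cmod s = \<epsilon> / (2 * A_infinity_norm \<alpha> a)" and t: "cmod t = \<delta> / (2 * NF f)"
        using pos \<alpha> \<delta> by (simp_all add: s_def t_def norm_divide norm_mult)
      have "NF (pointwise_mult (s *\<^sub>C a) (t *\<^sub>C f)) < 1"
        using pos \<alpha>(2) \<delta>(1) a f by (intro small A.mem_scale F.mem_scale) (simp_all add: A.scale F.scale s t)
      also have "pointwise_mult (s *\<^sub>C a) (t *\<^sub>C f) = (s * t) *\<^sub>C pointwise_mult a f"
        by (simp add: pointwise_mult_scaleC_left pointwise_mult_scaleC_right)
      finally show ?thesis
        using pos \<alpha>(2) \<delta>(1) by (simp add: F.scale closed a f norm_mult s t field_simps)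
    qed
  qed (use \<alpha> \<delta> in auto)
qed

lemma A_infinity_module_continuous:
  fixes F :: "(complex \<Rightarrow> 'v::complex_vector) set"
  assumes F: "normed_on F NF" and \<alpha>: "\<alpha> > 0" and C: "C \<ge> 0"
    and closed: "\<And>a f. a \<in> A_infinity \<Longrightarrow> f \<in> F \<Longrightarrow> pointwise_mult a f \<in> F"
    and bound: "\<And>a f. a \<in> A_infinity \<Longrightarrow> f \<in> F \<Longrightarrow> NF (pointwise_mult a f) \<le> C * A_infinity_norm \<alpha> a * NF f"
  shows "continuous_map (prod_topology A_infinity_topology (norm_topology F NF)) (norm_topology F NF)
     (\<lambda>(a, f). pointwise_mult a f)"
proof -
  interpret F: normed_on F NF by fact
  interpret A: normed_on A_infinity "A_infinity_norm \<alpha>" by (rule normed_on_A_infinity[OF \<alpha>])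
  have "openin (prod_topology A_infinity_topology (norm_topology F NF))
      {x \<in> A_infinity \<times> F. (\<lambda>(a, f). pointwise_mult a f) x \<in> U}" (is "openin _ ?S")
    if U: "openin (norm_topology F NF) U" for U
    unfolding openin_prod_topology_alt
  proof (intro allI impI)
    fix a f assume "(a, f) \<in> ?S"
    then have a: "a \<in> A_infinity" and f: "f \<in> F" and "pointwise_mult a f \<in> U" by auto
    then obtain r where r: "r > 0" "\<And>g. g \<in> F \<Longrightarrow> NF (g - pointwise_mult a f) < r \<Longrightarrow> g \<in> U"
      using U unfolding F.openin_norm_topology by blast
    \<comment> \<open>The error splits as \<open>(b - a) g + a (g - f)\<close>, where
      \<open>NF g \<le> NF f + 1\<close> since \<open>\<delta> \<le> 1\<close>. It is at most
      \<open>K * \<delta> - \<delta>\<close>; the final \<open>+ 1\<close> in \<open>K\<close> makes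
      \<open>K\<close> positive and the estimate by \<open>r\<close> strict.\<close>
    define K where "K = C * (NF f + 1 + A_infinity_norm \<alpha> a) + 1"
    have K: "K > 0" using C F.nonneg[OF f] A.nonneg[OF a] by (simp add: K_def add_nonneg_pos)
    define \<delta> where "\<delta> = min 1 (r / K)"
    have \<delta>: "\<delta> > 0" "\<delta> \<le> 1" "K * \<delta> \<le> r" using r K by (auto simp: \<delta>_def min_def field_simps)
    define U1 where "U1 = {b \<in> A_infinity. A_infinity_norm \<alpha> (b - a) < \<delta>}"
    define U2 where "U2 = {g\<in>F. NF (g - f) < \<delta>}"
    have "openin A_infinity_topology U1"
      unfolding U1_def by (intro A_infinity_ball_open a \<alpha> \<delta>)
    moreover have "openin (norm_topology F NF) U2"
      unfolding U2_def by (rule F.ball_open[OF f])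
    moreover have "a \<in> U1" "f \<in> U2" using a f \<delta> by (auto simp: U1_def U2_def)
    moreover have "U1 \<times> U2 \<subseteq> ?S"
    proof (intro subsetI)
      fix x assume "x \<in> U1 \<times> U2"
      then obtain b g where x: "x = (b, g)" and "b \<in> U1" "g \<in> U2" by blast
      then have b: "b \<in> A_infinity" "A_infinity_norm \<alpha> (b - a) < \<delta>"
        and g: "g \<in> F" "NF (g - f) < \<delta>" by (auto simp: U1_def U2_def)
      have "NF g \<le> NF (g - f) + NF f"
        using F.triangle[of "g - f" f] g f by (simp add: F.mem_diff)
      then have ng: "NF g \<le> NF f + 1" using g \<delta> by simp
      have eq: "pointwise_mult b g - pointwise_mult a f = pointwise_mult (b - a) g + pointwise_mult a (g - f)"
        by (simp add: pointwise_mult_diff_left pointwise_mult_diff_right)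
      have "NF (pointwise_mult b g - pointwise_mult a f) \<le>
          NF (pointwise_mult (b - a) g) + NF (pointwise_mult a (g - f))"
        unfolding eq using a b f g by (intro F.triangle closed A.mem_diff F.mem_diff)
      also have "\<dots> \<le> C * A_infinity_norm \<alpha> (b - a) * NF g + C * A_infinity_norm \<alpha> a * NF (g - f)"
        using a b f g by (intro add_mono bound A.mem_diff F.mem_diff)
      also have "\<dots> \<le> C * \<delta> * (NF f + 1) + C * A_infinity_norm \<alpha> a * \<delta>"
        using a b f g ng C \<delta>
        by (intro add_mono mult_mono mult_nonneg_nonneg) (auto simp: A.nonneg F.nonneg A.mem_diff F.mem_diff)
      also have "\<dots> = K * \<delta> - \<delta>" by (simp add: K_def algebra_simps)
      also have "\<dots> < r" using \<delta> by simp
      finally have "pointwise_mult b g \<in> U" using b g by (intro r closed)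
      then show "x \<in> ?S"
        using b g x by simp
    qed
    ultimately show "\<exists>U1 U2. openin A_infinity_topology U1 \<and> openin (norm_topology F NF) U2 \<and>
        a \<in> U1 \<and> f \<in> U2 \<and> U1 \<times> U2 \<subseteq> ?S" by blast
  qed
  then show ?thesis
    unfolding continuous_map_def topspace_prod_topology topspace_A_infinity_topology
      F.topspace_norm_topology
    using closed by auto
qed

section \<open>The iterated spaces as sums of shifted jets\<close>

lemma sum_fun_apply: "(sum f I) z = (\<Sum>i\<in>I. f i z)"
  for f :: "'i \<Rightarrow> 'b \<Rightarrow> 'c::comm_monoid_add"
  by (induction I rule: infinite_finite_induct) auto

lemma scaleC_fun_apply: "(c *\<^sub>C f) x = c *\<^sub>C f x"
  by (simp add: scaleC_fun_def)

text \<open>In the notation of the paper, \<open>rochberg_sum n g\<close> is the sum over \<open>j\<close> of the functions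
  $\tau_{(n-j,0]} g_j$ followed by \<open>j\<close> zeros.\<close>

definition rochberg_sum :: "nat \<Rightarrow> (nat \<Rightarrow> complex \<Rightarrow> 'a::complex_banach) \<Rightarrow> complex \<Rightarrow> nat \<Rightarrow> 'a" where
  "rochberg_sum n g z i = (if i < n then \<Sum>j\<le>i. divided_deriv (i - j) (g j) z else 0)"

lemma rochberg_sum_component:
  "i < n \<Longrightarrow> (\<lambda>z. rochberg_sum n g z i) = (\<Sum>j\<le>i. divided_deriv (i - j) (g j))"
  by (simp add: fun_eq_iff rochberg_sum_def sum_fun_apply)

lemma tuples_in_mono: "V \<subseteq> W \<Longrightarrow> tuples_in n V \<subseteq> tuples_in n W"
  by (auto simp: tuples_in_def)

lemma tuples_in_nth: "x \<in> tuples_in n V \<Longrightarrow> i < n \<Longrightarrow> x i \<in> V"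
  by (simp add: tuples_in_def)

text \<open>Linearity is claimed on smooth families: \<open>cderiv\<close> selects its value by
  \<open>THE\<close>, so additivity is available only for differentiable summands.\<close>

lemma linear_rochberg_sum: "linear_on_into (tuples_in n smooth_on_disc) UNIV (rochberg_sum n)"
  unfolding linear_on_into_def
  by (auto simp: fun_eq_iff rochberg_sum_def tuples_in_nth divided_deriv_add divided_deriv_scaleC
      scaleC_fun_apply complex_vector.scale_sum_right sum.distrib intro!: sum.cong)

text \<open>Entry \<open>i\<close> is \<open>g i\<close> plus divided derivatives of the earlier
  \<open>g j\<close>. The system is triangular with the identity on the diagonal, so the coordinates
  vanish one after the other.\<close>

lemma rochberg_sum_eq_0:
  assumes g: "g \<in> tuples_in n smooth_on_disc" and eq: "rochberg_sum n g = 0"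
  shows "g = 0"
proof -
  have "g i = 0" if "i < n" for i
    using that
  proof (induction i rule: less_induct)
    case (less i)
    have "0 = (\<Sum>j\<le>i. divided_deriv (i - j) (g j))"
      using rochberg_sum_component[OF less.prems, of g] eq by (simp add: fun_eq_iff)
    also have "\<dots> = (\<Sum>j<i. divided_deriv (i - j) (g j)) + g i"
      by (simp flip: lessThan_Suc_atMost)
    also have "(\<Sum>j<i. divided_deriv (i - j) (g j)) = 0"
      using less.IH less.prems
      by (intro sum.neutral ballI) (metis divided_deriv_zero lessThan_iff less_trans)
    finally show ?case by simp
  qed
  moreover have "g i = 0" if "\<not> i < n" for i
    using that g by (simp add: tuples_in_def tuples_def)
  ultimately show ?thesis by (intro ext) (metis zero_fun_apply)
qed

lemma rochberg_sum_inj: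
  assumes g: "g \<in> tuples_in n smooth_on_disc" and h: "h \<in> tuples_in n smooth_on_disc"
    and eq: "rochberg_sum n g = rochberg_sum n h"
  shows "g = h"
proof -
  have "h + (g - h) = g" by simp
  have diff: "g - h \<in> tuples_in n smooth_on_disc"
    using g h unfolding tuples_in_def tuples_def
    by (simp add: complex_vector.subspace_diff[OF subspace_smooth_on_disc])
  have "rochberg_sum n h + rochberg_sum n (g - h) = rochberg_sum n (h + (g - h))"
    using linear_rochberg_sum[of n] h diff unfolding linear_on_into_def by metis
  then have "rochberg_sum n (g - h) = 0" using eq by simp
  with rochberg_sum_eq_0[OF diff] show ?thesis by simp
qed

lemma rochberg_sum_in_tuples: "rochberg_sum n g z \<in> tuples n"
  by (simp add: tuples_def rochberg_sum_def)

lemma rochberg_sum_analytic: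
  assumes "g \<in> tuples_in n (analytic_on_disc UNIV norm)"
  shows "rochberg_sum n g \<in> analytic_tuples n"
  unfolding analytic_tuples_def
  using assms by (auto simp: rochberg_sum_in_tuples rochberg_sum_component tuples_in_nth
      intro!: complex_vector.subspace_sum[OF subspace_analytic] divided_deriv_analytic)

text \<open>Multiplication by \<open>a\<close> in the coordinates: a lower triangular Toeplitz
  matrix of functions. No derivative falls on \<open>g\<close>, so the module property of
  \<open>F\<close> keeps the result in \<open>F\<close>.\<close>

definition multiplier :: "nat \<Rightarrow> (complex \<Rightarrow> complex) \<Rightarrow> (nat \<Rightarrow> complex \<Rightarrow> 'a::complex_banach) \<Rightarrow>
    nat \<Rightarrow> complex \<Rightarrow> 'a" where
  "multiplier n a g j =
     (if j < n then \<Sum>k\<le>j. pointwise_mult ((-1) ^ (j - k) *\<^sub>C divided_deriv (j - k) a) (g k) else 0)"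

lemma multiplier_smooth:
  assumes "a \<in> smooth_on_disc" "g \<in> tuples_in n smooth_on_disc"
  shows "multiplier n a g \<in> tuples_in n smooth_on_disc"
  using assms by (auto simp: tuples_in_def tuples_def multiplier_def
      intro!: smooth_sum smooth_mult smooth_scaleC divided_deriv_smooth)

text \<open>Each product of \<open>a\<close> with a divided derivative of \<open>g k\<close> is
  expanded by \<open>alternating_Leibniz\<close>. Collecting the terms with \<open>k + m = j\<close>
  leaves a divided derivative of order \<open>i - j\<close> applied to coordinate \<open>j\<close>
  of the multiplied family.\<close>

lemma pointwise_mult_rochberg_sum:
  fixes g :: "nat \<Rightarrow> complex \<Rightarrow> 'a::complex_banach"
  assumes a: "a \<in> smooth_on_disc" and g: "g \<in> tuples_in n smooth_on_disc"
  shows "pointwise_mult a (rochberg_sum n g) = rochberg_sum n (multiplier n a g)"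
proof (intro ext)
  fix z i
  show "pointwise_mult a (rochberg_sum n g) z i = rochberg_sum n (multiplier n a g) z i"
  proof (cases "i < n")
    case True
    define T where "T k m = (-1) ^ m *\<^sub>C divided_deriv (i - (k + m)) (pointwise_mult (divided_deriv m a) (g k))" for k m
    have sm: "pointwise_mult (divided_deriv m a) (g k) \<in> smooth_on_disc" if "k \<le> i" for m k
      using that True a g by (intro smooth_mult divided_deriv_smooth) (auto simp: tuples_in_def)
    have "pointwise_mult a (rochberg_sum n g) z i = a z *\<^sub>C (\<Sum>k\<le>i. divided_deriv (i - k) (g k) z)"
      using True by (simp add: pointwise_mult_def scaleC_fun_apply rochberg_sum_def)
    also have "\<dots> = (\<Sum>k\<le>i. pointwise_mult a (divided_deriv (i - k) (g k))) z"
      by (simp add: sum_fun_apply complex_vector.scale_sum_right pointwise_mult_def)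
    also have "(\<Sum>k\<le>i. pointwise_mult a (divided_deriv (i - k) (g k))) = (\<Sum>k\<le>i. \<Sum>m\<le>i - k. T k m)"
    proof (intro sum.cong refl)
      fix k assume "k \<in> {..i}"
      then have "g k \<in> smooth_on_disc" using True g by (auto simp: tuples_in_def)
      from alternating_Leibniz[OF a this, of "i - k"]
      show "pointwise_mult a (divided_deriv (i - k) (g k)) = (\<Sum>m\<le>i - k. T k m)"
        by (simp add: T_def)
    qed
    also have "\<dots> = (\<Sum>(k, m)\<in>{(k, m). k + m \<le> i}. T k m)"
      by (subst sum.Sigma) (auto intro!: sum.cong)
    also have "\<dots> = (\<Sum>j\<le>i. \<Sum>k\<le>j. T k (j - k))"
      by (rule sum.triangle_reindex_eq)
    also have "\<dots> = (\<Sum>j\<le>i. divided_deriv (i - j) (multiplier n a g j))"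
    proof (intro sum.cong refl)
      fix j assume j: "j \<in> {..i}"
      have "divided_deriv (i - j) (multiplier n a g j) =
          (\<Sum>k\<le>j. divided_deriv (i - j) ((-1) ^ (j - k) *\<^sub>C pointwise_mult (divided_deriv (j - k) a) (g k)))"
        using j True sm unfolding multiplier_def pointwise_mult_scaleC_left
        by (subst divided_deriv_sum[symmetric]) (auto intro!: smooth_scaleC)
      also have "\<dots> = (\<Sum>k\<le>j. T k (j - k))"
        using j sm by (intro sum.cong refl) (simp add: T_def divided_deriv_scaleC)
      finally show "(\<Sum>k\<le>j. T k (j - k)) = divided_deriv (i - j) (multiplier n a g j)" by simp
    qed
    also have "\<dots> z = rochberg_sum n (multiplier n a g) z i"
      using True by (simp add: rochberg_sum_def sum_fun_apply)
    finally show ?thesis .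
  qed (simp add: pointwise_mult_def scaleC_fun_apply rochberg_sum_def)
qed

section \<open>Identification with the recursively defined spaces\<close>

lemma rochberg_sum_last: "tuple_last (rochberg_sum (Suc n) g) = g 0"
  by (simp add: tuple_last_def rochberg_sum_def fun_eq_iff)

text \<open>The summand for \<open>j = 0\<close> is the shifted jet of \<open>g 0\<close>; the
  others form the same construction for the tail of \<open>g\<close>. This is exactly the recursion
  that defines \<open>iterated_space\<close> and \<open>iterated_norm\<close>.\<close>

lemma rochberg_sum_init:
  "tuple_init (rochberg_sum (Suc n) g) = tau_shift n (g 0) + rochberg_sum n (\<lambda>j. g (Suc j))"
  by (simp add: fun_eq_iff tuple_init_def tau_shift_def rochberg_sum_def sum.atMost_Suc_shift
      divided_deriv_def scaleC_fun_apply del: sum.atMost_Suc funpow.simps fact_Suc)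

text \<open>Subtracting the shifted jet of the last entry strips off coordinate 0, and the induction
  hypothesis supplies the remaining ones; conversely \<open>case_nat\<close> puts the last entry
  back in front of them.\<close>

lemma iterated_space_eq:
  fixes F :: "(complex \<Rightarrow> 'a::complex_banach) set"
  assumes F: "F \<subseteq> analytic_on_disc UNIV norm"
  shows "iterated_space F (Suc n) = rochberg_sum (Suc n) ` tuples_in (Suc n) F"
proof (induction n)
  case 0
  show ?case
  proof (intro equalityI subsetI)
    fix G assume G: "G \<in> iterated_space F (Suc 0)"
    define g :: "nat \<Rightarrow> complex \<Rightarrow> 'a" where "g = (\<lambda>i. if i = 0 then tuple_last G else 0)"
    have "rochberg_sum (Suc 0) g = G"
      using G by (auto simp: fun_eq_iff rochberg_sum_def g_def tuple_last_def analytic_tuples_def tuples_def)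
    moreover have "g \<in> tuples_in (Suc 0) F"
      using G by (auto simp: g_def tuples_in_def tuples_def)
    ultimately show "G \<in> rochberg_sum (Suc 0) ` tuples_in (Suc 0) F" by blast
  next
    fix G assume "G \<in> rochberg_sum (Suc 0) ` tuples_in (Suc 0) F"
    then show "G \<in> iterated_space F (Suc 0)"
      using rochberg_sum_analytic tuples_in_mono[OF F]
      by (auto simp: rochberg_sum_last tuples_in_nth)
  qed
next
  case (Suc n)
  show ?case
  proof (intro equalityI subsetI)
    fix G assume G: "G \<in> iterated_space F (Suc (Suc n))"
    then have mem: "G \<in> analytic_tuples (Suc (Suc n))" "tuple_last G \<in> F"
      "tuple_init G - tau_shift (Suc n) (tuple_last G) \<in> rochberg_sum (Suc n) ` tuples_in (Suc n) F"
      unfolding Suc.IH[symmetric] by auto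
    then obtain h where h: "h \<in> tuples_in (Suc n) F"
      "tuple_init G - tau_shift (Suc n) (tuple_last G) = rochberg_sum (Suc n) h" by blast
    define g where "g = case_nat (tuple_last G) h"
    have "tuple_init (rochberg_sum (Suc (Suc n)) g) = tuple_init G"
      unfolding rochberg_sum_init using h(2) by (simp add: g_def algebra_simps)
    moreover have "tuple_last (rochberg_sum (Suc (Suc n)) g) = tuple_last G"
      by (simp add: rochberg_sum_last g_def)
    ultimately have "rochberg_sum (Suc (Suc n)) g z i = G z i" for z i
      by (cases i) (simp_all add: tuple_init_def tuple_last_def fun_eq_iff)
    then have "rochberg_sum (Suc (Suc n)) g = G" by (simp add: fun_eq_iff)
    moreover have "g \<in> tuples_in (Suc (Suc n)) F"
      using mem(2) h(1) by (auto simp: g_def tuples_in_def tuples_def split: nat.split)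
    ultimately show "G \<in> rochberg_sum (Suc (Suc n)) ` tuples_in (Suc (Suc n)) F" by blast
  next
    fix G assume "G \<in> rochberg_sum (Suc (Suc n)) ` tuples_in (Suc (Suc n)) F"
    then obtain g where g: "g \<in> tuples_in (Suc (Suc n)) F" "G = rochberg_sum (Suc (Suc n)) g" by blast
    have "G \<in> analytic_tuples (Suc (Suc n))"
      using g rochberg_sum_analytic tuples_in_mono[OF F] by blast
    moreover have "(\<lambda>j. g (Suc j)) \<in> tuples_in (Suc n) F"
      using g by (auto simp: tuples_in_def tuples_def)
    then have "tuple_init G - tau_shift (Suc n) (g 0) \<in> iterated_space F (Suc n)"
      unfolding Suc.IH g(2) rochberg_sum_init by simp
    ultimately show "G \<in> iterated_space F (Suc (Suc n))"
      using g by (simp add: rochberg_sum_last tuples_in_nth)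
  qed
qed

lemma iterated_norm_rochberg_sum:
  "iterated_norm NF (Suc n) (rochberg_sum (Suc n) g) = sum_norm (Suc n) NF g"
proof (induction n arbitrary: g)
  case (Suc n)
  have "iterated_norm NF (Suc (Suc n)) (rochberg_sum (Suc (Suc n)) g) =
      sum_norm (Suc n) NF (\<lambda>j. g (Suc j)) + NF (g 0)"
    using Suc[of "\<lambda>j. g (Suc j)"] by (simp add: rochberg_sum_last rochberg_sum_init)
  also have "\<dots> = sum_norm (Suc (Suc n)) NF g"
    unfolding sum_norm_def by (subst (2) sum.lessThan_Suc_shift) simp
  finally show ?case .
qed (simp add: rochberg_sum_last sum_norm_def)

text \<open>A jet has the single coordinate \<open>f\<close>, in position 0. Claim (i) is then an
  instance of the formulas for the space and its norm.\<close>

lemma tau_eq_rochberg_sum: "tau n f = rochberg_sum n (\<lambda>i. if i = 0 then f else 0)"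
proof (intro ext)
  fix z i
  have "(\<Sum>j\<le>i. divided_deriv (i - j) (if j = 0 then f else 0) z) = divided_deriv i f z"
    by (subst sum.remove[of _ 0]) auto
  then show "tau n f z i = rochberg_sum n (\<lambda>i. if i = 0 then f else 0) z i"
    by (simp add: tau_def rochberg_sum_def divided_deriv_def scaleC_fun_apply)
qed

section \<open>Analyticity of tuple-valued functions\<close>

lemma limitin_tuples:
  fixes s :: "nat \<Rightarrow> nat \<Rightarrow> 'a::complex_banach"
  assumes s: "\<And>m. s m \<in> tuples n"
  shows "limitin (norm_topology (tuples n) (tuple_norm n)) s l sequentially \<longleftrightarrow>
    l \<in> tuples n \<and> (\<forall>i<n. (\<lambda>m. s m i) \<longlonglongrightarrow> l i)"
proof -
  interpret normed_on "tuples n" "tuple_norm n :: (nat \<Rightarrow> 'a) \<Rightarrow> real"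
    using normed_on_tuples_in[OF normed_on_UNIV, of n]
    by (simp add: tuples_in_UNIV sum_norm_eq_tuple_norm)
  have "(\<lambda>m. tuple_norm n (s m - l)) \<longlonglongrightarrow> 0 \<longleftrightarrow> (\<forall>i<n. (\<lambda>m. s m i) \<longlonglongrightarrow> l i)"
  proof safe
    fix i assume lim: "(\<lambda>m. tuple_norm n (s m - l)) \<longlonglongrightarrow> 0" and i: "i < n"
    have "norm (s m i - l i) \<le> tuple_norm n (s m - l)" for m
      unfolding tuple_norm_def
      using i member_le_sum[of i "{..<n}" "\<lambda>i. norm ((s m - l) i)"] by simp
    then have "(\<lambda>m. s m i - l i) \<longlonglongrightarrow> 0"
      by (intro Lim_null_comparison[OF _ lim]) auto
    then show "(\<lambda>m. s m i) \<longlonglongrightarrow> l i" by (simp add: LIM_zero_iff)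
  next
    assume "\<forall>i<n. (\<lambda>m. s m i) \<longlonglongrightarrow> l i"
    then have "(\<lambda>m. \<Sum>i<n. norm (s m i - l i)) \<longlonglongrightarrow> (\<Sum>i<n. norm (l i - l i))"
      by (intro tendsto_sum tendsto_norm tendsto_diff) auto
    then show "(\<lambda>m. tuple_norm n (s m - l)) \<longlonglongrightarrow> 0" by (simp add: tuple_norm_def)
  qed
  with s show ?thesis by (simp add: limitin_norm_topology)
qed

text \<open>Convergence in the sum norm is entrywise, and the finitely many entries have a common
  disc of expansion about each point. This lets the definition of \<open>acceptable_space\<close> be
  read through the entries.\<close>

lemma analytic_on_disc_tuples:
  "analytic_on_disc (tuples n) (tuple_norm n) = (analytic_tuples n :: (complex \<Rightarrow> nat \<Rightarrow> 'a::complex_banach) set)"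
proof (intro equalityI subsetI)
  fix G :: "complex \<Rightarrow> nat \<Rightarrow> 'a"
  assume G: "G \<in> analytic_on_disc (tuples n) (tuple_norm n)"
  have tup: "G z \<in> tuples n" for z
    using G unfolding analytic_on_disc_def by (cases "z \<in> unit_disc") (auto simp: tuples_def)
  moreover have "(\<lambda>z. G z i) \<in> analytic_on_disc UNIV norm" if i: "i < n" for i
    unfolding analytic_on_disc_iff
  proof (intro conjI ballI)
    show "vanishes_off_disc (\<lambda>z. G z i)"
      using G by (simp add: analytic_on_disc_def vanishes_off_disc_def)
    fix a assume "a \<in> unit_disc"
    then obtain r c where r: "r > 0" "ball a r \<subseteq> unit_disc" "\<And>k. c k \<in> tuples n"
      and lim: "\<And>z. z \<in> ball a r \<Longrightarrow>
        limitin (norm_topology (tuples n) (tuple_norm n)) (\<lambda>m. \<Sum>k<m. (z - a) ^ k *\<^sub>C c k) (G z) sequentially"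
      using G unfolding analytic_on_disc_def by blast
    have "(\<Sum>k<m. (z - a) ^ k *\<^sub>C c k) \<in> tuples n" for m z
      using r(3) by (auto simp: tuples_def sum_fun_apply scaleC_fun_apply)
    then have "(\<lambda>k. (z - a) ^ k *\<^sub>C c k i) sums G z i" if "z \<in> ball a r" for z
      using lim[OF that] i by (simp add: limitin_tuples sums_def sum_fun_apply scaleC_fun_apply)
    with r(1,2) show "\<exists>r>0. \<exists>c. ball a r \<subseteq> unit_disc \<and> (\<forall>z\<in>ball a r. (\<lambda>k. (z - a) ^ k *\<^sub>C c k) sums G z i)"
      by (intro exI[of _ r] conjI exI[of _ "\<lambda>k. c k i"]) auto
  qed
  ultimately show "G \<in> analytic_tuples n" by (simp add: analytic_tuples_def)
next
  fix G :: "complex \<Rightarrow> nat \<Rightarrow> 'a"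
  assume G: "G \<in> analytic_tuples n"
  then have tup: "G z \<in> tuples n" and an: "i < n \<Longrightarrow> (\<lambda>z. G z i) \<in> analytic_on_disc UNIV norm" for z i
    by (auto simp: analytic_tuples_def)
  have off: "G z = 0" if "z \<notin> unit_disc" for z
  proof
    fix i show "G z i = 0 i"
      using an[of i] tup[of z] that
      by (cases "i < n") (auto simp: analytic_on_disc_iff vanishes_off_disc_def tuples_def)
  qed
  have "\<exists>r>0. \<exists>c. ball a r \<subseteq> unit_disc \<and> (\<forall>k. c k \<in> tuples n) \<and> (\<forall>z\<in>ball a r.
      limitin (norm_topology (tuples n) (tuple_norm n)) (\<lambda>m. \<Sum>k<m. (z - a) ^ k *\<^sub>C c k) (G z) sequentially)"
    if a: "a \<in> unit_disc" for a
  proof -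
    have "\<forall>i\<in>{..<n}. \<exists>r c. r > 0 \<and> ball a r \<subseteq> unit_disc \<and> (\<forall>z\<in>ball a r. (\<lambda>k. (z - a) ^ k *\<^sub>C c k) sums G z i)"
      using an a unfolding analytic_on_disc_iff by blast
    then obtain r c where r: "\<And>i. i < n \<Longrightarrow> r i > 0"
      and c: "\<And>i z. i < n \<Longrightarrow> z \<in> ball a (r i) \<Longrightarrow> (\<lambda>k. (z - a) ^ k *\<^sub>C c i k) sums G z i"
      unfolding bchoice_iff lessThan_iff by blast
    \<comment> \<open>The inserted \<open>1 - norm a\<close> keeps the ball inside the disc and
      makes the set nonempty when \<open>n = 0\<close>.\<close>
    define R where "R = Min (insert (1 - norm a) (r ` {..<n}))"
    have R: "R > 0" "R \<le> 1 - norm a" "\<And>i. i < n \<Longrightarrow> R \<le> r i"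
      using a r unfolding R_def by (auto simp: Min_gr_iff)
    define d where "d k = (\<lambda>i. if i < n then c i k else 0)" for k
    have d: "d k \<in> tuples n" for k by (simp add: d_def tuples_def)
    have "limitin (norm_topology (tuples n) (tuple_norm n)) (\<lambda>m. \<Sum>k<m. (z - a) ^ k *\<^sub>C d k) (G z) sequentially"
      if "z \<in> ball a R" for z
    proof (subst limitin_tuples)
      show "(\<Sum>k<m. (z - a) ^ k *\<^sub>C d k) \<in> tuples n" for m
        using d by (auto simp: tuples_def sum_fun_apply scaleC_fun_apply)
      have "(\<lambda>k. (z - a) ^ k *\<^sub>C d k i) sums G z i" if "i < n" for i
        using c[OF that, of z] R(3)[OF that] \<open>z \<in> ball a R\<close> that by (simp add: d_def)
      then show "G z \<in> tuples n \<and> (\<forall>i<n. (\<lambda>m. (\<Sum>k<m. (z - a) ^ k *\<^sub>C d k) i) \<longlonglongrightarrow> G z i)"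
        using tup by (simp add: sums_def sum_fun_apply scaleC_fun_apply)
    qed
    moreover have "ball a R \<subseteq> unit_disc"
    proof
      fix z assume "z \<in> ball a R"
      then show "z \<in> unit_disc" using R(2) dist_triangle[of 0 z a] by (simp add: dist_commute)
    qed
    ultimately show ?thesis using R(1) d by blast
  qed
  with tup off show "G \<in> analytic_on_disc (tuples n) (tuple_norm n)"
    unfolding analytic_on_disc_def by blast
qed

section \<open>Acceptability and the Rochberg spaces\<close>

text \<open>A sequential form of the derivative, because the Baire argument concerns sequences of
  operators.\<close>

lemma has_cderiv_difference_quotient:
  assumes f: "has_cderiv f d z" and h: "\<And>m. h m \<noteq> 0" "h \<longlonglongrightarrow> 0"
  shows "(\<lambda>m. inverse (h m) *\<^sub>C (f (z + h m) - f z)) \<longlonglongrightarrow> d"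
proof -
  have "filterlim h (at 0) sequentially" using h by (simp add: filterlim_at)
  moreover have "(\<lambda>x. norm (f (z + x) - f z - x *\<^sub>C d) / norm x) \<midarrow>0\<rightarrow> 0"
    using f unfolding has_derivative_at by blast
  ultimately have lim: "(\<lambda>m. norm (f (z + h m) - f z - h m *\<^sub>C d) / norm (h m)) \<longlonglongrightarrow> 0"
    by (rule filterlim_compose[rotated])
  have "norm (f (z + h m) - f z - h m *\<^sub>C d) / norm (h m) = norm (inverse (h m) *\<^sub>C (f (z + h m) - f z) - d)" for m
  proof -
    have "inverse (h m) *\<^sub>C (h m *\<^sub>C d) = d"
      using h(1)[of m] by (simp add: scaleC_scaleC scaleC_one)
    then have "inverse (h m) *\<^sub>C (f (z + h m) - f z) - d = inverse (h m) *\<^sub>C (f (z + h m) - f z - h m *\<^sub>C d)"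
      unfolding complex_vector.scale_right_diff_distrib[of _ "f (z + h m) - f z"] by simp
    then show ?thesis by (simp only: norm_scaleC norm_inverse divide_inverse mult.commute)
  qed
  with lim show ?thesis by (simp add: tendsto_norm_zero_iff LIM_zero_iff)
qed

lemma linear_on_into_subset: "linear_on_into V W T \<Longrightarrow> U \<subseteq> V \<Longrightarrow> linear_on_into U W T"
  unfolding linear_on_into_def by blast

text \<open>The invariance condition concerns an arbitrary analytic \<open>G\<close>, so coordinates
  must exist before \<open>G\<close> is known to lie in the iterated space. They come from the
  recursion applied to the space of all analytic functions in place of \<open>F\<close>.\<close>

lemma analytic_tuples_subset_rochberg_sum:
  "(analytic_tuples (Suc n) :: (complex \<Rightarrow> nat \<Rightarrow> 'a::complex_banach) set) \<subseteq> rochberg_sum (Suc n) ` tuples_in (Suc n) (analytic_on_disc UNIV norm)"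
proof -
  have "(analytic_tuples (Suc n) :: (complex \<Rightarrow> nat \<Rightarrow> 'a) set) \<subseteq> iterated_space (analytic_on_disc UNIV norm) (Suc n)"
  proof (induction n)
    case (Suc n)
    show ?case
    proof
      fix G :: "complex \<Rightarrow> nat \<Rightarrow> 'a"
      assume G: "G \<in> analytic_tuples (Suc (Suc n))"
      then have an: "i < Suc (Suc n) \<Longrightarrow> (\<lambda>z. G z i) \<in> analytic_on_disc UNIV norm"
        and tup: "G z \<in> tuples (Suc (Suc n))" for i z
        by (auto simp: analytic_tuples_def)
      have last: "tuple_last G \<in> analytic_on_disc UNIV norm"
        using an[of 0] by (simp add: tuple_last_def)
      have "(\<lambda>z. (tuple_init G - tau_shift (Suc n) (tuple_last G)) z i) \<in> analytic_on_disc UNIV norm"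
        if i: "i < Suc n" for i
      proof -
        have "(\<lambda>z. (tuple_init G - tau_shift (Suc n) (tuple_last G)) z i) =
            (\<lambda>z. G z (Suc i)) - divided_deriv (Suc i) (tuple_last G)"
          using i by (simp add: fun_eq_iff tuple_init_def tau_shift_def divided_deriv_def
              scaleC_fun_apply del: funpow.simps fact_Suc)
        also have "\<dots> \<in> analytic_on_disc UNIV norm"
          using i by (intro complex_vector.subspace_diff[OF subspace_analytic] an
              divided_deriv_analytic last) simp
        finally show ?thesis .
      qed
      moreover have "(tuple_init G - tau_shift (Suc n) (tuple_last G)) z \<in> tuples (Suc n)" for z
        using tup[of z] by (simp add: tuples_def tuple_init_def tau_shift_def)
      ultimately have "tuple_init G - tau_shift (Suc n) (tuple_last G) \<in> analytic_tuples (Suc n)"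
        unfolding analytic_tuples_def by blast
      with Suc.IH G last show "G \<in> iterated_space (analytic_on_disc UNIV norm) (Suc (Suc n))"
        by auto
    qed
  qed (auto simp: analytic_tuples_def tuple_last_def)
  then show ?thesis by (simp only: iterated_space_eq[OF subset_refl])
qed

section \<open>Multiplication by \<open>w - z\<close> and its action on jets at
  \<open>z\<close>\<close>

definition disc_shift :: "complex \<Rightarrow> (complex \<Rightarrow> 'a::complex_banach) \<Rightarrow> complex \<Rightarrow> 'a" where
  "disc_shift z = pointwise_mult (restrict_disc (\<lambda>w. w - z))"

lemma restrict_disc_linear_in_A_infinity: "restrict_disc (\<lambda>w. w - z) \<in> A_infinity"
  by (rule restrict_disc_in_A_infinity[of _ 2]) (auto intro!: holomorphic_intros)

lemma cderiv_disc_shift: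
  assumes f: "f \<in> smooth_on_disc"
  shows "cderiv (disc_shift z f) = f + disc_shift z (cderiv f)"
proof -
  define p where "p = restrict_disc (\<lambda>w. w - z)"
  have p: "p \<in> A_infinity" unfolding p_def by (rule restrict_disc_linear_in_A_infinity)
  have "cderiv p w = 1" if w: "w \<in> unit_disc" for w
  proof (rule cderiv_eqI[OF w])
    have "((\<lambda>w. w - z) has_derivative (\<lambda>h. h *\<^sub>C 1)) (at w)"
      by (auto intro!: derivative_eq_intros simp: scaleC_complex_def)
    then show "has_cderiv p 1 w"
      by (rule has_derivative_transform_within_open[OF _ open_ball w]) (simp add: p_def restrict_disc_def)
  qed
  then have "cderiv p w *\<^sub>C f w = f w" for w
    using smooth_vanishes[OF f]
    by (cases "w \<in> unit_disc") (auto simp: vanishes_off_disc_def scaleC_one simp del: mem_ball)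
  then have "pointwise_mult (cderiv p) f = f"
    by (simp add: fun_eq_iff pointwise_mult_def)
  then show ?thesis
    using cderiv_mult[OF smooth_cdiff[OF A_infinity_smooth[OF p]] smooth_cdiff[OF f]]
    by (simp add: disc_shift_def p_def)
qed

lemma disc_shift_smooth: "f \<in> smooth_on_disc \<Longrightarrow> disc_shift z f \<in> smooth_on_disc"
  unfolding disc_shift_def
  by (intro smooth_mult A_infinity_smooth restrict_disc_linear_in_A_infinity)

text \<open>The derivative of the factor \<open>w - z\<close> is 1 on the disc, so the Leibniz rule
  leaves only two terms.\<close>

lemma cderiv_power_disc_shift:
  assumes f: "f \<in> smooth_on_disc"
  shows "(cderiv ^^ Suc k) (disc_shift z f) =
    of_nat (Suc k) *\<^sub>C (cderiv ^^ k) f + disc_shift z ((cderiv ^^ Suc k) f)"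
proof (induction k)
  case 0
  show ?case using f by (simp add: cderiv_disc_shift scaleC_one)
next
  case (Suc k)
  define u where "u = (cderiv ^^ Suc k) f"
  have u: "u \<in> smooth_on_disc" unfolding u_def using f by (rule cderiv_power_smooth)
  have u': "(cderiv ^^ k) f \<in> smooth_on_disc" "cderiv ((cderiv ^^ k) f) = u"
    using f by (simp_all add: cderiv_power_smooth u_def)
  have "(cderiv ^^ Suc (Suc k)) (disc_shift z f) = cderiv ((cderiv ^^ Suc k) (disc_shift z f))"
    by (simp only: funpow.simps o_apply)
  also have "\<dots> = cderiv (of_nat (Suc k) *\<^sub>C (cderiv ^^ k) f + disc_shift z u)"
    by (simp only: Suc u_def)
  also have "\<dots> = of_nat (Suc k) *\<^sub>C u + (u + disc_shift z (cderiv u))"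
    using u u' by (simp add: cderiv_add cderiv_scaleC smooth_cdiff smooth_scaleC disc_shift_smooth
        cderiv_disc_shift del: of_nat_Suc)
  also have "\<dots> = of_nat (Suc (Suc k)) *\<^sub>C u + disc_shift z (cderiv u)"
    by (simp only: of_nat_Suc[of "Suc k"] scaleC_add_left scaleC_one add_ac)
  finally show ?case by (simp add: u_def)
qed

text \<open>The term that keeps the factor \<open>w - z\<close> vanishes at \<open>z\<close>, and
  the factor \<open>Suc k'\<close> is absorbed by the factorial. On jets at \<open>z\<close> the
  operator is therefore the shift by one place, with 0 entering at index 0.\<close>

lemma divided_deriv_disc_shift:
  assumes f: "f \<in> smooth_on_disc" and z: "z \<in> unit_disc"
  shows "divided_deriv k (disc_shift z f) z = (case k of 0 \<Rightarrow> 0 | Suc k' \<Rightarrow> divided_deriv k' f z)"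
proof (cases k)
  case 0
  then show ?thesis using z by (simp add: disc_shift_def pointwise_mult_def restrict_disc_def)
next
  case (Suc k')
  have "(cderiv ^^ Suc k') (disc_shift z f) z = of_nat (Suc k') *\<^sub>C (cderiv ^^ k') f z"
    unfolding cderiv_power_disc_shift[OF f] using z
    by (simp add: disc_shift_def pointwise_mult_def restrict_disc_def scaleC_fun_apply)
  then show ?thesis
    by (simp add: Suc divided_deriv_def scaleC_fun_apply del: funpow.simps of_nat_Suc)
qed

lemma disc_shift_power_smooth: "f \<in> smooth_on_disc \<Longrightarrow> (disc_shift z ^^ j) f \<in> smooth_on_disc"
  by (induction j) (auto simp: disc_shift_smooth)

lemma divided_deriv_disc_shift_power:
  assumes f: "f \<in> smooth_on_disc" and z: "z \<in> unit_disc"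
  shows "divided_deriv k ((disc_shift z ^^ j) f) z = (if j \<le> k then divided_deriv (k - j) f z else 0)"
proof (induction j arbitrary: k)
  case (Suc j)
  then show ?case
    using divided_deriv_disc_shift[OF disc_shift_power_smooth[OF f] z]
    by (auto split: nat.split)
qed simp

lemma signed_divided_deriv:
  assumes a: "a \<in> A_infinity"
  shows "(-1) ^ k *\<^sub>C divided_deriv k a \<in> A_infinity"
    and "\<alpha> > 0 \<Longrightarrow> A_infinity_norm \<alpha> ((-1) ^ k *\<^sub>C divided_deriv k a) \<le> A_infinity_norm (\<alpha> + real k) a"
  using A_infinity_divided_deriv[OF a]
  by (auto simp: complex_vector.subspace_scale[OF subspace_A_infinity] norm_power
      normed_on.scale[OF normed_on_A_infinity])

section \<open>Transfer of the axioms through the coordinates\<close>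

locale acceptable =
  fixes F :: "(complex \<Rightarrow> 'a::complex_banach) set" and NF :: "(complex \<Rightarrow> 'a) \<Rightarrow> real"
  assumes acceptable: "acceptable_space UNIV norm F NF"
begin

lemma banach: "complex_banach_on F NF"
  using acceptable by (simp add: acceptable_space_def)

sublocale normed_on F NF
  using banach by (rule complex_banach_onD)

lemma analytic: "F \<subseteq> analytic_on_disc UNIV norm"
  using acceptable by (simp add: acceptable_space_def)

lemma smooth: "F \<subseteq> smooth_on_disc"
  using analytic analytic_smooth by blast

lemma mult_mem: "a \<in> A_infinity \<Longrightarrow> f \<in> F \<Longrightarrow> pointwise_mult a f \<in> F"
  using acceptable by (simp add: acceptable_space_def)

lemma mult_bound:
  obtains \<alpha> C where "\<alpha> > 0" "C \<ge> 0"
    "\<And>a f. a \<in> A_infinity \<Longrightarrow> f \<in> F \<Longrightarrow> NF (pointwise_mult a f) \<le> C * A_infinity_norm \<alpha> a * NF f"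
proof -
  have "continuous_map (prod_topology A_infinity_topology (norm_topology F NF)) (norm_topology F NF)
      (\<lambda>(a, f). pointwise_mult a f)"
    using acceptable by (simp add: acceptable_space_def)
  from A_infinity_module_bound[OF normed_on_axioms _ this] mult_mem
  obtain \<alpha> C where "\<alpha> > 0" "C \<ge> 0"
    "\<And>a f. a \<in> A_infinity \<Longrightarrow> f \<in> F \<Longrightarrow> NF (pointwise_mult a f) \<le> C * A_infinity_norm \<alpha> a * NF f"
    by blast
  then show thesis by (rule that)
qed

text \<open>The next derivative at \<open>z\<close> is a pointwise limit of difference quotients,
  each bounded on \<open>F\<close> by the induction hypothesis at two points of the disc; hence the
  induction is over all \<open>z\<close>. Baire makes the limit bounded.\<close>

lemma cderiv_power_bound:
  "z \<in> unit_disc \<Longrightarrow> \<exists>C\<ge>0. \<forall>f\<in>F. norm ((cderiv ^^ k) f z) \<le> C * NF f"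
proof (induction k arbitrary: z)
  case 0
  have "linear_on_into F UNIV (\<lambda>f. f z)"
    by (auto simp: linear_on_into_def scaleC_fun_apply)
  moreover have "continuous_map (norm_topology F NF) (norm_topology UNIV norm) (\<lambda>f. f z)"
    using acceptable 0 by (simp add: acceptable_space_def)
  ultimately obtain C where "C \<ge> 0" "\<And>f. f \<in> F \<Longrightarrow> norm (f z) \<le> C * NF f"
    using bounded_linear_if_continuous_map[OF normed_on_axioms normed_on_UNIV] by metis
  then show ?case by auto
next
  case (Suc k)
  \<comment> \<open>Scaled by \<open>1 - norm z\<close> so that \<open>z + h m\<close> stays in the
    disc; the double \<open>Suc\<close> makes the remaining factor smaller than 1 already for
    \<open>m = 0\<close>.\<close>
  define h where "h m = complex_of_real ((1 - norm z) * inverse (real (Suc (Suc m))))" for m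
  have h0: "h m \<noteq> 0" for m using Suc.prems by (simp add: h_def del: of_nat_Suc)
  have "(\<lambda>m. inverse (real (Suc (Suc m)))) \<longlonglongrightarrow> 0"
    using LIMSEQ_inverse_real_of_nat by (rule LIMSEQ_Suc)
  then have "(\<lambda>m. (1 - norm z) * inverse (real (Suc (Suc m)))) \<longlonglongrightarrow> (1 - norm z) * 0"
    by (rule tendsto_mult_left)
  then have "(\<lambda>m. complex_of_real ((1 - norm z) * inverse (real (Suc (Suc m))))) \<longlonglongrightarrow> complex_of_real ((1 - norm z) * 0)"
    by (rule tendsto_of_real)
  then have h_lim: "h \<longlonglongrightarrow> 0" by (simp add: h_def[abs_def])
  have zh: "z + h m \<in> unit_disc" for m
  proof -
    have "norm (h m) = (1 - norm z) * inverse (real (Suc (Suc m)))"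
      unfolding h_def norm_of_real using Suc.prems by (simp add: abs_mult del: of_nat_Suc)
    also have "\<dots> < (1 - norm z) * 1"
      using Suc.prems by (intro mult_strict_left_mono) (auto simp: inverse_less_1_iff)
    finally show ?thesis using norm_triangle_ineq[of z "h m"] by simp
  qed
  define T :: "nat \<Rightarrow> (complex \<Rightarrow> 'a) \<Rightarrow> 'a" where "T m f = inverse (h m) *\<^sub>C ((cderiv ^^ k) f (z + h m) - (cderiv ^^ k) f z)" for m f
  have "linear_on_into F UNIV (T m)" for m
    unfolding linear_on_into_def using smooth
    by (auto simp: T_def subset_iff cderiv_power_add cderiv_power_scaleC scaleC_fun_apply algebra_simps
        scaleC_add_right complex_vector.scale_right_diff_distrib)
  moreover have "\<exists>C. \<forall>f\<in>F. norm (T m f) \<le> C * NF f" for m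
  proof -
    obtain C1 where C1: "\<And>f. f \<in> F \<Longrightarrow> norm ((cderiv ^^ k) f (z + h m)) \<le> C1 * NF f"
      using Suc.IH[OF zh] by blast
    obtain C2 where C2: "\<And>f. f \<in> F \<Longrightarrow> norm ((cderiv ^^ k) f z) \<le> C2 * NF f"
      using Suc.IH[OF Suc.prems] by blast
    have "norm (T m f) \<le> (norm (inverse (h m)) * (C1 + C2)) * NF f" if "f \<in> F" for f
    proof -
      have "norm ((cderiv ^^ k) f (z + h m) - (cderiv ^^ k) f z) \<le> C1 * NF f + C2 * NF f"
        using C1[OF that] C2[OF that] norm_triangle_ineq4 order_trans add_mono by meson
      then have "norm (inverse (h m)) * norm ((cderiv ^^ k) f (z + h m) - (cderiv ^^ k) f z) \<le>
          norm (inverse (h m)) * (C1 * NF f + C2 * NF f)"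
        by (rule mult_left_mono) simp
      then show ?thesis by (simp only: T_def norm_scaleC distrib_right mult.assoc)
    qed
    then show ?thesis by blast
  qed
  moreover have "(\<lambda>m. T m f) \<longlonglongrightarrow> (cderiv ^^ Suc k) f z" if "f \<in> F" for f
  proof -
    have "cdiff_on_disc ((cderiv ^^ k) f)"
      using that smooth cderiv_power_smooth smooth_cdiff by blast
    then have "has_cderiv ((cderiv ^^ k) f) ((cderiv ^^ Suc k) f z) z"
      using Suc.prems by (simp add: cdiff_on_disc_def)
    from has_cderiv_difference_quotient[OF this h0 h_lim] show ?thesis by (simp only: T_def)
  qed
  ultimately obtain C where "C \<ge> 0" "\<And>f. f \<in> F \<Longrightarrow> norm ((cderiv ^^ Suc k) f z) \<le> C * NF f"
    using bounded_linear_pointwise_limit[OF banach, of T "\<lambda>f. (cderiv ^^ Suc k) f z"] by blast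
  then show ?case by blast
qed

lemma divided_deriv_bound:
  assumes "z \<in> unit_disc"
  shows "\<exists>C\<ge>0. \<forall>f\<in>F. norm (divided_deriv k f z) \<le> C * NF f"
proof -
  obtain C where C: "C \<ge> 0" "\<And>f. f \<in> F \<Longrightarrow> norm ((cderiv ^^ k) f z) \<le> C * NF f"
    using cderiv_power_bound[OF assms] by blast
  have "norm (divided_deriv k f z) \<le> C / fact k * NF f" if "f \<in> F" for f
    using C(2)[OF that] by (simp add: divided_deriv_def scaleC_fun_apply norm_scaleC norm_divide field_simps)
  then show ?thesis using C(1) by (intro exI[of _ "C / fact k"]) auto
qed

lemma rochberg_sum_eval_bound:
  assumes z: "z \<in> unit_disc"
  shows "\<exists>C. \<forall>g\<in>tuples_in n F. tuple_norm n (rochberg_sum n g z) \<le> C * sum_norm n NF g"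
proof -
  obtain C where C: "\<And>k. C k \<ge> 0" "\<And>k f. f \<in> F \<Longrightarrow> norm (divided_deriv k f z) \<le> C k * NF f"
    using divided_deriv_bound[OF z] by metis
  \<comment> \<open>A common bound for the orders below \<open>n\<close>, the only ones that occur
    in an entry.\<close>
  define K where "K = (\<Sum>k<n. C k)"
  have CK: "C k \<le> K" if "k < n" for k
    unfolding K_def using that C(1) by (intro member_le_sum) auto
  have K: "K \<ge> 0" unfolding K_def using C(1) by (intro sum_nonneg) auto
  have "tuple_norm n (rochberg_sum n g z) \<le> (real n * K) * sum_norm n NF g" if g: "g \<in> tuples_in n F" for g
  proof -
    have "norm (rochberg_sum n g z i) \<le> K * sum_norm n NF g" if i: "i < n" for i
    proof -
      have "norm (rochberg_sum n g z i) \<le> (\<Sum>j\<le>i. norm (divided_deriv (i - j) (g j) z))"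
        using i by (simp add: rochberg_sum_def norm_sum)
      also have "\<dots> \<le> (\<Sum>j\<le>i. K * NF (g j))"
      proof (rule sum_mono)
        fix j assume "j \<in> {..i}"
        then have gj: "g j \<in> F" using g i by (auto simp: tuples_in_def)
        have "norm (divided_deriv (i - j) (g j) z) \<le> C (i - j) * NF (g j)" using C(2)[OF gj] .
        also have "\<dots> \<le> K * NF (g j)"
          using i nonneg[OF gj] by (intro mult_right_mono CK) auto
        finally show "norm (divided_deriv (i - j) (g j) z) \<le> K * NF (g j)" .
      qed
      also have "\<dots> \<le> (\<Sum>j<n. K * NF (g j))"
        using i g K by (intro sum_mono2) (auto simp: tuples_in_def nonneg)
      finally show ?thesis by (simp add: sum_norm_def sum_distrib_left)
    qed
    then have "(\<Sum>i<n. norm (rochberg_sum n g z i)) \<le> (\<Sum>i<n. K * sum_norm n NF g)"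
      by (intro sum_mono) simp
    then show ?thesis by (simp add: tuple_norm_def)
  qed
  then show ?thesis by blast
qed

lemma multiplier_mem:
  assumes "a \<in> A_infinity" "g \<in> tuples_in n F"
  shows "multiplier n a g \<in> tuples_in n F"
  using assms by (auto simp: tuples_in_def tuples_def multiplier_def
      intro!: mem_sum mult_mem signed_divided_deriv)

lemma multiplier_bound:
  obtains \<alpha> C where "\<alpha> > 0" "C \<ge> 0"
    "\<And>a g. a \<in> A_infinity \<Longrightarrow> g \<in> tuples_in n F \<Longrightarrow>
      sum_norm n NF (multiplier n a g) \<le> C * A_infinity_norm \<alpha> a * sum_norm n NF g"
proof -
  obtain \<alpha> C where \<alpha>: "\<alpha> > 0" and C: "C \<ge> 0"
    and bound: "\<And>a f. a \<in> A_infinity \<Longrightarrow> f \<in> F \<Longrightarrow> NF (pointwise_mult a f) \<le> C * A_infinity_norm \<alpha> a * NF f"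
    using mult_bound by blast
  show thesis
  \<comment> \<open>The matrix entries involve fewer than \<open>n\<close> derivatives of
    \<open>a\<close>, each costing one unit of the exponent; the factor \<open>real n\<close> comes
    from adding up the rows.\<close>
  proof (rule that[of "\<alpha> + real n" "real n * C"])
    fix a g assume a: "a \<in> A_infinity" and g: "g \<in> tuples_in n F"
    define A where "A = A_infinity_norm (\<alpha> + real n) a"
    have A: "A \<ge> 0"
      using \<alpha> a normed_on.nonneg[OF normed_on_A_infinity, of "\<alpha> + real n" a] by (simp add: A_def)
    have "NF (multiplier n a g j) \<le> C * A * sum_norm n NF g" if j: "j < n" for j
    proof -
      have gk: "g k \<in> F" if "k \<in> {..j}" for k using that g j by (auto simp: tuples_in_def)
      have "NF (multiplier n a g j) \<le>
          (\<Sum>k\<le>j. NF (pointwise_mult ((-1) ^ (j - k) *\<^sub>C divided_deriv (j - k) a) (g k)))"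
        using j gk a by (auto simp: multiplier_def intro!: norm_sum_le mult_mem signed_divided_deriv)
      also have "\<dots> \<le> (\<Sum>k\<le>j. C * A * NF (g k))"
      proof (rule sum_mono)
        fix k assume k: "k \<in> {..j}"
        have "NF (pointwise_mult ((-1) ^ (j - k) *\<^sub>C divided_deriv (j - k) a) (g k)) \<le>
            C * A_infinity_norm \<alpha> ((-1) ^ (j - k) *\<^sub>C divided_deriv (j - k) a) * NF (g k)"
          by (intro bound signed_divided_deriv a gk[OF k])
        also have "A_infinity_norm \<alpha> ((-1) ^ (j - k) *\<^sub>C divided_deriv (j - k) a) \<le> A"
        proof -
          have "j - k \<le> n" using j by linarith
          then show ?thesis
            using signed_divided_deriv(2)[OF a \<alpha>, of "j - k"]
              A_infinity_norm_mono[OF a, of "\<alpha> + real (j - k)" "\<alpha> + real n"] \<alpha>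
            by (simp add: A_def)
        qed
        finally show "NF (pointwise_mult ((-1) ^ (j - k) *\<^sub>C divided_deriv (j - k) a) (g k)) \<le> C * A * NF (g k)"
          using C nonneg[OF gk[OF k]] by (simp add: mult_left_mono mult_right_mono)
      qed
      also have "\<dots> \<le> (\<Sum>k<n. C * A * NF (g k))"
        using j g A C by (intro sum_mono2) (auto simp: tuples_in_def nonneg)
      finally show ?thesis by (simp add: sum_norm_def sum_distrib_left)
    qed
    then have "(\<Sum>j<n. NF (multiplier n a g j)) \<le> (\<Sum>j<n. C * A * sum_norm n NF g)"
      by (intro sum_mono) simp
    then show "sum_norm n NF (multiplier n a g) \<le>
        real n * C * A_infinity_norm (\<alpha> + real n) a * sum_norm n NF g"
      by (simp add: sum_norm_def A_def mult.assoc)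
  qed (use \<alpha> C in auto)
qed

text \<open>The matrix of \<open>multiplier n b\<close> is triangular with \<open>b\<close> on the diagonal, so it can be
  inverted by recursion wherever division by \<open>b\<close> is possible.\<close>

lemma multiplier_inverse_bound:
  assumes b: "b \<in> A_infinity" and K: "K > 0"
    and divide: "\<And>f. f \<in> analytic_on_disc UNIV norm \<Longrightarrow> pointwise_mult b f \<in> F \<Longrightarrow>
      f \<in> F \<and> NF f \<le> K * NF (pointwise_mult b f)"
    and j: "j < n"
  shows "\<exists>L\<ge>0. \<forall>g\<in>tuples_in n (analytic_on_disc UNIV norm). multiplier n b g \<in> tuples_in n F \<longrightarrow>
    g j \<in> F \<and> NF (g j) \<le> L * sum_norm n NF (multiplier n b g)"
  using j
proof (induction j rule: less_induct)
  case (less j)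
  obtain \<alpha> C where \<alpha>: "\<alpha> > 0" and C: "C \<ge> 0"
    and bound: "\<And>a f. a \<in> A_infinity \<Longrightarrow> f \<in> F \<Longrightarrow> NF (pointwise_mult a f) \<le> C * A_infinity_norm \<alpha> a * NF f"
    using mult_bound by blast
  have "\<forall>k\<in>{..<j}. \<exists>L\<ge>0. \<forall>g\<in>tuples_in n (analytic_on_disc UNIV norm). multiplier n b g \<in> tuples_in n F \<longrightarrow>
      g k \<in> F \<and> NF (g k) \<le> L * sum_norm n NF (multiplier n b g)"
    using less by auto
  then obtain L where L: "\<And>k. k < j \<Longrightarrow> L k \<ge> 0"
    "\<And>k g. k < j \<Longrightarrow> g \<in> tuples_in n (analytic_on_disc UNIV norm) \<Longrightarrow> multiplier n b g \<in> tuples_in n F \<Longrightarrow>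
      g k \<in> F \<and> NF (g k) \<le> L k * sum_norm n NF (multiplier n b g)"
    unfolding bchoice_iff lessThan_iff by blast
  define c where "c k = (-1) ^ (j - k) *\<^sub>C divided_deriv (j - k) b" for k
  have c: "c k \<in> A_infinity" for k unfolding c_def by (intro signed_divided_deriv b)
  define B where "B k = C * A_infinity_norm \<alpha> (c k)" for k
  have B: "B k \<ge> 0" for k
    using C normed_on.nonneg[OF normed_on_A_infinity[OF \<alpha>] c] by (simp add: B_def)
  \<comment> \<open>Row \<open>j\<close> reads \<open>b g_j = h_j - (\<Sum>k<j. c_k g_k)\<close>.
    The 1 accounts for \<open>h_j\<close>, the sum for the coordinates already bounded, and
    \<open>K\<close> for the division by \<open>b\<close>.\<close>
  define M where "M = K * (1 + (\<Sum>k<j. B k * L k))"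
  have M: "M \<ge> 0"
    unfolding M_def using K B L(1) by (intro mult_nonneg_nonneg add_nonneg_nonneg sum_nonneg) auto
  have "g j \<in> F \<and> NF (g j) \<le> M * sum_norm n NF (multiplier n b g)"
    if g: "g \<in> tuples_in n (analytic_on_disc UNIV norm)" and h: "multiplier n b g \<in> tuples_in n F" for g
  proof -
    define h where "h = multiplier n b g"
    define S where "S = sum_norm n NF h"
    have h: "h j \<in> F" "NF (h j) \<le> S"
      using h less.prems sum_norm_component_le[OF normed_on_axioms h, of j]
      by (auto simp: h_def S_def tuples_in_def)
    have gk: "g k \<in> F" "NF (g k) \<le> L k * S" if "k < j" for k
      using L(2)[OF that g] \<open>multiplier n b g \<in> tuples_in n F\<close> by (auto simp: S_def h_def)
    have ck: "pointwise_mult (c k) (g k) \<in> F" if "k < j" for k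
      using c gk[OF that] by (intro mult_mem)
    have "h j = (\<Sum>k\<le>j. pointwise_mult (c k) (g k))"
      using less.prems by (simp add: h_def multiplier_def c_def)
    also have "\<dots> = (\<Sum>k<j. pointwise_mult (c k) (g k)) + pointwise_mult (c j) (g j)"
      by (simp flip: lessThan_Suc_atMost)
    also have "c j = b" by (simp add: c_def scaleC_one)
    finally have eq: "pointwise_mult b (g j) = h j - (\<Sum>k<j. pointwise_mult (c k) (g k))"
      by (metis add_diff_cancel_left')
    have mem: "pointwise_mult b (g j) \<in> F"
      unfolding eq using h(1) ck by (intro mem_diff mem_sum) auto
    have "NF (pointwise_mult b (g j)) \<le> NF (h j) + NF (\<Sum>k<j. pointwise_mult (c k) (g k))"
      unfolding eq using h(1) ck by (intro triangle_diff mem_sum) auto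
    also have "\<dots> \<le> S + (\<Sum>k<j. NF (pointwise_mult (c k) (g k)))"
      using h(2) ck by (intro add_mono norm_sum_le) auto
    also have "(\<Sum>k<j. NF (pointwise_mult (c k) (g k))) \<le> (\<Sum>k<j. B k * L k * S)"
    proof (rule sum_mono)
      fix k assume k: "k \<in> {..<j}"
      then have "NF (pointwise_mult (c k) (g k)) \<le> B k * NF (g k)"
        unfolding B_def using gk by (intro bound c) auto
      also have "\<dots> \<le> B k * (L k * S)"
        using k B gk by (intro mult_left_mono) auto
      finally show "NF (pointwise_mult (c k) (g k)) \<le> B k * L k * S" by (simp add: mult.assoc)
    qed
    finally have le: "NF (pointwise_mult b (g j)) \<le> (1 + (\<Sum>k<j. B k * L k)) * S"
      by (simp add: distrib_right sum_distrib_right)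
    have "g j \<in> analytic_on_disc UNIV norm" using g less.prems by (rule tuples_in_nth)
    from divide[OF this mem] have "g j \<in> F" "NF (g j) \<le> K * NF (pointwise_mult b (g j))" by auto
    moreover have "K * NF (pointwise_mult b (g j)) \<le> K * ((1 + (\<Sum>k<j. B k * L k)) * S)"
      using le K by (intro mult_left_mono) auto
    ultimately show ?thesis by (simp add: M_def S_def h_def mult.assoc)
  qed
  with M show ?case by blast
qed

text \<open>The division half of the invariance condition, restated for the factor that lies in
  \<open>A_infinity\<close>, as the triangular inversion requires.\<close>

lemma automorphism_divide:
  assumes "conformal_automorphism \<phi>"
  obtains K where "K > 0" "\<And>f. f \<in> analytic_on_disc UNIV norm \<Longrightarrow> pointwise_mult (restrict_disc \<phi>) f \<in> F \<Longrightarrow>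
      f \<in> F \<and> NF f \<le> K * NF (pointwise_mult (restrict_disc \<phi>) f)"
proof -
  obtain K where K: "K > 0" "\<And>f. f \<in> analytic_on_disc UNIV norm \<Longrightarrow> pointwise_mult \<phi> f \<in> F \<Longrightarrow>
      f \<in> F \<and> NF f \<le> K * NF (pointwise_mult \<phi> f)"
    using acceptable assms unfolding acceptable_space_def by meson
  show thesis
  proof (rule that[OF K(1)])
    fix f assume f: "f \<in> analytic_on_disc UNIV norm" "pointwise_mult (restrict_disc \<phi>) f \<in> F"
    have "pointwise_mult (restrict_disc \<phi>) f = pointwise_mult \<phi> f"
      using f by (intro pointwise_mult_restrict_disc) (simp add: analytic_on_disc_iff)
    with K(2) f show "f \<in> F \<and> NF f \<le> K * NF (pointwise_mult (restrict_disc \<phi>) f)" by simp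
  qed
qed

text \<open>In coordinates, one direction and its estimate are the boundedness of the multiplier
  matrix, the other direction and its estimate are the inversion of that matrix.\<close>

lemma rochberg_sum_automorphism:
  assumes \<phi>: "conformal_automorphism \<phi>"
    and M: "\<And>g. g \<in> tuples_in (Suc n) F \<Longrightarrow> M (rochberg_sum (Suc n) g) = sum_norm (Suc n) NF g"
  defines "S \<equiv> rochberg_sum (Suc n) ` tuples_in (Suc n) F"
  shows "\<exists>K>0. \<forall>G\<in>analytic_tuples (Suc n). (pointwise_mult \<phi> G \<in> S \<longleftrightarrow> G \<in> S) \<and>
    (G \<in> S \<longrightarrow> inverse K * M (pointwise_mult \<phi> G) \<le> M G \<and> M G \<le> K * M (pointwise_mult \<phi> G))"
proof -
  define b where "b = restrict_disc \<phi>"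
  have b: "b \<in> A_infinity" unfolding b_def using \<phi> by (rule conformal_automorphism_in_A_infinity)
  obtain K where K: "K > 0" "\<And>f. f \<in> analytic_on_disc UNIV norm \<Longrightarrow> pointwise_mult b f \<in> F \<Longrightarrow>
      f \<in> F \<and> NF f \<le> K * NF (pointwise_mult b f)"
    using automorphism_divide[OF \<phi>] unfolding b_def by blast
  have "\<forall>j\<in>{..<Suc n}. \<exists>L\<ge>0. \<forall>g\<in>tuples_in (Suc n) (analytic_on_disc UNIV norm).
      multiplier (Suc n) b g \<in> tuples_in (Suc n) F \<longrightarrow>
      g j \<in> F \<and> NF (g j) \<le> L * sum_norm (Suc n) NF (multiplier (Suc n) b g)"
    using multiplier_inverse_bound[OF b K] by auto
  then obtain L where L: "\<And>j. j < Suc n \<Longrightarrow> L j \<ge> 0"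
    "\<And>j g. j < Suc n \<Longrightarrow> g \<in> tuples_in (Suc n) (analytic_on_disc UNIV norm) \<Longrightarrow>
      multiplier (Suc n) b g \<in> tuples_in (Suc n) F \<Longrightarrow>
      g j \<in> F \<and> NF (g j) \<le> L j * sum_norm (Suc n) NF (multiplier (Suc n) b g)"
    unfolding bchoice_iff lessThan_iff by blast
  obtain \<alpha> C where \<alpha>: "\<alpha> > 0" "C \<ge> 0" and bound: "\<And>a g. a \<in> A_infinity \<Longrightarrow> g \<in> tuples_in (Suc n) F \<Longrightarrow>
      sum_norm (Suc n) NF (multiplier (Suc n) a g) \<le> C * A_infinity_norm \<alpha> a * sum_norm (Suc n) NF g"
    using multiplier_bound[of "Suc n"] by blast
  define B where "B = C * A_infinity_norm \<alpha> b"
  define L' where "L' = (\<Sum>j<Suc n. L j)"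
  have B: "B \<ge> 0" using \<alpha> normed_on.nonneg[OF normed_on_A_infinity b] by (simp add: B_def)
  have L': "L' \<ge> 0" unfolding L'_def using L(1) by (intro sum_nonneg) auto
  \<comment> \<open>One constant has to serve both inequalities, \<open>B\<close> for multiplication
    and \<open>L'\<close> for division; the 1 ensures that it is positive.\<close>
  define K' where "K' = B + L' + 1"
  have K': "K' > 0" "B \<le> K'" "L' \<le> K'" using B L' by (auto simp: K'_def)
  note sum_nonneg' = normed_on.nonneg[OF normed_on_tuples_in[OF normed_on_axioms]]
  have main: "(pointwise_mult \<phi> G \<in> S \<longleftrightarrow> G \<in> S) \<and>
    (G \<in> S \<longrightarrow> inverse K' * M (pointwise_mult \<phi> G) \<le> M G \<and> M G \<le> K' * M (pointwise_mult \<phi> G))"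
    if G: "G \<in> analytic_tuples (Suc n)" for G
  proof -
    have "G \<in> analytic_on_disc (tuples (Suc n)) (tuple_norm (Suc n))"
      using G by (simp only: analytic_on_disc_tuples)
    then have eq: "pointwise_mult \<phi> G = pointwise_mult b G"
      unfolding b_def by (intro pointwise_mult_restrict_disc[symmetric])
        (simp add: analytic_on_disc_def vanishes_off_disc_def)
    obtain g where g: "g \<in> tuples_in (Suc n) (analytic_on_disc UNIV norm)" "G = rochberg_sum (Suc n) g"
      using analytic_tuples_subset_rochberg_sum G by blast
    have g_smooth: "g \<in> tuples_in (Suc n) smooth_on_disc"
      using g(1) tuples_in_mono analytic_smooth by blast
    have mult: "pointwise_mult \<phi> G = rochberg_sum (Suc n) (multiplier (Suc n) b g)"
      using eq g(2) pointwise_mult_rochberg_sum[OF A_infinity_smooth[OF b] g_smooth] by metis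
    have F_smooth: "tuples_in (Suc n) F \<subseteq> tuples_in (Suc n) smooth_on_disc"
      using smooth by (rule tuples_in_mono)
    \<comment> \<open>Coordinates are unique among smooth families, so a preimage of
      \<open>G\<close> with entries in \<open>F\<close> can only be \<open>g\<close>, which so far
      is known to be merely analytic.\<close>
    have "G \<in> S \<longleftrightarrow> g \<in> tuples_in (Suc n) F"
      unfolding S_def g(2) using F_smooth g_smooth rochberg_sum_inj by blast
    moreover have "pointwise_mult \<phi> G \<in> S \<longleftrightarrow> multiplier (Suc n) b g \<in> tuples_in (Suc n) F"
      unfolding S_def mult using F_smooth multiplier_smooth[OF A_infinity_smooth[OF b] g_smooth]
        rochberg_sum_inj by blast
    moreover have "multiplier (Suc n) b g \<in> tuples_in (Suc n) F" if "g \<in> tuples_in (Suc n) F"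
      using multiplier_mem[OF b that] .
    moreover have "g \<in> tuples_in (Suc n) F" if "multiplier (Suc n) b g \<in> tuples_in (Suc n) F"
      using L(2)[OF _ g(1) that] g(1) by (simp add: tuples_in_def)
    moreover have "inverse K' * M (pointwise_mult \<phi> G) \<le> M G \<and> M G \<le> K' * M (pointwise_mult \<phi> G)"
      if gF: "g \<in> tuples_in (Suc n) F" and h: "multiplier (Suc n) b g \<in> tuples_in (Suc n) F"
    proof
      have MG: "M G = sum_norm (Suc n) NF g"
        and MphiG: "M (pointwise_mult \<phi> G) = sum_norm (Suc n) NF (multiplier (Suc n) b g)"
        unfolding mult by (simp_all add: g(2) M gF h)
      have "M (pointwise_mult \<phi> G) \<le> B * M G"
        unfolding MG MphiG B_def by (rule bound[OF b gF])
      also have "\<dots> \<le> K' * M G"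
        unfolding MG by (intro mult_right_mono K' sum_nonneg' gF)
      finally show "inverse K' * M (pointwise_mult \<phi> G) \<le> M G"
        using K'(1) by (simp add: field_simps)
      have "sum_norm (Suc n) NF g \<le> (\<Sum>j<Suc n. L j * sum_norm (Suc n) NF (multiplier (Suc n) b g))"
        unfolding sum_norm_def[of _ _ g] using L(2)[OF _ g(1) h] by (intro sum_mono) auto
      also have "\<dots> = L' * sum_norm (Suc n) NF (multiplier (Suc n) b g)"
        by (simp only: L'_def sum_distrib_right)
      also have "\<dots> \<le> K' * sum_norm (Suc n) NF (multiplier (Suc n) b g)"
        by (intro mult_right_mono K' sum_nonneg' h)
      finally show "M G \<le> K' * M (pointwise_mult \<phi> G)"
        unfolding MG MphiG .
    qed
    ultimately show ?thesis by blast
  qed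
  with K'(1) show ?thesis by blast
qed

text \<open>The norm \<open>M\<close> is prescribed on the image of \<open>rochberg_sum\<close>
  only, which is all that is known of \<open>iterated_norm\<close>. Completeness comes from the
  isometry with an l1-sum, the other axioms from estimates on coordinates.\<close>

lemma acceptable_rochberg_sum:
  assumes M: "\<And>g. g \<in> tuples_in (Suc n) F \<Longrightarrow> M (rochberg_sum (Suc n) g) = sum_norm (Suc n) NF g"
  shows "acceptable_space (tuples (Suc n)) (tuple_norm (Suc n)) (rochberg_sum (Suc n) ` tuples_in (Suc n) F) M"
proof -
  define S where "S = rochberg_sum (Suc n) ` tuples_in (Suc n) F"
  have tuples: "complex_banach_on (tuples (Suc n)) (tuple_norm (Suc n) :: (nat \<Rightarrow> 'a) \<Rightarrow> real)"
    using complex_banach_on_tuples_in[OF complex_banach_on_UNIV, of "Suc n"]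
    by (simp only: tuples_in_UNIV sum_norm_eq_tuple_norm)
  have F_smooth: "tuples_in (Suc n) F \<subseteq> tuples_in (Suc n) smooth_on_disc"
    using smooth by (rule tuples_in_mono)
  have S: "complex_banach_on S M"
    unfolding S_def
  proof (rule complex_banach_on_isometric_image[where N = "sum_norm (Suc n) NF"])
    show "complex_banach_on (tuples_in (Suc n) F) (sum_norm (Suc n) NF)"
      by (rule complex_banach_on_tuples_in[OF banach])
    show "M (rochberg_sum (Suc n) g) = sum_norm (Suc n) NF g" if "g \<in> tuples_in (Suc n) F" for g
      using that by (rule M)
    show "linear_on_into (tuples_in (Suc n) F) UNIV (rochberg_sum (Suc n))"
      using linear_rochberg_sum F_smooth by (rule linear_on_into_subset)
    show "g = 0" if "g \<in> tuples_in (Suc n) F" "rochberg_sum (Suc n) g = 0" for g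
      using rochberg_sum_eq_0 F_smooth that by blast
  qed
  note S_normed = complex_banach_onD(1)[OF S]
  have "S \<subseteq> analytic_on_disc (tuples (Suc n)) (tuple_norm (Suc n))"
    unfolding S_def analytic_on_disc_tuples
    using rochberg_sum_analytic tuples_in_mono[OF analytic] by blast
  moreover have "continuous_map (norm_topology S M) (norm_topology (tuples (Suc n)) (tuple_norm (Suc n))) (\<lambda>G. G z)"
    if z: "z \<in> unit_disc" for z
  proof -
    obtain C where "\<And>g. g \<in> tuples_in (Suc n) F \<Longrightarrow>
        tuple_norm (Suc n) (rochberg_sum (Suc n) g z) \<le> C * sum_norm (Suc n) NF g"
      using rochberg_sum_eval_bound[OF z] by blast
    then have "tuple_norm (Suc n) (G z) \<le> C * M G" if "G \<in> S" for G
      using that M by (auto simp: S_def)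
    moreover have "linear_on_into S (tuples (Suc n)) (\<lambda>G. G z)"
      by (auto simp: linear_on_into_def S_def scaleC_fun_apply rochberg_sum_in_tuples)
    ultimately show ?thesis
      by (intro continuous_map_if_bounded_linear[OF S_normed complex_banach_onD(1)[OF tuples]])
  qed
  moreover have mult: "pointwise_mult a (rochberg_sum (Suc n) g) = rochberg_sum (Suc n) (multiplier (Suc n) a g)"
    if "a \<in> A_infinity" "g \<in> tuples_in (Suc n) F" for a g
    using pointwise_mult_rochberg_sum A_infinity_smooth F_smooth that by blast
  then have closed: "pointwise_mult a G \<in> S" if "a \<in> A_infinity" "G \<in> S" for a G
    using that multiplier_mem by (auto simp: S_def)
  moreover have "continuous_map (prod_topology A_infinity_topology (norm_topology S M)) (norm_topology S M)
      (\<lambda>(a, G). pointwise_mult a G)"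
  proof -
    obtain \<alpha> C where \<alpha>: "\<alpha> > 0" "C \<ge> 0" and bound: "\<And>a g. a \<in> A_infinity \<Longrightarrow> g \<in> tuples_in (Suc n) F \<Longrightarrow>
        sum_norm (Suc n) NF (multiplier (Suc n) a g) \<le> C * A_infinity_norm \<alpha> a * sum_norm (Suc n) NF g"
      using multiplier_bound[of "Suc n"] by blast
    show ?thesis
    proof (rule A_infinity_module_continuous[OF S_normed \<alpha> closed])
      show "M (pointwise_mult a G) \<le> C * A_infinity_norm \<alpha> a * M G" if "a \<in> A_infinity" "G \<in> S" for a G
        using that by (auto simp: S_def mult M multiplier_mem bound)
    qed
  qed
  moreover have "\<exists>K>0. \<forall>G\<in>analytic_tuples (Suc n). (pointwise_mult \<phi> G \<in> S \<longleftrightarrow> G \<in> S) \<and>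
    (G \<in> S \<longrightarrow> inverse K * M (pointwise_mult \<phi> G) \<le> M G \<and> M G \<le> K * M (pointwise_mult \<phi> G))"
    if "conformal_automorphism \<phi>" for \<phi>
    unfolding S_def by (rule rochberg_sum_automorphism[OF that M])
  ultimately show ?thesis
    unfolding acceptable_space_def analytic_on_disc_tuples S_def[symmetric]
    using tuples S by blast
qed

section \<open>Comparison with the Rochberg spaces\<close>

lemma tau_representation:
  assumes z: "z \<in> unit_disc"
  obtains C where "C > 0" "\<And>g. g \<in> tuples_in n F \<Longrightarrow>
    \<exists>f\<in>F. tau n f z = rochberg_sum n g z \<and> NF f \<le> C * sum_norm n NF g"
proof -
  obtain \<alpha> C where \<alpha>: "\<alpha> > 0" and C: "C \<ge> 0"
    and bound: "\<And>a f. a \<in> A_infinity \<Longrightarrow> f \<in> F \<Longrightarrow> NF (pointwise_mult a f) \<le> C * A_infinity_norm \<alpha> a * NF f"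
    using mult_bound by blast
  define B where "B = C * A_infinity_norm \<alpha> (restrict_disc (\<lambda>w. w - z))"
  have B: "B \<ge> 0"
    using C normed_on.nonneg[OF normed_on_A_infinity[OF \<alpha>] restrict_disc_linear_in_A_infinity]
    by (simp add: B_def)
  have shift: "disc_shift z f \<in> F" "NF (disc_shift z f) \<le> B * NF f" if "f \<in> F" for f
    unfolding disc_shift_def B_def using that restrict_disc_linear_in_A_infinity
    by (auto intro: mult_mem bound)
  have shift_power: "(disc_shift z ^^ j) f \<in> F \<and> NF ((disc_shift z ^^ j) f) \<le> B ^ j * NF f" if "f \<in> F" for f j
  proof (induction j)
    case (Suc j)
    then have "NF (disc_shift z ((disc_shift z ^^ j) f)) \<le> B * NF ((disc_shift z ^^ j) f)"
      by (intro shift) simp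
    also have "\<dots> \<le> B * (B ^ j * NF f)" using Suc B by (intro mult_left_mono) auto
    finally show ?case using Suc shift by simp
  qed (use that in simp)
  \<comment> \<open>Dominates each power \<open>B ^ j\<close> with \<open>j < n\<close>, whether
    \<open>B\<close> is below or above 1; the added 1 keeps it positive even for
    \<open>n = 0\<close>.\<close>
  define D where "D = (\<Sum>j<n. B ^ j) + 1"
  have BD: "B ^ j \<le> D" if "j < n" for j
    using member_le_sum[of j "{..<n}" "\<lambda>j. B ^ j"] that B by (simp add: D_def)
  have D: "D > 0" using B by (simp add: D_def add_nonneg_pos sum_nonneg)
  show thesis
  proof (rule that[OF D])
    fix g assume g: "g \<in> tuples_in n F"
    then have gF: "g j \<in> F" if "j < n" for j using that by (rule tuples_in_nth)
    define f where "f = (\<Sum>j<n. (disc_shift z ^^ j) (g j))"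
    have f: "f \<in> F" unfolding f_def using shift_power gF by (intro mem_sum) auto
    have "NF f \<le> (\<Sum>j<n. NF ((disc_shift z ^^ j) (g j)))"
      unfolding f_def using shift_power gF by (intro norm_sum_le) auto
    also have "\<dots> \<le> (\<Sum>j<n. D * NF (g j))"
    proof (rule sum_mono)
      fix j assume "j \<in> {..<n}"
      then have j: "j < n" by simp
      have "NF ((disc_shift z ^^ j) (g j)) \<le> B ^ j * NF (g j)" using shift_power[OF gF[OF j]] by simp
      also have "\<dots> \<le> D * NF (g j)" by (intro mult_right_mono BD j nonneg gF)
      finally show "NF ((disc_shift z ^^ j) (g j)) \<le> D * NF (g j)" .
    qed
    finally have "NF f \<le> D * sum_norm n NF g" by (simp add: sum_norm_def sum_distrib_left)
    moreover have "tau n f z i = rochberg_sum n g z i" for i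
    proof (cases "i < n")
      case True
      have g_smooth: "g j \<in> smooth_on_disc" if "j < n" for j using gF[OF that] smooth by blast
      have "tau n f z i = divided_deriv i f z"
        using True by (simp add: tau_def divided_deriv_def scaleC_fun_apply)
      also have "\<dots> = (\<Sum>j<n. divided_deriv i ((disc_shift z ^^ j) (g j)) z)"
        unfolding f_def using g_smooth
        by (subst divided_deriv_sum) (auto simp: disc_shift_power_smooth sum_fun_apply)
      also have "\<dots> = (\<Sum>j<n. if j \<le> i then divided_deriv (i - j) (g j) z else 0)"
        using g_smooth z by (intro sum.cong refl divided_deriv_disc_shift_power) auto
      also have "\<dots> = (\<Sum>j\<in>{j\<in>{..<n}. j \<le> i}. divided_deriv (i - j) (g j) z)"
        by (rule sum.inter_filter[symmetric]) simp
      also have "{j\<in>{..<n}. j \<le> i} = {..i}" using True by auto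
      finally show ?thesis using True by (simp add: rochberg_sum_def)
    qed (simp add: tau_def rochberg_sum_def)
    ultimately show "\<exists>f\<in>F. tau n f z = rochberg_sum n g z \<and> NF f \<le> D * sum_norm n NF g"
      using f by (auto simp: fun_eq_iff)
  qed
qed

lemma tau_in_rochberg_sum:
  assumes "f \<in> F"
  shows "(\<lambda>i. if i = 0 then f else 0) \<in> tuples_in (Suc n) F"
    and "sum_norm (Suc n) NF (\<lambda>i. if i = 0 then f else 0) = NF f"
proof -
  show "(\<lambda>i. if i = 0 then f else 0) \<in> tuples_in (Suc n) F"
    using assms by (auto simp: tuples_in_def tuples_def)
  show "sum_norm (Suc n) NF (\<lambda>i. if i = 0 then f else 0) = NF f"
    unfolding sum_norm_def by (subst sum.lessThan_Suc_shift) simp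
qed

text \<open>Jets of members of \<open>F\<close> are among the competitors for the quotient norm of
  the iterated space, with the same norm, which gives one inequality with constant 1. Conversely
  each \<open>G\<close> can be replaced by a jet with the same value at \<open>z\<close>, at the
  cost of the factor \<open>C\<close>.\<close>

lemma rochberg_family:
  assumes z: "z \<in> unit_disc"
    and M: "\<And>g. g \<in> tuples_in (Suc n) F \<Longrightarrow> M (rochberg_sum (Suc n) g) = sum_norm (Suc n) NF g"
  defines "S \<equiv> rochberg_sum (Suc n) ` tuples_in (Suc n) F"
  shows "family_space S z = rochberg_space F (Suc n) z"
    and "equivalent_norms_on (rochberg_space F (Suc n) z) (family_norm S M z) (rochberg_norm F NF (Suc n) z)"
proof -
  obtain C where C: "C > 0" and rep: "\<And>g. g \<in> tuples_in (Suc n) F \<Longrightarrow>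
      \<exists>f\<in>F. tau (Suc n) f z = rochberg_sum (Suc n) g z \<and> NF f \<le> C * sum_norm (Suc n) NF g"
    using tau_representation[OF z] by blast
  have tau: "tau (Suc n) f \<in> S" "M (tau (Suc n) f) = NF f" if "f \<in> F" for f
    using tau_in_rochberg_sum[OF that] M by (auto simp: S_def tau_eq_rochberg_sum)
  have rep': "\<exists>f\<in>F. tau (Suc n) f z = G z \<and> NF f \<le> C * M G" if "G \<in> S" for G
    using that rep M by (auto simp: S_def)
  have M_nonneg: "M G \<ge> 0" if "G \<in> S" for G
    using that M normed_on.nonneg[OF normed_on_tuples_in[OF normed_on_axioms]] by (auto simp: S_def)
  show "family_space S z = rochberg_space F (Suc n) z"
  proof (intro equalityI subsetI)
    fix w assume "w \<in> family_space S z"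
    then show "w \<in> rochberg_space F (Suc n) z"
      using rep' by (force simp: family_space_def rochberg_space_def)
  next
    fix w assume "w \<in> rochberg_space F (Suc n) z"
    then show "w \<in> family_space S z"
      using tau(1) by (auto simp: family_space_def rochberg_space_def)
  qed
  have "1 * family_norm S M z w \<le> rochberg_norm F NF (Suc n) z w \<and>
      rochberg_norm F NF (Suc n) z w \<le> C * family_norm S M z w"
    if w: "w \<in> rochberg_space F (Suc n) z" for w
  proof -
    define P where "P = {M G | G. G \<in> S \<and> w = G z}"
    define Q where "Q = {NF f | f. f \<in> F \<and> w = tau (Suc n) f z}"
    \<comment> \<open>Every competitor \<open>f\<close> for the Rochberg norm yields the competitor
      \<open>tau (Suc n) f\<close> of equal norm, so the infimum over \<open>P\<close> is the
      smaller one.\<close>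
    have sub: "Q \<subseteq> P" using tau by (force simp: P_def Q_def)
    have Q: "Q \<noteq> {}" using w by (auto simp: Q_def rochberg_space_def)
    have P: "bdd_below P" using M_nonneg by (auto simp: P_def intro!: bdd_belowI[of _ 0])
    have bddQ: "bdd_below Q" using sub P by (rule bdd_below_mono[rotated])
    have "Inf P \<le> Inf Q" by (rule cInf_superset_mono[OF Q P sub])
    \<comment> \<open>Stated after division by \<open>C\<close>, so that it becomes a lower bound
      for all of \<open>P\<close>.\<close>
    moreover have "Inf Q / C \<le> Inf P"
    proof (rule cInf_greatest)
      show "P \<noteq> {}" using Q sub by blast
      fix x assume "x \<in> P"
      then obtain G where G: "G \<in> S" "w = G z" "x = M G" by (auto simp: P_def)
      then obtain f where "f \<in> F" "tau (Suc n) f z = w" "NF f \<le> C * x" using rep' by metis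
      then have "Inf Q \<le> C * x"
        using bddQ by (intro cInf_lower2[of "NF f"]) (auto simp: Q_def)
      then show "Inf Q / C \<le> x" using C by (simp add: field_simps)
    qed
    ultimately show ?thesis
      using C by (simp add: family_norm_def rochberg_norm_def quotient_norm_def P_def Q_def field_simps)
  qed
  then show "equivalent_norms_on (rochberg_space F (Suc n) z) (family_norm S M z) (rochberg_norm F NF (Suc n) z)"
    unfolding equivalent_norms_on_def using C by (metis zero_less_one)
qed

end

theorem proposition6p7:
  fixes F :: "(complex \<Rightarrow> 'a::complex_banach) set"
    and NF :: "(complex \<Rightarrow> 'a) \<Rightarrow> real"
    and n :: nat
  assumes "acceptable_space UNIV norm F NF"
    and "n \<ge> 1"
  shows "acceptable_space (tuples n) (tuple_norm n) (iterated_space F n) (iterated_norm NF n) \<and>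
    (\<forall>f\<in>F. tau n f \<in> iterated_space F n \<and> iterated_norm NF n (tau n f) = NF f) \<and>
    (\<forall>z\<in>unit_disc.
       family_space (iterated_space F n) z = rochberg_space F n z \<and>
       equivalent_norms_on (rochberg_space F n z)
         (family_norm (iterated_space F n) (iterated_norm NF n) z)
         (rochberg_norm F NF n z))"
proof -
  interpret acceptable F NF by unfold_locales (rule assms(1))
  obtain m where n: "n = Suc m" using assms(2) by (cases n) auto
  note space = iterated_space_eq[OF analytic, of m]
  note norm = iterated_norm_rochberg_sum[of NF m]
  show ?thesis
    unfolding n space
  proof (intro conjI ballI)
    show "acceptable_space (tuples (Suc m)) (tuple_norm (Suc m))
        (rochberg_sum (Suc m) ` tuples_in (Suc m) F) (iterated_norm NF (Suc m))"
      by (rule acceptable_rochberg_sum[OF norm])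
    show "tau (Suc m) f \<in> rochberg_sum (Suc m) ` tuples_in (Suc m) F"
      "iterated_norm NF (Suc m) (tau (Suc m) f) = NF f" if "f \<in> F" for f
      using tau_in_rochberg_sum[OF that] unfolding tau_eq_rochberg_sum norm by blast+
  qed (rule rochberg_family[OF _ norm], assumption)+
qed

end
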